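(* Let $M$ be as in the context (a closed connected orientable $C^\infty$ manifold of dimension $n\ge 2$ with volume form $\omega$ and a fixed finite regular conservative atlas), and let $N\subset M$ be a compact $n$-submanifold with connected $C^3$ boundary. Let $\Omega$ be either the interior of $N$ or the interior of a (compact $C^2$) collar of $\partial N$. Given $X\in\mathfrak{X}^r_\mu(M)$, $r\in\mathbb{Z}^+$, there exists $Z\in\mathfrak{X}^r_\mu(M)$, as $C^r$-close to $X$ as desired (i.e. for every $\epsilon>0$ there is such a $Z$ with $\|Z-X\|_{C^r}<\epsilon$), satisfying: (1) $Z$ is $C^\infty$ in $\Omega$; (2) $Z=X$ in $\Omega^{c}=M\setminus\Omega$.
   Context: Standing setting: $M$ is a second countable, Hausdorff, connected, orientable, closed (compact without boundary) $C^\infty$ manifold of dimension $n\ge 2$, equipped with a $C^\infty$ volume form $\omega$ and a fixed finite atlas $(V_i,\phi_i)_{i\le m}$ that is conservative (each $\phi_i$ pushes $\omega$ forward to the canonical volume form of $\mathbb{R}^n$, and $\phi_i(V_i)=\lambda\mathbb{B}^n$ for some constant $\lambda>0$, where $\mathbb{B}^n$ is the open unit ball) and regular (there is a larger conservative atlas $(W_i,\Phi_i)_{i\le m}$ with $\overline{V_i}\subset W_i$ and $\Phi_i|_{V_i}=\phi_i$). $\mu$ is the Lebesgue measure induced by $\omega$. $\mathfrak{X}^r_\mu(M)$ is the space of $C^r$ vector fields on $M$ that are divergence-free with respect to $\omega$. The Whitney $C^r$ norm is $\|X\|_{C^r}=\max_{j;\,0\le k\le r}\ \sup_{\phi_j(V_j)}\|D^kX_j\|$,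 where $X_j:\phi_j(V_j)\to\mathbb{R}^n$ is the expression of $X$ in the chart $(V_j,\phi_j)$, with $\|D^0X_j(x)\|=|X_j(x)|$ and $\|D^kX_j(x)\|=\max_{u_i\in\mathbb{S}^{n-1}}|D^kX_j(x;u_1,\dots,u_k)|$. Collars: given a compact $n$-submanifold $N\subset M$ with $C^{3}$ boundary, one may construct a $C^{2}$ vector field transverse to $\partial N$ and pointing inward, which in turn defines a $C^{2}$ collar embedding $\zeta:\partial N\times[0,\infty[\,\hookrightarrow N$ with $\zeta(x,0)=x$. For each $\epsilon>0$, $\zeta(\partial N\times[0,\epsilon])$ is a (compact $C^2$) collar of $\partial N$; its interior is $\zeta(\partial N\times\,]0,\epsilon[)$. *)

theory Defs
  imports "HOL-Analysis.Analysis"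
begin

subsection \<open>Functions of class \<open>C\<^sup>k\<close>\<close>

text \<open>
  The value \<open>iter_deriv f [u\<^sub>1, \<dots>, u\<^sub>k] x\<close> is \<open>D\<^sup>k f(x; u\<^sub>1, \<dots>, u\<^sub>k)\<close>. The set \<open>S\<close> in
  \<open>Ck_on k f S\<close> is meant to be open; only the values of \<open>f\<close> on \<open>S\<close> matter then.
\<close>

primrec iter_deriv ::
  "('a::euclidean_space \<Rightarrow> 'b::real_normed_vector) \<Rightarrow> 'a list \<Rightarrow> 'a \<Rightarrow> 'b" where
  "iter_deriv f [] = f"
| "iter_deriv f (u # us) = (\<lambda>x. frechet_derivative (iter_deriv f us) (at x) u)"

definition Ck_on ::
  "nat \<Rightarrow> ('a::euclidean_space \<Rightarrow> 'b::real_normed_vector) \<Rightarrow> 'a set \<Rightarrow> bool" where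
  "Ck_on k f S \<longleftrightarrow>
    (\<forall>us. length us < k \<longrightarrow> (\<forall>x\<in>S. iter_deriv f us differentiable at x)) \<and>
    (\<forall>us. length us \<le> k \<longrightarrow> continuous_on S (iter_deriv f us))"

definition smooth_on ::
  "('a::euclidean_space \<Rightarrow> 'b::real_normed_vector) \<Rightarrow> 'a set \<Rightarrow> bool" where
  "smooth_on f S \<longleftrightarrow> (\<forall>k. Ck_on k f S)"

definition deriv_norm ::
  "nat \<Rightarrow> ('a::euclidean_space \<Rightarrow> 'b::real_normed_vector) \<Rightarrow> 'a \<Rightarrow> real" where
  "deriv_norm k f x =
    (SUP us \<in> {us. length us = k \<and> set us \<subseteq> sphere 0 1}. norm (iter_deriv f us x))"


subsection \<open>Smooth structures\<close>

text \<open>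
  The manifold is the whole type \<open>'m\<close>, of dimension \<open>CARD('n)\<close>. A chart is a pair of a domain
  and a coordinate map, whose values outside the domain are irrelevant.
\<close>

type_synonym ('m, 'n) chart = "'m set \<times> ('m \<Rightarrow> real ^ 'n)"

abbreviation chart_dom :: "('m, 'n) chart \<Rightarrow> 'm set" where
  "chart_dom c \<equiv> fst c"

abbreviation chart_map :: "('m, 'n) chart \<Rightarrow> 'm \<Rightarrow> real ^ 'n" where
  "chart_map c \<equiv> snd c"

definition chart_img :: "('m, 'n) chart \<Rightarrow> (real ^ 'n) set" where
  "chart_img c = chart_map c ` chart_dom c"

definition chart_inv :: "('m, 'n) chart \<Rightarrow> real ^ 'n \<Rightarrow> 'm" where
  "chart_inv c = inv_into (chart_dom c) (chart_map c)"

definition is_chart :: "('m::topological_space, 'n::finite) chart \<Rightarrow> bool" where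
  "is_chart c \<longleftrightarrow> open (chart_dom c) \<and> open (chart_img c) \<and>
    homeomorphism (chart_dom c) (chart_img c) (chart_map c) (chart_inv c)"

definition transition :: "('m, 'n) chart \<Rightarrow> ('m, 'n) chart \<Rightarrow> real ^ 'n \<Rightarrow> real ^ 'n" where
  "transition c d = chart_map d \<circ> chart_inv c"

definition Ck_compatible :: "nat \<Rightarrow> ('m, 'n::finite) chart \<Rightarrow> ('m, 'n) chart \<Rightarrow> bool" where
  "Ck_compatible k c d \<longleftrightarrow>
    Ck_on k (transition c d) (chart_map c ` (chart_dom c \<inter> chart_dom d)) \<and>
    Ck_on k (transition d c) (chart_map d ` (chart_dom c \<inter> chart_dom d))"

definition smooth_atlas :: "('m::topological_space, 'n::finite) chart set \<Rightarrow> bool" where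
  "smooth_atlas A \<longleftrightarrow> (\<forall>c\<in>A. is_chart c) \<and> (\<Union>c\<in>A. chart_dom c) = UNIV \<and>
    (\<forall>c\<in>A. \<forall>d\<in>A. \<forall>k. Ck_compatible k c d)"

definition smooth_structure :: "('m::topological_space, 'n::finite) chart set \<Rightarrow> bool" where
  "smooth_structure A \<longleftrightarrow> smooth_atlas A \<and>
    (\<forall>c. is_chart c \<and> (\<forall>d\<in>A. \<forall>k. Ck_compatible k c d) \<longrightarrow> c \<in> A)"

definition orientable :: "('m, 'n::finite) chart set \<Rightarrow> bool" where
  "orientable A \<longleftrightarrow> (\<exists>B\<subseteq>A. (\<Union>c\<in>B. chart_dom c) = UNIV \<and>
    (\<forall>c\<in>B. \<forall>d\<in>B. \<forall>p \<in> chart_dom c \<inter> chart_dom d.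
      det (matrix (frechet_derivative (transition c d) (at (chart_map c p)))) > 0))"


subsection \<open>Tangent vectors, vector fields and top-degree forms\<close>

text \<open>
  A tangent vector at \<open>p\<close> is the family of its coordinate vectors in all charts of the smooth
  structure around \<open>p\<close>, related by the derivatives of the transition maps. The family is
  set to \<open>0\<close> at all other charts, so that equality of tangent vectors is equality of functions.
\<close>

type_synonym ('m, 'n) tvec = "('m, 'n) chart \<Rightarrow> real ^ 'n"
type_synonym ('m, 'n) vfield = "'m \<Rightarrow> ('m, 'n) tvec"

text \<open>An \<open>n\<close>-form takes families of tangent vectors indexed by the coordinate type \<open>'n\<close> itself.\<close>

type_synonym ('m, 'n) topform = "'m \<Rightarrow> ('n \<Rightarrow> ('m, 'n) tvec) \<Rightarrow> real"

definition tangent_space ::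
  "('m, 'n::finite) chart set \<Rightarrow> 'm \<Rightarrow> ('m, 'n) tvec set" where
  "tangent_space A p = {v.
    (\<forall>c. \<not> (c \<in> A \<and> p \<in> chart_dom c) \<longrightarrow> v c = 0) \<and>
    (\<forall>c\<in>A. \<forall>d\<in>A. p \<in> chart_dom c \<inter> chart_dom d \<longrightarrow>
      v d = frechet_derivative (transition c d) (at (chart_map c p)) (v c))}"

text \<open>The tangent vector at \<open>p\<close> whose coordinate vector in the chart \<open>c\<close> is \<open>u\<close>:\<close>

definition tangent_of ::
  "('m, 'n::finite) chart set \<Rightarrow> ('m, 'n) chart \<Rightarrow> 'm \<Rightarrow> real ^ 'n \<Rightarrow> ('m, 'n) tvec" where
  "tangent_of A c p u = (\<lambda>d. if d \<in> A \<and> p \<in> chart_dom d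
     then frechet_derivative (transition c d) (at (chart_map c p)) u else 0)"

definition local_field ::
  "('m, 'n) chart \<Rightarrow> ('m, 'n) vfield \<Rightarrow> real ^ 'n \<Rightarrow> real ^ 'n" where
  "local_field c X = (\<lambda>x. X (chart_inv c x) c)"

definition vector_field :: "('m, 'n::finite) chart set \<Rightarrow> ('m, 'n) vfield \<Rightarrow> bool" where
  "vector_field A X \<longleftrightarrow> (\<forall>p. X p \<in> tangent_space A p)"

definition Ck_field_on ::
  "('m, 'n::finite) chart set \<Rightarrow> nat \<Rightarrow> ('m, 'n) vfield \<Rightarrow> 'm set \<Rightarrow> bool" where
  "Ck_field_on A k X U \<longleftrightarrow>
    (\<forall>c\<in>A. Ck_on k (local_field c X) (chart_map c ` (chart_dom c \<inter> U)))"

definition smooth_field_on ::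
  "('m, 'n::finite) chart set \<Rightarrow> ('m, 'n) vfield \<Rightarrow> 'm set \<Rightarrow> bool" where
  "smooth_field_on A X U \<longleftrightarrow>
    (\<forall>c\<in>A. smooth_on (local_field c X) (chart_map c ` (chart_dom c \<inter> U)))"

definition alternating_multilinear_on ::
  "('m, 'n::finite) tvec set \<Rightarrow> (('n \<Rightarrow> ('m, 'n) tvec) \<Rightarrow> real) \<Rightarrow> bool" where
  "alternating_multilinear_on T \<alpha> \<longleftrightarrow>
    (\<forall>v i. \<forall>x\<in>T. \<forall>y\<in>T. \<forall>a b. range v \<subseteq> T \<longrightarrow>
      \<alpha> (v(i := (\<lambda>c. a *\<^sub>R x c + b *\<^sub>R y c))) = a * \<alpha> (v(i := x)) + b * \<alpha> (v(i := y))) \<and>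
    (\<forall>v i j. range v \<subseteq> T \<and> i \<noteq> j \<and> v i = v j \<longrightarrow> \<alpha> v = 0)"

text \<open>The push-forward \<open>(\<phi>\<^sub>*\<omega>)\<^sub>x(u\<^sub>1, \<dots>, u\<^sub>n)\<close> under the coordinate map \<open>\<phi>\<close> of the chart \<open>c\<close>:\<close>

definition push_form ::
  "('m, 'n::finite) chart set \<Rightarrow> ('m, 'n) topform \<Rightarrow> ('m, 'n) chart
    \<Rightarrow> real ^ 'n \<Rightarrow> ('n \<Rightarrow> real ^ 'n) \<Rightarrow> real" where
  "push_form A \<omega> c x u = \<omega> (chart_inv c x) (\<lambda>i. tangent_of A c (chart_inv c x) (u i))"

definition smooth_volume_form ::
  "('m, 'n::finite) chart set \<Rightarrow> ('m, 'n) topform \<Rightarrow> bool" where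
  "smooth_volume_form A \<omega> \<longleftrightarrow>
    (\<forall>p. alternating_multilinear_on (tangent_space A p) (\<omega> p)) \<and>
    (\<forall>c\<in>A. \<forall>u. smooth_on (\<lambda>x. push_form A \<omega> c x u) (chart_img c)) \<and>
    (\<forall>p. \<exists>v. range v \<subseteq> tangent_space A p \<and> \<omega> p v \<noteq> 0)"

definition canonical_form :: "('n::finite \<Rightarrow> real ^ 'n) \<Rightarrow> real" where
  "canonical_form u = det (\<chi> i j. u j $ i)"

text \<open>
  In coordinates with \<open>\<omega> = \<rho> dx\<^sub>1 \<and> \<dots> \<and> dx\<^sub>n\<close>, the function \<open>div X\<close> determined by
  \<open>L\<^sub>X \<omega> = d(\<iota>\<^sub>X \<omega>) = (div X) \<omega>\<close> is \<open>\<rho>\<^sup>-\<^sup>1 \<Sum>\<^sub>i \<partial>\<^sub>i(\<rho> X\<^sub>i)\<close>.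
\<close>

definition density ::
  "('m, 'n::finite) chart set \<Rightarrow> ('m, 'n) topform \<Rightarrow> ('m, 'n) chart \<Rightarrow> real ^ 'n \<Rightarrow> real" where
  "density A \<omega> c x = push_form A \<omega> c x (\<lambda>i. axis i 1)"

definition divergence ::
  "('m, 'n::finite) chart set \<Rightarrow> ('m, 'n) topform \<Rightarrow> ('m, 'n) chart
    \<Rightarrow> ('m, 'n) vfield \<Rightarrow> real ^ 'n \<Rightarrow> real" where
  "divergence A \<omega> c X x =
    (\<Sum>i\<in>UNIV. frechet_derivative (\<lambda>y. density A \<omega> c y * local_field c X y $ i) (at x) (axis i 1))
      / density A \<omega> c x"

definition divfree_fields ::
  "('m, 'n::finite) chart set \<Rightarrow> ('m, 'n) topform \<Rightarrow> nat \<Rightarrow> ('m, 'n) vfield set" where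
  "divfree_fields A \<omega> r = {X. vector_field A X \<and> Ck_field_on A r X UNIV \<and>
    (\<forall>c\<in>A. \<forall>x\<in>chart_img c. divergence A \<omega> c X x = 0)}"


subsection \<open>Conservative regular atlases and the Whitney norm\<close>

definition conservative_atlas ::
  "('m, 'n::finite) chart set \<Rightarrow> ('m, 'n) topform \<Rightarrow> nat \<Rightarrow> (nat \<Rightarrow> ('m, 'n) chart) \<Rightarrow> bool" where
  "conservative_atlas A \<omega> m V \<longleftrightarrow>
    (\<forall>i\<in>{1..m}. V i \<in> A) \<and> (\<Union>i\<in>{1..m}. chart_dom (V i)) = UNIV \<and>
    (\<forall>i\<in>{1..m}. \<forall>x\<in>chart_img (V i). \<forall>u. push_form A \<omega> (V i) x u = canonical_form u) \<and>
    (\<exists>l>0. \<forall>i\<in>{1..m}. chart_img (V i) = ball 0 l)"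

definition regular_atlas ::
  "('m::topological_space, 'n::finite) chart set \<Rightarrow> ('m, 'n) topform \<Rightarrow> nat
    \<Rightarrow> (nat \<Rightarrow> ('m, 'n) chart) \<Rightarrow> bool" where
  "regular_atlas A \<omega> m V \<longleftrightarrow> (\<exists>W. conservative_atlas A \<omega> m W \<and>
    (\<forall>i\<in>{1..m}. closure (chart_dom (V i)) \<subseteq> chart_dom (W i) \<and>
      (\<forall>p\<in>chart_dom (V i). chart_map (W i) p = chart_map (V i) p)))"

definition whitney_norm ::
  "nat \<Rightarrow> (nat \<Rightarrow> ('m, 'n::finite) chart) \<Rightarrow> nat \<Rightarrow> ('m, 'n) vfield \<Rightarrow> real" where
  "whitney_norm m V r X =
    Max ((\<lambda>(j, k). SUP x\<in>chart_img (V j). deriv_norm k (local_field (V j) X) x)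
      ` ({1..m} \<times> {0..r}))"

definition field_diff :: "('m, 'n::finite) vfield \<Rightarrow> ('m, 'n) vfield \<Rightarrow> ('m, 'n) vfield" where
  "field_diff Z X = (\<lambda>p c. Z p c - X p c)"


subsection \<open>Submanifolds of full dimension and collars\<close>

definition boundary_chart ::
  "('m::topological_space, 'n::finite) chart set \<Rightarrow> nat \<Rightarrow> 'm set \<Rightarrow> 'n
    \<Rightarrow> ('m, 'n) chart \<Rightarrow> bool" where
  "boundary_chart A k N i c \<longleftrightarrow> is_chart c \<and> (\<forall>d\<in>A. Ck_compatible k c d) \<and>
    chart_map c ` (chart_dom c \<inter> N) = chart_img c \<inter> {x. 0 \<le> x $ i}"

definition Ck_full_submanifold ::
  "('m::topological_space, 'n::finite) chart set \<Rightarrow> nat \<Rightarrow> 'm set \<Rightarrow> bool" where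
  "Ck_full_submanifold A k N \<longleftrightarrow> (\<forall>p\<in>N. \<exists>i c. boundary_chart A k N i c \<and> p \<in> chart_dom c)"

definition mboundary ::
  "('m::topological_space, 'n::finite) chart set \<Rightarrow> nat \<Rightarrow> 'm set \<Rightarrow> 'm set" where
  "mboundary A k N =
    {p\<in>N. \<exists>i c. boundary_chart A k N i c \<and> p \<in> chart_dom c \<and> chart_map c p $ i = 0}"

definition minterior ::
  "('m::topological_space, 'n::finite) chart set \<Rightarrow> nat \<Rightarrow> 'm set \<Rightarrow> 'm set" where
  "minterior A k N = N - mboundary A k N"

definition set_coord :: "'n \<Rightarrow> real \<Rightarrow> real ^ 'n \<Rightarrow> real ^ 'n::finite" where
  "set_coord i t x = (\<chi> j. if j = i then t else x $ j)"

text \<open>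
  A \<open>C\<^sup>2\<close> embedding \<open>\<partial>N \<times> [0, \<infinity>) \<rightarrow> N\<close>. A boundary chart \<open>c\<close> with half-space
  coordinate \<open>i\<close> gives the chart of \<open>\<partial>N \<times> [0, \<infinity>)\<close> that puts the \<open>[0, \<infinity>)\<close> factor into the
  \<open>i\<close>-th coordinate, which vanishes on \<open>\<partial>N\<close>. Being \<open>C\<^sup>2\<close> up to the boundary of this half-space
  means having local \<open>C\<^sup>2\<close> extensions \<open>g\<close>; the derivative of \<open>g\<close> at points of the half-space does
  not depend on the extension.
\<close>

definition collar_embedding ::
  "('m::topological_space, 'n::finite) chart set \<Rightarrow> 'm set \<Rightarrow> ('m \<times> real \<Rightarrow> 'm) \<Rightarrow> bool" where
  "collar_embedding A N \<zeta> \<longleftrightarrow>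
    \<zeta> ` (mboundary A 3 N \<times> {0..}) \<subseteq> N \<and>
    (\<forall>p\<in>mboundary A 3 N. \<zeta> (p, 0) = p) \<and>
    embedding_map (top_of_set (mboundary A 3 N \<times> {0..})) euclidean \<zeta> \<and>
    (\<forall>i c d p t. boundary_chart A 3 N i c \<and> p \<in> chart_dom c \<inter> mboundary A 3 N \<and> 0 \<le> t \<and>
        d \<in> A \<and> \<zeta> (p, t) \<in> chart_dom d \<longrightarrow>
      (\<exists>W g. open W \<and> set_coord i t (chart_map c p) \<in> W \<and> Ck_on 2 g W \<and>
        (\<forall>z\<in>W. 0 \<le> z $ i \<longrightarrow> set_coord i 0 z \<in> chart_img c \<and>
          \<zeta> (chart_inv c (set_coord i 0 z), z $ i) \<in> chart_dom d \<and>
          g z = chart_map d (\<zeta> (chart_inv c (set_coord i 0 z), z $ i))) \<and>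
        inj (frechet_derivative g (at (set_coord i t (chart_map c p))))))"

definition collar_interior ::
  "('m::topological_space, 'n::finite) chart set \<Rightarrow> 'm set \<Rightarrow> 'm set \<Rightarrow> bool" where
  "collar_interior A N \<Omega> \<longleftrightarrow> (\<exists>\<zeta> \<epsilon>. collar_embedding A N \<zeta> \<and> 0 < \<epsilon> \<and>
    \<Omega> = \<zeta> ` (mboundary A 3 N \<times> {0<..<\<epsilon>}))"

end

theory Submission
  imports Defs
begin

text \<open>
  Both kinds of regions \<open>\<Omega>\<close> are open, and the argument works in any open set: a point of the
  submanifold off its boundary is a topological interior point (\<open>minterior_eq_interior\<close>), and the
  interior of a collar is open by invariance of domain (\<open>open_collar_interior\<close>).

  A field \<open>X\<close> has zero divergence iff the \<open>(n - 1)\<close>-form \<open>\<iota>\<^sub>X \<omega>\<close> is closed. Closed forms are preserved by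
  pullback under smooth maps and by averages of such pullbacks, and an average over translations is a
  convolution, which is smooth. In de Rham's manner, the translations are replaced by maps that are
  the identity outside a given open set \<open>U\<close>. In a chart where the volume form is canonical, take
  the maps \<open>x \<mapsto> x + s \<delta>(x) v\<close>, where \<open>\<delta>\<close> is a smooth function which is positive on \<open>U\<close> and zero elsewhere
  (\<open>smooth_positive_exactly_on\<close>), and average over \<open>v\<close> with a smooth weight. The resulting field
  (\<open>smear\<close>) is a mollification of \<open>X\<close> with a radius \<open>s \<delta>(x)\<close> that depends on the point, plus the
  correction that keeps the divergence zero (\<open>euclidean_div_smear_integrand\<close>). It has four properties.

  \<^item> It equals \<open>X\<close> outside \<open>U\<close>, since there \<open>\<delta>\<close> and its derivative vanish (\<open>smear_eq_of_flat\<close>).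
  \<^item> It is smooth on \<open>U\<close>, since the substitution \<open>y = x + s \<delta>(x) v\<close> moves the dependence on \<open>x\<close> into a
    smooth kernel (\<open>smear_smooth_where_positive\<close>).
  \<^item> It is smooth wherever \<open>X\<close> was smooth already, including across the boundary of \<open>U\<close>, since
    differentiation under the integral sign is possible there (\<open>Ck_family_smear\<close>).
  \<^item> It converges to \<open>X\<close> in \<open>C\<^sup>r\<close> on compact sets as \<open>s \<longrightarrow> 0\<close>, since its derivatives up to order \<open>r\<close> are
    jointly continuous in \<open>s\<close> and \<open>x\<close> and it is \<open>X\<close> for \<open>s = 0\<close> (\<open>eventually_Cr_close\<close>).

  Because of the third property, the finitely many charts of the atlas can be treated one after the
  other, with \<open>U\<close> the part of \<open>\<Omega>\<close> in the domain of the chart (\<open>smoothing_on_open_set\<close>).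

  The divergence has to vanish in every chart of the smooth structure, not just in the
  conservative ones. Its independence of the chart is the Piola identity
  (\<open>divergence_of_Piola_transform\<close>), which rests on Jacobi's formula for the derivative of a
  determinant.
\<close>

section \<open>Families of functions with continuous derivatives\<close>

lemma has_derivative_cong_open:
  assumes "open S" "x \<in> S" "\<And>y. y \<in> S \<Longrightarrow> f y = g y"
  shows "(f has_derivative f') (at x) \<longleftrightarrow> (g has_derivative f') (at x)"
  using has_derivative_transform_within_open[of f f' x UNIV S g]
    has_derivative_transform_within_open[of g f' x UNIV S f] assms by auto

lemma frechet_derivative_cong_open:
  assumes "open S" "x \<in> S" "\<And>y. y \<in> S \<Longrightarrow> f y = g y"
  shows "frechet_derivative f (at x) = frechet_derivative g (at x)"
  unfolding frechet_derivative_def using has_derivative_cong_open[OF assms] by simp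

lemma differentiable_cong_open:
  assumes "open S" "x \<in> S" "\<And>y. y \<in> S \<Longrightarrow> f y = g y"
  shows "f differentiable (at x) \<longleftrightarrow> g differentiable (at x)"
  unfolding differentiable_def using has_derivative_cong_open[OF assms] by simp

lemma iter_deriv_cong_open:
  assumes "open S" "\<And>y. y \<in> S \<Longrightarrow> f y = g y" "x \<in> S"
  shows "iter_deriv f us x = iter_deriv g us x"
  using assms(3)
proof (induction us arbitrary: x)
  case (Cons u us)
  show ?case
    using frechet_derivative_cong_open[OF assms(1) Cons.prems Cons.IH] by simp
qed (use assms in auto)

text \<open>
  The last entry of the list is the first direction of differentiation. Peeling it off turns a
  statement about higher derivatives of \<open>f\<close> into one about a directional derivative of \<open>f\<close>,
  which is what inductions on the order of differentiability need.
\<close>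

lemma iter_deriv_snoc:
  "iter_deriv f (us @ [u]) = iter_deriv (\<lambda>x. frechet_derivative f (at x) u) us"
  by (induction us) auto

text \<open>
  Only derivatives in the variable \<open>x\<close> are taken; \<open>p\<close> is a parameter. Continuity is required
  jointly in \<open>(p, x)\<close>: this is what lets derivatives pass under an integral over \<open>p\<close>, and what
  makes them converge uniformly on compact sets when \<open>p\<close> tends to a limit.
\<close>

definition Ck_family ::
  "nat \<Rightarrow> ('p::topological_space \<Rightarrow> 'a::euclidean_space \<Rightarrow> 'b::real_normed_vector)
    \<Rightarrow> 'p set \<Rightarrow> 'a set \<Rightarrow> bool" where
  "Ck_family k f P S \<longleftrightarrow>
    (\<forall>us. length us < k \<longrightarrow> (\<forall>p\<in>P. \<forall>x\<in>S. iter_deriv (f p) us differentiable at x)) \<and>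
    (\<forall>us. length us \<le> k \<longrightarrow> continuous_on (P \<times> S) (\<lambda>(p, x). iter_deriv (f p) us x))"

lemma Ck_family_member:
  assumes "Ck_family k f P S" "p \<in> P"
  shows "Ck_on k (f p) S"
proof -
  have "continuous_on S (iter_deriv (f p) us)" if "length us \<le> k" for us
  proof -
    have "continuous_on S ((\<lambda>(p, x). iter_deriv (f p) us x) \<circ> (\<lambda>x. (p, x)))"
      using assms that unfolding Ck_family_def
      by (intro continuous_on_compose continuous_intros) (auto intro: continuous_on_subset)
    then show ?thesis by (simp add: o_def)
  qed
  then show ?thesis using assms unfolding Ck_family_def Ck_on_def by auto
qed

lemma Ck_on_imp_family:
  assumes "Ck_on k f S"
  shows "Ck_family k (\<lambda>_. f) P S"
proof -
  have "continuous_on (P \<times> S) (\<lambda>(p, x). iter_deriv f us x)" if "length us \<le> k" for us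
  proof -
    have "continuous_on (P \<times> S) (iter_deriv f us \<circ> snd)"
      using assms that unfolding Ck_on_def
      by (intro continuous_on_compose continuous_intros) (auto elim: continuous_on_subset)
    then show ?thesis by (simp add: o_def case_prod_beta)
  qed
  then show ?thesis using assms unfolding Ck_family_def Ck_on_def by auto
qed

lemma Ck_on_iff_family: "Ck_on k f S \<longleftrightarrow> Ck_family k (\<lambda>_. f) {0::real} S"
  using Ck_on_imp_family[of k f S "{0::real}"] Ck_family_member[of k "\<lambda>_. f" "{0::real}" S 0] by auto

lemma Ck_family_mono:
  assumes "Ck_family k f P S" "j \<le> k" "Q \<subseteq> P" "T \<subseteq> S"
  shows "Ck_family j f Q T"
proof -
  have "Q \<times> T \<subseteq> P \<times> S" using assms by auto
  then show ?thesis using assms unfolding Ck_family_def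
    by (meson continuous_on_subset le_trans less_le_trans subsetD)
qed

lemma Ck_on_mono:
  assumes "Ck_on k f S" "j \<le> k" "T \<subseteq> S"
  shows "Ck_on j f T"
  using Ck_family_mono[of k _ _ S j _ T] assms unfolding Ck_on_iff_family by blast

lemma Ck_family_cong:
  assumes "open S" "\<And>p x. p \<in> P \<Longrightarrow> x \<in> S \<Longrightarrow> f p x = g p x"
  shows "Ck_family k f P S \<longleftrightarrow> Ck_family k g P S"
proof -
  have e: "iter_deriv (f p) us x = iter_deriv (g p) us x" if "p \<in> P" "x \<in> S" for p x us
    using iter_deriv_cong_open[OF assms(1), of "f p" "g p"] assms(2) that by blast
  have "iter_deriv (f p) us differentiable at x \<longleftrightarrow> iter_deriv (g p) us differentiable at x"
    if "p \<in> P" "x \<in> S" for p x us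
    using differentiable_cong_open[OF assms(1) that(2)] e that by blast
  moreover have "continuous_on (P \<times> S) (\<lambda>(p, x). iter_deriv (f p) us x) \<longleftrightarrow>
      continuous_on (P \<times> S) (\<lambda>(p, x). iter_deriv (g p) us x)" for us
    by (rule continuous_on_cong) (use e in auto)
  ultimately show ?thesis unfolding Ck_family_def by auto
qed

lemma Ck_family_eq:
  assumes "open S" "Ck_family k g P S" "\<And>p x. p \<in> P \<Longrightarrow> x \<in> S \<Longrightarrow> f p x = g p x"
  shows "Ck_family k f P S"
  using Ck_family_cong[of S P f g k] assms by blast

lemma Ck_on_cong:
  assumes "open S" "\<And>x. x \<in> S \<Longrightarrow> f x = g x"
  shows "Ck_on k f S \<longleftrightarrow> Ck_on k g S"
  unfolding Ck_on_iff_family by (rule Ck_family_cong) (use assms in auto)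

lemma Ck_family_0: "Ck_family 0 f P S \<longleftrightarrow> continuous_on (P \<times> S) (\<lambda>(p, x). f p x)"
  unfolding Ck_family_def by auto

lemma Ck_family_continuous:
  assumes "Ck_family k f P S"
  shows "continuous_on (P \<times> S) (\<lambda>(p, x). f p x)"
  using assms Ck_family_mono[of k f P S 0] Ck_family_0 by blast

lemma Ck_on_imp_continuous_on:
  assumes "Ck_on k f S"
  shows "continuous_on S f"
  using Ck_on_mono[OF assms, of 0 S] by (simp add: Ck_on_def)

lemma smooth_on_imp_continuous_on: "smooth_on f S \<Longrightarrow> continuous_on S f"
  unfolding smooth_on_def using Ck_on_imp_continuous_on by blast

text \<open>
  The recursion on which every closure property below is proved by induction.
\<close>

lemma Ck_family_Suc:
  "Ck_family (Suc k) f P S \<longleftrightarrow> (\<forall>p\<in>P. \<forall>x\<in>S. f p differentiable at x) \<and>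
    continuous_on (P \<times> S) (\<lambda>(p, x). f p x) \<and>
    (\<forall>u. Ck_family k (\<lambda>p x. frechet_derivative (f p) (at x) u) P S)"
  (is "?L \<longleftrightarrow> ?R")
proof
  assume L: ?L
  have "f p differentiable at x" if "p \<in> P" "x \<in> S" for p x
    using L that unfolding Ck_family_def by (metis iter_deriv.simps(1) length_0_conv zero_less_Suc)
  moreover have "Ck_family k (\<lambda>p x. frechet_derivative (f p) (at x) u) P S" for u
    unfolding Ck_family_def
  proof (intro conjI allI impI)
    fix us :: "'b list"
    show "\<forall>p\<in>P. \<forall>x\<in>S. iter_deriv (\<lambda>x. frechet_derivative (f p) (at x) u) us differentiable at x"
      if "length us < k"
      using L that unfolding Ck_family_def iter_deriv_snoc[symmetric] by simp
    show "continuous_on (P \<times> S) (\<lambda>(p, x). iter_deriv (\<lambda>x. frechet_derivative (f p) (at x) u) us x)"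
      if "length us \<le> k"
      using L that unfolding Ck_family_def iter_deriv_snoc[symmetric] by simp
  qed
  ultimately show ?R using Ck_family_continuous[OF L] by blast
next
  assume R: ?R
  show ?L unfolding Ck_family_def
  proof (intro conjI allI impI)
    fix us :: "'b list"
    show "\<forall>p\<in>P. \<forall>x\<in>S. iter_deriv (f p) us differentiable at x" if "length us < Suc k"
      using R that
      by (cases us rule: rev_cases) (auto simp: Ck_family_def iter_deriv_snoc simp del: iter_deriv.simps(2))
    show "continuous_on (P \<times> S) (\<lambda>(p, x). iter_deriv (f p) us x)" if "length us \<le> Suc k"
      using R that
      by (cases us rule: rev_cases) (auto simp: Ck_family_def iter_deriv_snoc simp del: iter_deriv.simps(2))
  qed
qed

lemma Ck_on_Suc:
  "Ck_on (Suc k) f S \<longleftrightarrow> (\<forall>x\<in>S. f differentiable at x) \<and>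
    continuous_on S f \<and> (\<forall>u. Ck_on k (\<lambda>x. frechet_derivative f (at x) u) S)"
proof -
  have "continuous_on ({0::real} \<times> S) (\<lambda>(p, x). f x) \<longleftrightarrow> continuous_on S f"
    using Ck_on_iff_family[of 0 f S] unfolding Ck_on_def Ck_family_0 by auto
  then show ?thesis unfolding Ck_on_iff_family Ck_family_Suc by auto
qed

lemma Ck_family_SucI:
  assumes "open S" "\<And>p x. p \<in> P \<Longrightarrow> x \<in> S \<Longrightarrow> (f p has_derivative f' p x) (at x)"
    and "continuous_on (P \<times> S) (\<lambda>(p, x). f p x)"
    and "\<And>u. Ck_family k (\<lambda>p x. f' p x u) P S"
  shows "Ck_family (Suc k) f P S"
proof -
  have "Ck_family k (\<lambda>p x. frechet_derivative (f p) (at x) u) P S" for u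
    using assms(4)[of u] Ck_family_cong[OF assms(1), of P "\<lambda>p x. f' p x u"
        "\<lambda>p x. frechet_derivative (f p) (at x) u" k] frechet_derivative_at[OF assms(2)] by metis
  then show ?thesis unfolding Ck_family_Suc using assms(2,3) differentiableI by blast
qed

lemma Ck_family_has_derivative:
  assumes "Ck_family k f P S" "k > 0" "p \<in> P" "x \<in> S"
  shows "(f p has_derivative frechet_derivative (f p) (at x)) (at x)"
  using assms by (cases k) (auto simp: Ck_family_Suc frechet_derivative_works)

lemma Ck_on_has_derivative:
  assumes "Ck_on k f S" "k > 0" "x \<in> S"
  shows "(f has_derivative frechet_derivative f (at x)) (at x)"
  using Ck_family_has_derivative[of k "\<lambda>_. f" "{0::real}" S] assms by (auto simp: Ck_on_iff_family)

lemma Ck_family_directional: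
  assumes "Ck_family (Suc k) f P S"
  shows "Ck_family k (\<lambda>p x. frechet_derivative (f p) (at x) u) P S"
  using assms Ck_family_Suc by blast

lemma Ck_on_directional:
  assumes "Ck_on (Suc k) f S"
  shows "Ck_on k (\<lambda>x. frechet_derivative f (at x) u) S"
  using assms Ck_on_Suc by blast

lemma Ck_family_Suc_lower: "Ck_family (Suc k) f P S \<Longrightarrow> Ck_family k f P S"
  by (rule Ck_family_mono) auto

lemma Ck_family_param:
  assumes "continuous_on P a" "open S"
  shows "Ck_family k (\<lambda>p x. a p) P S"
proof -
  have z: "Ck_family k (\<lambda>p x. 0) P S" for k
  proof (induction k)
    case 0 show ?case by (simp add: Ck_family_0 case_prod_beta continuous_on_const)
  next
    case (Suc k) then show ?case
      by (intro Ck_family_SucI[where f' = "\<lambda>p x u. 0"] assms) (auto simp: case_prod_beta continuous_on_const)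
  qed
  have c: "continuous_on (P \<times> S) (\<lambda>(p, x). a p)"
    unfolding case_prod_beta by (intro continuous_on_compose2[OF assms(1)] continuous_intros) auto
  show ?thesis
  proof (cases k)
    case 0 then show ?thesis using c by (simp add: Ck_family_0)
  next
    case (Suc j) then show ?thesis
      using Ck_family_SucI[where f' = "\<lambda>p x u. 0", OF assms(2) _ c z] by auto
  qed
qed

lemma Ck_family_const: "open S \<Longrightarrow> Ck_family k (\<lambda>p x. c) P S"
  by (rule Ck_family_param) auto

lemma Ck_family_id:
  assumes "open S"
  shows "Ck_family k (\<lambda>p x. x) P S"
proof -
  have c: "continuous_on (P \<times> S) (\<lambda>(p, x). x)"
    unfolding case_prod_beta by (intro continuous_intros)
  show ?thesis
  proof (cases k)
    case 0 then show ?thesis using c by (simp add: Ck_family_0)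
  next
    case (Suc j) then show ?thesis
      using Ck_family_SucI[where f' = "\<lambda>p x u. u", OF assms _ c Ck_family_const[OF assms]] by auto
  qed
qed

lemma Ck_family_add:
  assumes "open S" "Ck_family k f P S" "Ck_family k g P S"
  shows "Ck_family k (\<lambda>p x. f p x + g p x) P S"
  using assms(2,3)
proof (induction k arbitrary: f g)
  case 0 then show ?case by (auto simp: Ck_family_0 case_prod_beta intro: continuous_intros)
next
  case (Suc k)
  show ?case
  proof (rule Ck_family_SucI[OF assms(1)])
    show "((\<lambda>x. f p x + g p x) has_derivative
        (\<lambda>u. frechet_derivative (f p) (at x) u + frechet_derivative (g p) (at x) u)) (at x)"
      if "p \<in> P" "x \<in> S" for p x
      using Ck_family_has_derivative[OF Suc.prems(1)] Ck_family_has_derivative[OF Suc.prems(2)] that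
      by (intro derivative_intros) auto
    show "continuous_on (P \<times> S) (\<lambda>(p, x). f p x + g p x)"
      using Suc.prems[THEN Ck_family_continuous] by (auto simp: case_prod_beta intro: continuous_intros)
    show "Ck_family k (\<lambda>p x. frechet_derivative (f p) (at x) u + frechet_derivative (g p) (at x) u) P S" for u
      by (intro Suc.IH Suc.prems[THEN Ck_family_directional])
  qed
qed

lemma Ck_family_sum:
  assumes "open S" "\<And>i. i \<in> I \<Longrightarrow> Ck_family k (f i) P S"
  shows "Ck_family k (\<lambda>p x. \<Sum>i\<in>I. f i p x) P S"
  using assms(2)
  by (induction I rule: infinite_finite_induct)
    (auto intro: Ck_family_const Ck_family_add simp: assms(1))

lemma (in bounded_bilinear) Ck_family:
  fixes f :: "'p::topological_space \<Rightarrow> 'x::euclidean_space \<Rightarrow> 'a"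
  assumes "open S" "Ck_family k f P S" "Ck_family k g P S"
  shows "Ck_family k (\<lambda>p x. prod (f p x) (g p x)) P S"
  using assms(2,3)
proof (induction k arbitrary: f g)
  case 0 then show ?case by (auto simp: Ck_family_0 case_prod_beta intro: continuous_on)
next
  case (Suc k)
  show ?case
  proof (rule Ck_family_SucI[OF assms(1)])
    show "((\<lambda>x. prod (f p x) (g p x)) has_derivative
        (\<lambda>u. prod (f p x) (frechet_derivative (g p) (at x) u)
          + prod (frechet_derivative (f p) (at x) u) (g p x))) (at x)"
      if "p \<in> P" "x \<in> S" for p x
      using Ck_family_has_derivative[OF Suc.prems(1)] Ck_family_has_derivative[OF Suc.prems(2)] that
      by (intro FDERIV) auto
    show "continuous_on (P \<times> S) (\<lambda>(p, x). prod (f p x) (g p x))"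
      using Suc.prems[THEN Ck_family_continuous] by (auto simp: case_prod_beta intro: continuous_on)
    show "Ck_family k (\<lambda>p x. prod (f p x) (frechet_derivative (g p) (at x) u)
          + prod (frechet_derivative (f p) (at x) u) (g p x)) P S" for u
      by (intro Ck_family_add[OF assms(1)] Suc.IH Suc.prems[THEN Ck_family_directional]
          Suc.prems[THEN Ck_family_Suc_lower])
  qed
qed

lemmas Ck_family_scaleR = bounded_bilinear.Ck_family[OF bounded_bilinear_scaleR]
lemmas Ck_family_mult = bounded_bilinear.Ck_family[OF bounded_bilinear_mult]
lemmas Ck_family_inner = bounded_bilinear.Ck_family[OF bounded_bilinear_inner]

lemma Ck_family_diff:
  assumes "open S" "Ck_family k f P S" "Ck_family k g P S"
  shows "Ck_family k (\<lambda>p x. f p x - g p x) P S"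
proof -
  have "Ck_family k (\<lambda>p x. f p x + (-1) *\<^sub>R g p x) P S"
    by (intro Ck_family_add Ck_family_scaleR Ck_family_const assms)
  then show ?thesis by simp
qed

lemma linear_eq_sum_Basis:
  fixes L :: "'a::euclidean_space \<Rightarrow> 'b::real_vector"
  assumes "linear L"
  shows "L x = (\<Sum>b\<in>Basis. (x \<bullet> b) *\<^sub>R L b)"
proof -
  have "L x = L (\<Sum>b\<in>Basis. (x \<bullet> b) *\<^sub>R b)" by (simp add: euclidean_representation)
  then show ?thesis by (simp only: linear_sum[OF assms] linear_scale[OF assms])
qed

lemma frechet_derivative_eq_sum_Basis:
  fixes f :: "'a::euclidean_space \<Rightarrow> 'b::real_normed_vector"
  assumes "f differentiable at x"
  shows "frechet_derivative f (at x) u = (\<Sum>b\<in>Basis. (u \<bullet> b) *\<^sub>R frechet_derivative f (at x) b)"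
  by (rule linear_eq_sum_Basis[OF linear_frechet_derivative[OF assms]])

lemma Ck_family_derivative_along:
  fixes f :: "'p::topological_space \<Rightarrow> 'a::euclidean_space \<Rightarrow> 'b::real_normed_vector"
  assumes "open S" "Ck_family (Suc k) f P S" "Ck_family k u P S"
  shows "Ck_family k (\<lambda>p x. frechet_derivative (f p) (at x) (u p x)) P S"
proof -
  have "Ck_family k (\<lambda>p x. \<Sum>b\<in>Basis. (u p x \<bullet> b) *\<^sub>R frechet_derivative (f p) (at x) b) P S"
    by (intro Ck_family_sum Ck_family_scaleR Ck_family_inner Ck_family_const assms
        Ck_family_directional[OF assms(2)])
  moreover have "frechet_derivative (f p) (at x) (u p x) =
      (\<Sum>b\<in>Basis. (u p x \<bullet> b) *\<^sub>R frechet_derivative (f p) (at x) b)" if "p \<in> P" "x \<in> S" for p x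
    using assms(2) that by (intro frechet_derivative_eq_sum_Basis) (auto simp: Ck_family_Suc)
  ultimately show ?thesis by (rule Ck_family_eq[OF assms(1)])
qed

lemma continuous_on_family_compose:
  assumes "continuous_on (P \<times> S) (\<lambda>(p, x). f p x)" "continuous_on (P \<times> T) (\<lambda>(p, y). g p y)"
    and "\<And>p x. p \<in> P \<Longrightarrow> x \<in> S \<Longrightarrow> f p x \<in> T"
  shows "continuous_on (P \<times> S) (\<lambda>(p, x). g p (f p x))"
proof -
  have "continuous_on (P \<times> S) ((\<lambda>(p, y). g p y) \<circ> (\<lambda>(p, x). (p, f p x)))"
  proof (rule continuous_on_compose)
    show "continuous_on (P \<times> S) (\<lambda>(p, x). (p, f p x))"
      using assms(1) by (auto simp: case_prod_beta intro!: continuous_intros)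
    show "continuous_on ((\<lambda>(p, x). (p, f p x)) ` (P \<times> S)) (\<lambda>(p, y). g p y)"
      using assms(2,3) by (auto intro: continuous_on_subset)
  qed
  then show ?thesis by (simp add: o_def case_prod_beta)
qed

text \<open>
  By the chain rule, the derivative of \<open>g \<circ> f\<close> in the direction \<open>u\<close> is the sum over basis vectors
  \<open>b\<close> of \<open>D f u \<bullet> b\<close> times \<open>(D g b) \<circ> f\<close>. The induction hypothesis applies to \<open>D g b\<close>, so \<open>g\<close> has
  to vary in the induction.
\<close>

lemma Ck_family_compose:
  fixes f :: "'p::topological_space \<Rightarrow> 'a::euclidean_space \<Rightarrow> 'b::euclidean_space"
    and g :: "'p \<Rightarrow> 'b \<Rightarrow> 'c::real_normed_vector"
  assumes "open S" "open T" "Ck_family k f P S" "Ck_family k g P T"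
    and fT: "\<And>p x. p \<in> P \<Longrightarrow> x \<in> S \<Longrightarrow> f p x \<in> T"
  shows "Ck_family k (\<lambda>p x. g p (f p x)) P S"
  using assms(3,4)
proof (induction k arbitrary: g)
  case 0
  then show ?case using continuous_on_family_compose[OF _ _ fT] by (simp add: Ck_family_0)
next
  case (Suc k)
  have dg: "(g p has_derivative frechet_derivative (g p) (at y)) (at y)" if "p \<in> P" "y \<in> T" for p y
    using Ck_family_has_derivative[OF Suc.prems(2)] that by simp
  have IH: "Ck_family k (\<lambda>p x. frechet_derivative (g p) (at (f p x)) b) P S" for b
    by (intro Suc.IH[OF Suc.prems(1)[THEN Ck_family_Suc_lower]] Ck_family_directional[OF Suc.prems(2)])
  show ?case
  proof (rule Ck_family_SucI[OF assms(1)])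
    show "((\<lambda>x. g p (f p x)) has_derivative
        (\<lambda>u. frechet_derivative (g p) (at (f p x)) (frechet_derivative (f p) (at x) u))) (at x)"
      if "p \<in> P" "x \<in> S" for p x
      using has_derivative_compose[OF Ck_family_has_derivative[OF Suc.prems(1), of p x]
          dg[of p "f p x"]] fT that by simp
    show "continuous_on (P \<times> S) (\<lambda>(p, x). g p (f p x))"
      using Suc.prems[THEN Ck_family_continuous] fT by (rule continuous_on_family_compose)
    fix u
    have "Ck_family k (\<lambda>p x. \<Sum>b\<in>Basis. (frechet_derivative (f p) (at x) u \<bullet> b) *\<^sub>R
        frechet_derivative (g p) (at (f p x)) b) P S"
      by (intro Ck_family_sum Ck_family_scaleR Ck_family_inner Ck_family_const assms IH
          Ck_family_directional[OF Suc.prems(1)])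
    then show "Ck_family k (\<lambda>p x. frechet_derivative (g p) (at (f p x))
        (frechet_derivative (f p) (at x) u)) P S"
      by (rule Ck_family_eq[OF assms(1)])
        (rule frechet_derivative_eq_sum_Basis, use dg fT differentiable_def in blast)
  qed
qed

lemma Ck_family_local:
  fixes f :: "'p::topological_space \<Rightarrow> 'a::euclidean_space \<Rightarrow> 'b::real_normed_vector"
  assumes "\<And>x. x \<in> S \<Longrightarrow> \<exists>T. open T \<and> x \<in> T \<and> Ck_family k f P (S \<inter> T)"
  shows "Ck_family k f P S"
  unfolding Ck_family_def
proof (intro conjI allI impI ballI)
  fix us :: "'a list" and p x assume "length us < k" "p \<in> P" "x \<in> S"
  then show "iter_deriv (f p) us differentiable at x"
    using assms[of x] unfolding Ck_family_def by blast
next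
  fix us :: "'a list" assume us: "length us \<le> k"
  show "continuous_on (P \<times> S) (\<lambda>(p, x). iter_deriv (f p) us x)"
    unfolding continuous_on_def
  proof
    fix z assume z: "z \<in> P \<times> S"
    obtain T where T: "open T" "snd z \<in> T" "Ck_family k f P (S \<inter> T)"
      using assms[of "snd z"] z by auto
    have "continuous_on (P \<times> (S \<inter> T)) (\<lambda>(p, x). iter_deriv (f p) us x)"
      using T(3) us unfolding Ck_family_def by blast
    then have "((\<lambda>(p, x). iter_deriv (f p) us x) \<longlongrightarrow>
        (case z of (p, x) \<Rightarrow> iter_deriv (f p) us x)) (at z within P \<times> (S \<inter> T))"
      using z T unfolding continuous_on_def by (cases z) auto
    moreover have "at z within P \<times> (S \<inter> T) = at z within P \<times> S"
    proof (rule at_within_nhd[where S = "UNIV \<times> T"])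
      show "open (UNIV \<times> T)" using T by (simp add: open_Times)
    qed (use T z in \<open>auto simp: mem_Times_iff\<close>)
    ultimately show "((\<lambda>(p, x). iter_deriv (f p) us x) \<longlongrightarrow>
        (case z of (p, x) \<Rightarrow> iter_deriv (f p) us x)) (at z within P \<times> S)" by simp
  qed
qed

lemma Ck_on_local:
  assumes "\<And>x. x \<in> S \<Longrightarrow> \<exists>T. open T \<and> x \<in> T \<and> Ck_on k f (S \<inter> T)"
  shows "Ck_on k f S"
  using assms unfolding Ck_on_iff_family by (rule Ck_family_local)

text \<open>
  Leibniz's rule needs the derivative to be continuous as a map into the space of bounded linear
  operators. In finite dimension that follows from the continuity of the directional derivatives.
\<close>

lemma Ck_family_integral_has_derivative:
  fixes f :: "'p::t2_space \<times> 'v::euclidean_space \<Rightarrow> 'a::euclidean_space \<Rightarrow> 'b::banach"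
  assumes "open S" "Ck_family k f (P \<times> cbox a b) S" "k > 0" and p: "p \<in> P" and x: "x \<in> S"
  shows "((\<lambda>x. integral (cbox a b) (\<lambda>v. f (p, v) x)) has_derivative
    (\<lambda>u. integral (cbox a b) (\<lambda>v. frechet_derivative (f (p, v)) (at x) u))) (at x)"
proof -
  obtain e where e: "e > 0" "ball x e \<subseteq> S" using assms(1) x openE by blast
  define U where "U = ball x e"
  define L where "L = (\<lambda>x v. Blinfun (frechet_derivative (f (p, v)) (at x)))"
  have d: "(f (p, v) has_derivative frechet_derivative (f (p, v)) (at y)) (at y)"
    if "v \<in> cbox a b" "y \<in> S" for v y
    using Ck_family_has_derivative[OF assms(2,3)] that p by auto
  have L: "blinfun_apply (L y v) = frechet_derivative (f (p, v)) (at y)"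
    if "v \<in> cbox a b" "y \<in> S" for v y
    unfolding L_def using d[OF that] by (simp add: bounded_linear_Blinfun_apply has_derivative_bounded_linear)
  have c1: "Ck_family 1 f (P \<times> cbox a b) S"
    by (rule Ck_family_mono[OF assms(2)]) (use assms(3) in auto)
  have U: "U \<subseteq> S" "x \<in> U" "convex U" "open U" using e unfolding U_def by auto
  have cu: "continuous_on (U \<times> cbox a b) (\<lambda>(y, v). frechet_derivative (f (p, v)) (at y) i)" for i
  proof -
    have "continuous_on ((P \<times> cbox a b) \<times> S) (\<lambda>(q, y). frechet_derivative (f q) (at y) i)"
      using c1 Ck_family_directional[of 0 f "P \<times> cbox a b" S i] by (simp add: Ck_family_0)
    then have "continuous_on (U \<times> cbox a b)
      ((\<lambda>(q, y). frechet_derivative (f q) (at y) i) \<circ> (\<lambda>(y, v). ((p, v), y)))"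
      unfolding case_prod_beta
      by (intro continuous_on_compose continuous_intros) (use U p in \<open>auto elim!: continuous_on_subset\<close>)
    then show ?thesis by (simp add: o_def case_prod_beta)
  qed
  have cL: "continuous_on (U \<times> cbox a b) (\<lambda>(y, v). L y v)"
  proof (rule continuous_on_blinfun_componentwise)
    fix i :: 'a
    show "continuous_on (U \<times> cbox a b) (\<lambda>z. blinfun_apply (case z of (y, v) \<Rightarrow> L y v) i)"
      using cu[of i] L U by (subst continuous_on_cong[OF refl, of _ _ "\<lambda>(y, v). frechet_derivative (f (p, v)) (at y) i"]) auto
  qed
  have "((\<lambda>y. integral (cbox a b) ((\<lambda>y v. f (p, v) y) y)) has_derivative
      blinfun_apply (integral (cbox a b) (L x))) (at x within U)"
  proof (rule leibniz_rule[OF _ _ cL U(2,3)])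
    show "((\<lambda>x. f (p, t) x) has_derivative blinfun_apply (L y t)) (at y within U)"
      if "y \<in> U" "t \<in> cbox a b" for y t
      using d L that U has_derivative_at_withinI by fastforce
    show "(\<lambda>v. f (p, v) y) integrable_on cbox a b" if "y \<in> U" for y
    proof (rule integrable_continuous)
      have "continuous_on (cbox a b) ((\<lambda>(q, y). f q y) \<circ> (\<lambda>v. ((p, v), y)))"
        by (intro continuous_on_compose continuous_intros continuous_on_subset[OF Ck_family_continuous[OF c1]])
          (use U p that in auto)
      then show "continuous_on (cbox a b) (\<lambda>v. f (p, v) y)" by (simp add: o_def)
    qed
  qed
  then have "((\<lambda>y. integral (cbox a b) (\<lambda>v. f (p, v) y)) has_derivative
      blinfun_apply (integral (cbox a b) (L x))) (at x)"
    unfolding at_within_open[OF U(2,4)] .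
  moreover have "blinfun_apply (integral (cbox a b) (L x)) =
      (\<lambda>u. integral (cbox a b) (\<lambda>v. frechet_derivative (f (p, v)) (at x) u))"
  proof
    fix u
    have "continuous_on (cbox a b) ((\<lambda>(y, v). L y v) \<circ> (\<lambda>v. (x, v)))"
      by (intro continuous_on_compose continuous_intros continuous_on_subset[OF cL]) (use U in auto)
    then have "L x integrable_on cbox a b" by (intro integrable_continuous) (simp add: o_def)
    then have "blinfun_apply (integral (cbox a b) (L x)) u = integral (cbox a b) (\<lambda>v. L x v u)"
      using integral_linear[of "L x" "cbox a b" "\<lambda>M. blinfun_apply M u"] blinfun.bounded_linear_left
      by (simp add: o_def)
    also have "\<dots> = integral (cbox a b) (\<lambda>v. frechet_derivative (f (p, v)) (at x) u)"
      using L x by (intro integral_cong) auto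
    finally show "blinfun_apply (integral (cbox a b) (L x)) u =
      integral (cbox a b) (\<lambda>v. frechet_derivative (f (p, v)) (at x) u)" .
  qed
  ultimately show ?thesis by simp
qed

lemma Ck_family_integral:
  fixes f :: "'p::t2_space \<times> 'v::euclidean_space \<Rightarrow> 'a::euclidean_space \<Rightarrow> 'b::banach"
  assumes "open S" "Ck_family k f (P \<times> cbox a b) S"
  shows "Ck_family k (\<lambda>p x. integral (cbox a b) (\<lambda>v. f (p, v) x)) P S"
proof -
  have c: "continuous_on (P \<times> S) (\<lambda>(p, x). integral (cbox a b) (\<lambda>v. f (p, v) x))"
    if "continuous_on ((P \<times> cbox a b) \<times> S) (\<lambda>(q, x). f q x)" for f :: "'p \<times> 'v \<Rightarrow> 'a \<Rightarrow> 'b"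
  proof -
    have "continuous_on ((P \<times> S) \<times> cbox a b) ((\<lambda>(q, x). f q x) \<circ> (\<lambda>z. ((fst (fst z), snd z), snd (fst z))))"
      by (intro continuous_on_compose continuous_intros) (auto intro: continuous_on_subset[OF that])
    then have "continuous_on ((P \<times> S) \<times> cbox a b) (\<lambda>(z, v). f (fst z, v) (snd z))"
      by (simp add: o_def case_prod_beta)
    from integral_continuous_on_param[OF this] show ?thesis by (simp add: case_prod_beta)
  qed
  show ?thesis using assms(2)
  proof (induction k arbitrary: f)
    case 0 then show ?case using c by (simp add: Ck_family_0)
  next
    case (Suc k)
    show ?case
    proof (rule Ck_family_SucI[OF assms(1)])
      show "((\<lambda>x. integral (cbox a b) (\<lambda>v. f (p, v) x)) has_derivative
        (\<lambda>u. integral (cbox a b) (\<lambda>v. frechet_derivative (f (p, v)) (at x) u))) (at x)"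
        if "p \<in> P" "x \<in> S" for p x
        using Ck_family_integral_has_derivative[OF assms(1) Suc.prems] that by simp
      show "continuous_on (P \<times> S) (\<lambda>(p, x). integral (cbox a b) (\<lambda>v. f (p, v) x))"
        by (rule c[OF Ck_family_continuous[OF Suc.prems]])
      show "Ck_family k (\<lambda>p x. integral (cbox a b) (\<lambda>v. frechet_derivative (f (p, v)) (at x) u)) P S" for u
        by (rule Suc.IH[OF Ck_family_directional[OF Suc.prems]])
    qed
  qed
qed

section \<open>Multilinearity of higher derivatives\<close>

definition basis_lists :: "nat \<Rightarrow> 'a::euclidean_space list set" where
  "basis_lists n = {bs. set bs \<subseteq> Basis \<and> length bs = n}"

lemma finite_basis_lists: "finite (basis_lists n)"
  unfolding basis_lists_def by (rule finite_lists_length_eq) simp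

lemma sum_basis_lists_Suc:
  "(\<Sum>bs\<in>basis_lists (Suc n). g bs) = (\<Sum>b\<in>Basis. \<Sum>bs\<in>basis_lists n. g (b # bs))"
proof -
  let ?h = "\<lambda>(bs, b). b # bs"
  have "inj_on ?h (basis_lists n \<times> Basis)" by (auto simp: inj_on_def)
  from sum.reindex[OF this, of g]
  have "(\<Sum>bs\<in>basis_lists (Suc n). g bs) =
      (\<Sum>(bs, b)\<in>basis_lists n \<times> Basis. g (b # bs))"
    unfolding basis_lists_def lists_length_Suc_eq by (simp add: o_def case_prod_unfold)
  also have "\<dots> = (\<Sum>bs\<in>basis_lists n. \<Sum>b\<in>Basis. g (b # bs))"
    by (rule sum.cartesian_product[symmetric])
  also have "\<dots> = (\<Sum>b\<in>Basis. \<Sum>bs\<in>basis_lists n. g (b # bs))"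
    by (rule sum.swap)
  finally show ?thesis .
qed

text \<open>
  Expanding every direction in the standard basis replaces the supremum over all unit directions
  in the \<open>C\<^sup>r\<close> norm by finitely many partial derivatives, which can be estimated one at a time.
\<close>

lemma iter_deriv_multilinear:
  fixes f :: "'a::euclidean_space \<Rightarrow> 'b::real_normed_vector"
  assumes "open S" "Ck_on k f S" "length us \<le> k"
  shows "\<exists>c. (\<forall>bs\<in>basis_lists (length us). \<bar>c bs\<bar> \<le> prod_list (map norm us)) \<and>
    (\<forall>x\<in>S. iter_deriv f us x = (\<Sum>bs\<in>basis_lists (length us). c bs *\<^sub>R iter_deriv f bs x))"
  using assms(3)
proof (induction us)
  case Nil
  have "basis_lists 0 = {[] :: 'a list}" unfolding basis_lists_def by auto
  then show ?case by (intro exI[of _ "\<lambda>_. 1"]) simp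
next
  case (Cons u us)
  then have "length us \<le> k" by simp
  from Cons.IH[OF this] obtain c
    where c: "\<And>bs. bs \<in> basis_lists (length us) \<Longrightarrow> \<bar>c bs\<bar> \<le> prod_list (map norm us)"
    "\<And>x. x \<in> S \<Longrightarrow> iter_deriv f us x = (\<Sum>bs\<in>basis_lists (length us). c bs *\<^sub>R iter_deriv f bs x)"
    by blast
  \<comment> \<open>The coefficients are the products of the coordinates of the directions.\<close>
  define c' where "c' bs = (u \<bullet> hd bs) * c (tl bs)" for bs
  have "iter_deriv f (u # us) x = (\<Sum>bs\<in>basis_lists (Suc (length us)). c' bs *\<^sub>R iter_deriv f bs x)"
    if x: "x \<in> S" for x
  proof -
    have d: "iter_deriv f bs differentiable at x" if "bs \<in> basis_lists (length us)" for bs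
      using assms(2) Cons.prems that x unfolding Ck_on_def basis_lists_def by auto
    have "((\<lambda>y. \<Sum>bs\<in>basis_lists (length us). c bs *\<^sub>R iter_deriv f bs y) has_derivative
       (\<lambda>v. \<Sum>bs\<in>basis_lists (length us). c bs *\<^sub>R frechet_derivative (iter_deriv f bs) (at x) v)) (at x)"
      using d by (intro derivative_intros) (simp add: frechet_derivative_works)
    moreover have "(iter_deriv f us has_derivative D) (at x) \<longleftrightarrow>
       ((\<lambda>y. \<Sum>bs\<in>basis_lists (length us). c bs *\<^sub>R iter_deriv f bs y) has_derivative D) (at x)" for D
      using c(2) by (intro has_derivative_cong_open[OF assms(1) x])
    ultimately have "(iter_deriv f us has_derivative
       (\<lambda>v. \<Sum>bs\<in>basis_lists (length us). c bs *\<^sub>R frechet_derivative (iter_deriv f bs) (at x) v)) (at x)"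
      by blast
    from fun_cong[OF frechet_derivative_at[OF this], of u] have "iter_deriv f (u # us) x =
       (\<Sum>bs\<in>basis_lists (length us). c bs *\<^sub>R frechet_derivative (iter_deriv f bs) (at x) u)"
      by simp
    also have "\<dots> = (\<Sum>bs\<in>basis_lists (length us). \<Sum>b\<in>Basis.
        (u \<bullet> b) *\<^sub>R c bs *\<^sub>R iter_deriv f (b # bs) x)"
    proof (intro sum.cong refl)
      fix bs :: "'a list" assume "bs \<in> basis_lists (length us)"
      then have "frechet_derivative (iter_deriv f bs) (at x) u =
          (\<Sum>b\<in>Basis. (u \<bullet> b) *\<^sub>R frechet_derivative (iter_deriv f bs) (at x) b)"
        using d by (intro frechet_derivative_eq_sum_Basis)
      then show "c bs *\<^sub>R frechet_derivative (iter_deriv f bs) (at x) u =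
          (\<Sum>b\<in>Basis. (u \<bullet> b) *\<^sub>R c bs *\<^sub>R iter_deriv f (b # bs) x)"
        by (simp add: scaleR_sum_right mult.commute)
    qed
    also have "\<dots> = (\<Sum>b\<in>Basis. \<Sum>bs\<in>basis_lists (length us). c' (b # bs) *\<^sub>R iter_deriv f (b # bs) x)"
      unfolding c'_def by (subst sum.swap) simp
    also have "\<dots> = (\<Sum>bs\<in>basis_lists (Suc (length us)). c' bs *\<^sub>R iter_deriv f bs x)"
      by (rule sum_basis_lists_Suc[symmetric])
    finally show ?thesis .
  qed
  moreover have "\<bar>c' bs\<bar> \<le> prod_list (map norm (u # us))" if "bs \<in> basis_lists (Suc (length us))" for bs
  proof -
    obtain b bs' where b: "bs = b # bs'" "b \<in> Basis" "bs' \<in> basis_lists (length us)"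
      using \<open>bs \<in> _\<close> unfolding basis_lists_def by (cases bs) auto
    then show ?thesis
      unfolding c'_def using c(1)[OF b(3)] Basis_le_norm[OF b(2), of u] by (auto simp: abs_mult intro!: mult_mono)
  qed
  ultimately show ?case unfolding list.size(4) add_Suc_right add_0_right by blast
qed

lemma norm_iter_deriv_le:
  fixes f :: "'a::euclidean_space \<Rightarrow> 'b::real_normed_vector"
  assumes "open S" "Ck_on k f S" "length us \<le> k" "x \<in> S"
  shows "norm (iter_deriv f us x) \<le>
    prod_list (map norm us) * (\<Sum>bs\<in>basis_lists (length us). norm (iter_deriv f bs x))"
proof -
  obtain c where c: "\<And>bs. bs \<in> basis_lists (length us) \<Longrightarrow> \<bar>c bs\<bar> \<le> prod_list (map norm us)"
    "iter_deriv f us x = (\<Sum>bs\<in>basis_lists (length us). c bs *\<^sub>R iter_deriv f bs x)"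
    using iter_deriv_multilinear[OF assms(1-3)] assms(4) by blast
  have "norm (iter_deriv f us x) \<le> (\<Sum>bs\<in>basis_lists (length us). norm (c bs *\<^sub>R iter_deriv f bs x))"
    unfolding c(2) by (rule norm_sum)
  also have "\<dots> \<le> (\<Sum>bs\<in>basis_lists (length us). prod_list (map norm us) * norm (iter_deriv f bs x))"
    using c(1) by (intro sum_mono) (auto intro!: mult_right_mono)
  finally show ?thesis by (simp add: sum_distrib_left)
qed

lemma iter_deriv_add:
  fixes f g :: "'a::euclidean_space \<Rightarrow> 'b::real_normed_vector"
  assumes "open S" "Ck_on k f S" "Ck_on k g S" "length us \<le> k" "x \<in> S"
  shows "iter_deriv (\<lambda>x. f x + g x) us x = iter_deriv f us x + iter_deriv g us x"
  using assms(4,5)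
proof (induction us arbitrary: x)
  case (Cons u us)
  have "(iter_deriv f us has_derivative frechet_derivative (iter_deriv f us) (at x)) (at x)"
    "(iter_deriv g us has_derivative frechet_derivative (iter_deriv g us) (at x)) (at x)"
    using assms(2,3) Cons.prems unfolding Ck_on_def frechet_derivative_works[symmetric] by auto
  from has_derivative_add[OF this]
  have "(iter_deriv (\<lambda>x. f x + g x) us has_derivative (\<lambda>v. frechet_derivative (iter_deriv f us) (at x) v +
      frechet_derivative (iter_deriv g us) (at x) v)) (at x)"
    using Cons.IH Cons.prems
    by (subst has_derivative_cong_open[OF assms(1) Cons.prems(2),
        of _ "\<lambda>x. iter_deriv f us x + iter_deriv g us x"]) auto
  from fun_cong[OF frechet_derivative_at[OF this], of u] show ?case by simp
qed simp

section \<open>Smooth functions that are positive exactly on a given open set\<close>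

lemma Ck_on_SucI:
  assumes "open S" "\<And>x. x \<in> S \<Longrightarrow> (f has_derivative f' x) (at x)"
    and "\<And>u. Ck_on k (\<lambda>x. f' x u) S"
  shows "Ck_on (Suc k) f S"
proof -
  have "Ck_on k (\<lambda>x. frechet_derivative f (at x) u) S" for u
    using assms(3)[of u] Ck_on_cong[OF assms(1), of "\<lambda>x. f' x u"
        "\<lambda>x. frechet_derivative f (at x) u" k] frechet_derivative_at[OF assms(2)] by metis
  moreover have "continuous_on S f"
    using assms(2) has_derivative_continuous has_derivative_at_withinI
    unfolding continuous_on_eq_continuous_within by blast
  ultimately show ?thesis unfolding Ck_on_Suc using assms(2) differentiableI by blast
qed

lemma Ck_on_compose:
  fixes f :: "'a::euclidean_space \<Rightarrow> 'b::euclidean_space"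
  assumes "open S" "open T" "Ck_on k f S" "Ck_on k g T" "\<And>x. x \<in> S \<Longrightarrow> f x \<in> T"
  shows "Ck_on k (\<lambda>x. g (f x)) S"
  using assms(3,4) unfolding Ck_on_iff_family
  by (rule Ck_family_compose[OF assms(1,2)]) (rule assms(5))

text \<open>
  For \<open>m = 0\<close> this is the standard smooth function that vanishes on the negative half-line. Its
  derivatives are combinations of the functions with larger \<open>m\<close>, so that smoothness is proved
  for all \<open>m\<close> at once.
\<close>

definition flat :: "nat \<Rightarrow> real \<Rightarrow> real" where
  "flat m t = (if t > 0 then exp (- (1 / t)) / t ^ m else 0)"

text \<open>
  The substitution \<open>t = 1 / y\<close> reduces this to \<open>y\<^sup>m / e\<^sup>y\<close> tending to \<open>0\<close> at infinity.
\<close>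

lemma flat_tendsto_0: "(flat m \<longlongrightarrow> 0) (at 0)"
proof (rule filterlim_split_at)
  have "eventually (\<lambda>t. flat m t = 0) (at_left 0)"
    unfolding eventually_at_left_field by (auto simp: flat_def intro: exI[of _ "-1"])
  then show "(flat m \<longlongrightarrow> 0) (at_left 0)" by (simp add: tendsto_eventually)
  have "((\<lambda>t. (inverse t) ^ m / exp (inverse t)) \<longlongrightarrow> (0::real)) (at_right 0)"
    by (rule filterlim_compose[OF tendsto_power_div_exp_0 filterlim_inverse_at_top_right])
  moreover have "eventually (\<lambda>t. (inverse t) ^ m / exp (inverse t) = flat m t) (at_right 0)"
    unfolding eventually_at_right_field
    by (intro exI[of _ 1]) (auto simp: flat_def exp_minus inverse_eq_divide power_divide field_simps)
  ultimately show "(flat m \<longlongrightarrow> 0) (at_right 0)"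
    by (rule Lim_transform_eventually)
qed

lemma flat_has_derivative: "(flat m has_field_derivative (flat (m + 2) t - m * flat (m + 1) t)) (at t)"
proof -
  consider "t < 0" | "t = 0" | "t > 0" by linarith
  then show ?thesis
  proof cases
    case 1
    have "((\<lambda>t. 0) has_field_derivative 0) (at t)" by simp
    then have "(flat m has_field_derivative 0) (at t)"
      by (rule has_field_derivative_transform_within_open[where S = "{..<0}"])
        (use 1 in \<open>auto simp: flat_def\<close>)
    then show ?thesis using 1 by (simp add: flat_def)
  next
    case 2
    have "((\<lambda>y. (flat m y - flat m 0) / (y - 0)) \<longlongrightarrow> 0) (at 0)"
    proof (rule Lim_transform_eventually[OF flat_tendsto_0[of "Suc m"]])
      show "\<forall>\<^sub>F y in at 0. flat (Suc m) y = (flat m y - flat m 0) / (y - 0)"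
        by (rule always_eventually) (auto simp: flat_def)
    qed
    then show ?thesis using 2 unfolding has_field_derivative_iff by (simp add: flat_def)
  next
    case 3
    have "((\<lambda>t. exp (- (1 / t))) has_field_derivative exp (- (1 / t)) / t\<^sup>2) (at t)"
      using 3 by (auto intro!: derivative_eq_intros simp: power2_eq_square)
    from DERIV_divide[OF this DERIV_pow[of m t]]
    have "((\<lambda>t. exp (- (1 / t)) / t ^ m) has_field_derivative
        (exp (- (1 / t)) / t\<^sup>2 * t ^ m - exp (- (1 / t)) * (m * t ^ (m - Suc 0))) / (t ^ m * t ^ m)) (at t)"
      using 3 by simp
    moreover have "(exp (- (1 / t)) / t\<^sup>2 * t ^ m - exp (- (1 / t)) * (m * t ^ (m - Suc 0))) / (t ^ m * t ^ m)
        = exp (- (1 / t)) / t ^ (m + 2) - m * (exp (- (1 / t)) / t ^ (m + 1))"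
      using 3 by (cases m) (auto simp: field_simps power2_eq_square)
    ultimately have "((\<lambda>t. exp (- (1 / t)) / t ^ m) has_field_derivative
        (exp (- (1 / t)) / t ^ (m + 2) - m * (exp (- (1 / t)) / t ^ (m + 1)))) (at t)" by simp
    then have "(flat m has_field_derivative
        (exp (- (1 / t)) / t ^ (m + 2) - m * (exp (- (1 / t)) / t ^ (m + 1)))) (at t)"
      by (rule has_field_derivative_transform_within_open[where S = "{0<..}"])
        (use 3 in \<open>auto simp: flat_def\<close>)
    then show ?thesis using 3 by (simp add: flat_def)
  qed
qed

lemma Ck_on_flat: "Ck_on k (flat m) UNIV"
proof (induction k arbitrary: m)
  case 0
  have "continuous_on UNIV (flat m)"
    using flat_has_derivative DERIV_isCont continuous_at_imp_continuous_on by blast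
  then show ?case by (simp add: Ck_on_def)
next
  case (Suc k)
  show ?case
  proof (rule Ck_on_SucI[OF open_UNIV])
    show "(flat m has_derivative (\<lambda>u. (flat (m + 2) t - m * flat (m + 1) t) * u)) (at t)" for t
      using flat_has_derivative unfolding has_field_derivative_def .
    show "Ck_on k (\<lambda>t. (flat (m + 2) t - m * flat (m + 1) t) * u) UNIV" for u
      using Suc[of "m + 2"] Suc[of "m + 1"] unfolding Ck_on_iff_family
      by (intro Ck_family_mult Ck_family_diff Ck_family_const open_UNIV)
  qed
qed

definition ball_bump :: "'a::euclidean_space \<Rightarrow> real \<Rightarrow> 'a \<Rightarrow> real" where
  "ball_bump a R x = flat 0 (R\<^sup>2 - (x - a) \<bullet> (x - a))"

lemma Ck_on_ball_bump: "Ck_on k (ball_bump a R) UNIV"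
proof -
  have "Ck_on k (\<lambda>x. flat 0 (R\<^sup>2 - (x - a) \<bullet> (x - a))) UNIV"
  proof (rule Ck_on_compose[OF open_UNIV open_UNIV _ Ck_on_flat])
    show "Ck_on k (\<lambda>x. R\<^sup>2 - (x - a) \<bullet> (x - a)) UNIV"
      unfolding Ck_on_iff_family
      by (intro Ck_family_diff Ck_family_inner Ck_family_const Ck_family_id open_UNIV)
  qed auto
  then show ?thesis unfolding ball_bump_def .
qed

lemma ball_bump_nonneg: "ball_bump a R x \<ge> 0"
  by (simp add: ball_bump_def flat_def)

lemma ball_bump_pos_iff:
  assumes "R > 0"
  shows "ball_bump a R x > 0 \<longleftrightarrow> x \<in> ball a R"
proof -
  have "(x - a) \<bullet> (x - a) = (norm (x - a))\<^sup>2" by (simp add: power2_norm_eq_inner)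
  moreover have "(norm (x - a))\<^sup>2 < R\<^sup>2 \<longleftrightarrow> norm (x - a) < R"
    using assms by (smt (verit) norm_ge_zero power_mono power_strict_mono zero_less_numeral)
  ultimately show ?thesis
    by (auto simp: ball_bump_def flat_def dist_norm norm_minus_commute)
qed

lemma iter_deriv_zero:
  "iter_deriv (\<lambda>_. 0) us = (\<lambda>_::'a::euclidean_space. 0::'b::real_normed_vector)"
  by (induction us) (simp_all add: frechet_derivative_const)

lemma iter_deriv_scaleR:
  fixes f :: "'a::euclidean_space \<Rightarrow> 'b::real_normed_vector"
  assumes "open S" "Ck_on k f S" "length us \<le> k" "x \<in> S"
  shows "iter_deriv (\<lambda>x. c *\<^sub>R f x) us x = c *\<^sub>R iter_deriv f us x"
  using assms(3,4)
proof (induction us arbitrary: x)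
  case (Cons u us)
  have "(iter_deriv f us has_derivative frechet_derivative (iter_deriv f us) (at x)) (at x)"
    using assms(2) Cons.prems unfolding Ck_on_def frechet_derivative_works[symmetric] by auto
  from has_derivative_scaleR_right[OF this, of c]
  have "(iter_deriv (\<lambda>x. c *\<^sub>R f x) us has_derivative
      (\<lambda>v. c *\<^sub>R frechet_derivative (iter_deriv f us) (at x) v)) (at x)"
    using Cons.IH Cons.prems
    by (subst has_derivative_cong_open[OF assms(1) Cons.prems(2),
        of _ "\<lambda>x. c *\<^sub>R iter_deriv f us x"]) auto
  from fun_cong[OF frechet_derivative_at[OF this], of u] show ?case by simp
qed simp

lemma iter_deriv_bounded:
  fixes f :: "'a::euclidean_space \<Rightarrow> 'b::real_normed_vector"
  assumes "smooth_on f UNIV" "\<And>x. x \<notin> cball a R \<Longrightarrow> f x = 0"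
  shows "\<exists>B. \<forall>x. norm (iter_deriv f us x) \<le> B"
proof -
  have "continuous_on (cball a R) (iter_deriv f us)"
    using assms(1) unfolding smooth_on_def Ck_on_def by (meson continuous_on_subset order_refl subset_UNIV)
  then have "bounded (iter_deriv f us ` cball a R)"
    by (intro compact_imp_bounded compact_continuous_image compact_cball)
  then obtain B where "\<forall>y\<in>iter_deriv f us ` cball a R. norm y \<le> B"
    unfolding bounded_iff by blast
  then have B: "norm (iter_deriv f us x) \<le> B" if "x \<in> cball a R" for x
    using that by blast
  have "iter_deriv f us x = 0" if "x \<notin> cball a R" for x
    using iter_deriv_cong_open[of "- cball a R" f "\<lambda>_. 0" x us] that assms(2)
    by (auto simp: iter_deriv_zero)
  then have "norm (iter_deriv f us x) \<le> max B 0" for x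
    using B[of x] by (cases "x \<in> cball a R") auto
  then show ?thesis by blast
qed

text \<open>
  The Weierstrass M-test for all derivatives at once: the series of derivatives in any fixed
  list of directions converges uniformly, hence is differentiated term by term.
\<close>

lemma smooth_on_series:
  fixes f :: "nat \<Rightarrow> 'a::euclidean_space \<Rightarrow> 'b::banach"
  assumes sm: "\<And>n. smooth_on (f n) UNIV"
    and bd: "\<And>us. \<exists>M. summable M \<and> (\<forall>n x. norm (iter_deriv (f n) us x) \<le> M n)"
  shows "smooth_on (\<lambda>x. \<Sum>n. f n x) UNIV"
proof -
  define F where "F = (\<lambda>x. \<Sum>n. f n x)"
  define G where "G us x = (\<Sum>n. iter_deriv (f n) us x)" for us x
  have G': "(G us has_derivative (\<lambda>h. \<Sum>n. frechet_derivative (iter_deriv (f n) us) (at x) h)) (at x)" for us x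
  proof -
    define D where "D n x h = frechet_derivative (iter_deriv (f n) us) (at x) h" for n x h
    have df: "iter_deriv (f n) us differentiable (at x)" for n x
      using sm[of n] unfolding smooth_on_def Ck_on_def by blast
    obtain M where M: "\<And>b. summable (M b)" "\<And>b n x. norm (iter_deriv (f n) (b # us) x) \<le> M b n"
      using bd[of "b # us" for b] by metis
    define N where "N n = (\<Sum>b\<in>(Basis::'a set). M b n)" for n
    have sN: "summable N" unfolding N_def by (intro summable_sum M)
    have DN: "norm (D n x h) \<le> norm h * N n" for n x h
    proof -
      have "D n x h = (\<Sum>b\<in>Basis. (h \<bullet> b) *\<^sub>R iter_deriv (f n) (b # us) x)"
        unfolding D_def iter_deriv.simps by (rule frechet_derivative_eq_sum_Basis[OF df])
      also have "norm \<dots> \<le> (\<Sum>b\<in>Basis. norm ((h \<bullet> b) *\<^sub>R iter_deriv (f n) (b # us) x))"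
        by (rule norm_sum)
      also have "\<dots> \<le> (\<Sum>b\<in>Basis. norm h * M b n)"
        unfolding norm_scaleR by (intro sum_mono mult_mono M) (auto simp: Basis_le_norm)
      finally show ?thesis unfolding N_def by (simp add: sum_distrib_left)
    qed
    have sD: "summable (\<lambda>n. norm (D n x h))" for x h
      by (rule summable_comparison_test'[OF summable_mult[OF sN, of "norm h"], of 0]) (use DN in auto)
    obtain M0 where M0: "summable M0" "\<And>n x. norm (iter_deriv (f n) us x) \<le> M0 n"
      using bd[of us] by blast
    have s0: "summable (\<lambda>n. iter_deriv (f n) us x)" for x
      by (rule summable_comparison_test'[OF M0(1), of 0]) (use M0(2) in auto)
    have "\<exists>g. \<forall>x\<in>UNIV. (\<lambda>n. iter_deriv (f n) us x) sums (g x) \<and>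
        (g has_derivative (\<lambda>h. \<Sum>n. D n x h)) (at x within UNIV)"
    proof (rule has_derivative_series)
      show "(iter_deriv (f n) us has_derivative D n x) (at x within UNIV)" for n x
        unfolding D_def using df by (simp add: frechet_derivative_works)
      show "(\<lambda>n. iter_deriv (f n) us 0) sums (\<Sum>n. iter_deriv (f n) us 0)"
        using s0 by (rule summable_sums)
      fix e :: real assume "e > 0"
      then obtain m where m: "\<And>n. n \<ge> m \<Longrightarrow> norm (\<Sum>i. N (i + n)) < e"
        using suminf_exist_split[OF _ sN] by blast
      have "norm ((\<Sum>i<n. D i x h) - (\<Sum>i. D i x h)) \<le> e * norm h" if "n \<ge> m" for n x h
      proof -
        have s: "summable (\<lambda>i. norm (D (i + n) x h))" using sD summable_ignore_initial_segment by fast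
        have "(\<Sum>i. D i x h) = (\<Sum>i. D (i + n) x h) + (\<Sum>i<n. D i x h)"
          by (rule suminf_split_initial_segment[OF summable_norm_cancel[OF sD]])
        then have "norm ((\<Sum>i<n. D i x h) - (\<Sum>i. D i x h)) = norm (\<Sum>i. D (i + n) x h)" by simp
        also have "\<dots> \<le> (\<Sum>i. norm (D (i + n) x h))" by (rule summable_norm[OF s])
        also have "\<dots> \<le> (\<Sum>i. norm h * N (i + n))"
          by (intro suminf_le DN s summable_mult summable_ignore_initial_segment sN)
        also have "\<dots> = norm h * (\<Sum>i. N (i + n))"
          by (intro suminf_mult summable_ignore_initial_segment sN)
        also have "\<dots> \<le> norm h * e"
          using m[OF that] by (intro mult_left_mono) auto
        finally show ?thesis by (simp add: mult.commute)
      qed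
      then show "\<forall>\<^sub>F n in sequentially. \<forall>x\<in>UNIV. \<forall>h. norm ((\<Sum>i<n. D i x h) - (\<Sum>i. D i x h)) \<le> e * norm h"
        unfolding eventually_sequentially by blast
    qed auto
    then obtain g where g: "\<And>x. (\<lambda>n. iter_deriv (f n) us x) sums (g x)"
      "\<And>x. (g has_derivative (\<lambda>h. \<Sum>n. D n x h)) (at x)" by auto
    have "g = G us" unfolding G_def using g(1) sums_unique by blast
    then show ?thesis using g(2)[of x] unfolding D_def by simp
  qed
  have FG: "iter_deriv F us = G us" for us
  proof (induction us)
    case Nil show ?case by (auto simp: F_def G_def)
  next
    case (Cons u us)
    have "iter_deriv F (u # us) x = G (u # us) x" for x
      using fun_cong[OF frechet_derivative_at[OF G'[of us x]], of u] by (simp add: Cons.IH) (simp add: G_def)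
    then show ?case by blast
  qed
  have "iter_deriv F us differentiable (at x)" for us x
    unfolding FG using G' differentiableI by blast
  moreover from this have "continuous_on UNIV (iter_deriv F us)" for us
    using differentiable_imp_continuous_within continuous_at_imp_continuous_on by blast
  ultimately show ?thesis unfolding smooth_on_def Ck_on_def F_def by blast
qed

text \<open>
  The open set is a countable union of balls, each of which carries a bump function. The sum of
  these bumps has the right positivity set, and it is smooth if the \<open>n\<close>-th bump is scaled so
  that its partial derivatives of order at most \<open>n\<close> are bounded by \<open>2\<^sup>-\<^sup>n\<close>: for each fixed order
  this bound is then available for all but finitely many terms.
\<close>

lemma smooth_positive_exactly_on:
  fixes U :: "'a::euclidean_space set"
  assumes "open U"
  shows "\<exists>\<delta>::'a \<Rightarrow> real. smooth_on \<delta> UNIV \<and> (\<forall>x. 0 \<le> \<delta> x \<and> \<delta> x \<le> 1) \<and> (\<forall>x. 0 < \<delta> x \<longleftrightarrow> x \<in> U)"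
proof (cases "U = {}")
  case True
  have "smooth_on (\<lambda>_::'a. 0::real) UNIV"
    unfolding smooth_on_def Ck_on_iff_family by (auto intro: Ck_family_const)
  then show ?thesis using True by (intro exI[of _ "\<lambda>_. 0"]) auto
next
  case False
  define F where "F = {ball x e | x e. e > 0 \<and> ball x e \<subseteq> U}"
  have "\<Union>F = U"
  proof
    show "U \<subseteq> \<Union>F"
    proof
      fix x assume "x \<in> U"
      then obtain e where "e > 0" "ball x e \<subseteq> U" using assms openE by blast
      then have "ball x e \<in> F" "x \<in> ball x e" unfolding F_def by auto
      then show "x \<in> \<Union>F" by blast
    qed
  qed (auto simp: F_def)
  have "\<And>S. S \<in> F \<Longrightarrow> open S" unfolding F_def by auto
  from Lindelof[of F, OF this] obtain F' where F': "F' \<subseteq> F" "countable F'" "\<Union>F' = \<Union>F" by blast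
  then have ne: "F' \<noteq> {}" using False \<open>\<Union>F = U\<close> by auto
  have "\<forall>n. \<exists>x e. e > 0 \<and> from_nat_into F' n = ball x e"
    using from_nat_into[OF ne] F'(1) unfolding F_def by blast
  then obtain a R where aR: "\<And>n. R n > 0" "\<And>n. from_nat_into F' n = ball (a n) (R n)" by metis
  have U: "U = (\<Union>n. ball (a n) (R n))"
    using F' \<open>\<Union>F = U\<close> range_from_nat_into[OF ne F'(2)] aR(2) by auto
  define b where "b n = ball_bump (a n) (R n)" for n
  have sb: "smooth_on (b n) UNIV" for n
    unfolding b_def smooth_on_def using Ck_on_ball_bump by blast
  have b0: "b n x = 0" if "x \<notin> cball (a n) (R n)" for n x
    using ball_bump_pos_iff[OF aR(1)[of n], of "a n" x] ball_bump_nonneg[of "a n" "R n" x] that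
    unfolding b_def by (auto simp: less_le)
  have "\<exists>B. \<forall>x. norm (iter_deriv (b n) us x) \<le> B" for n us
    by (rule iter_deriv_bounded[OF sb, of "a n" "R n"]) (rule b0)
  then obtain B where B: "\<And>n us x. norm (iter_deriv (b n) us x) \<le> B n us" by metis
  have Bnn: "0 \<le> B n us" for n us using B[of n us 0] norm_ge_zero order_trans by blast
  define M where "M n = (\<Sum>us\<in>(\<Union>j\<le>n. basis_lists j). B n us)" for n
  have fin: "finite (\<Union>j\<le>n. basis_lists j :: 'a list set)" for n
    by (intro finite_UN_I finite_basis_lists) auto
  have Mnn: "0 \<le> M n" for n unfolding M_def by (intro sum_nonneg Bnn)
  have M: "norm (iter_deriv (b n) bs x) \<le> M n" if "bs \<in> basis_lists j" "j \<le> n" for n j bs x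
  proof -
    have "B n bs \<le> M n" unfolding M_def
      by (rule member_le_sum[OF _ Bnn fin]) (use that in blast)
    then show ?thesis using B order_trans by blast
  qed
  \<comment> \<open>Division by \<open>1 + M n\<close>, not \<open>M n\<close>, because \<open>M n\<close> may vanish.\<close>
  define c where "c n = (1 / 2) ^ Suc n / (1 + M n)" for n
  have c0: "c n > 0" for n unfolding c_def using Mnn[of n] by simp
  have cM: "c n * M n \<le> (1 / 2) ^ Suc n" for n
    using Mnn[of n] unfolding c_def by (simp add: divide_le_eq mult_left_mono)
  define f where "f n x = c n *\<^sub>R b n x" for n x
  have itf: "iter_deriv (f n) us x = c n *\<^sub>R iter_deriv (b n) us x" for n us x
    unfolding f_def using sb[of n] unfolding smooth_on_def
    by (intro iter_deriv_scaleR[OF open_UNIV, of "length us"]) auto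
  have sf: "smooth_on (f n) UNIV" for n
    using sb[of n] unfolding smooth_on_def f_def Ck_on_iff_family
    by (auto intro!: Ck_family_scaleR[OF open_UNIV] Ck_family_const[OF open_UNIV] simp del: real_scaleR_def)
  have small: "norm (f n x) \<le> (1 / 2) ^ Suc n" for n x
  proof -
    have "norm (iter_deriv (b n) [] x) \<le> M n" by (rule M[of _ 0]) (auto simp: basis_lists_def)
    then have "norm (f n x) \<le> c n * M n" using c0[of n] by (simp add: f_def abs_mult mult_left_mono)
    then show ?thesis using cM order_trans by blast
  qed
  have geo: "summable (\<lambda>n. (1 / 2 :: real) ^ Suc n)" by (simp add: summable_geometric)
  have sumf: "summable (\<lambda>n. f n x)" for x
    by (rule summable_comparison_test'[OF geo, of 0]) (use small in auto)
  have "smooth_on (\<lambda>x. \<Sum>n. f n x) UNIV"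
  proof (rule smooth_on_series[OF sf])
    fix us :: "'a list"
    define K where "K = prod_list (map norm us) * real (card (basis_lists (length us) :: 'a list set))"
    define m where "m n = (if n < length us then c n * B n us else K * (1 / 2) ^ Suc n)" for n
    have pn: "0 \<le> prod_list (map norm us)" by (induction us) auto
    have "norm (iter_deriv (f n) us x) \<le> m n" for n x
    proof (cases "n < length us")
      case True
      then show ?thesis using c0[of n] B[of n us x] unfolding itf m_def by (simp add: abs_mult mult_left_mono)
    next
      case False
      have "norm (iter_deriv (f n) us x) = c n * norm (iter_deriv (b n) us x)"
        using c0[of n] unfolding itf by (simp add: abs_mult)
      also have "\<dots> \<le> c n * (prod_list (map norm us) *
          (\<Sum>bs\<in>basis_lists (length us). norm (iter_deriv (b n) bs x)))"
        using c0[of n] sb[of n] norm_iter_deriv_le[OF open_UNIV, of "length us" "b n" us x]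
        unfolding smooth_on_def by (intro mult_left_mono) auto
      also have "\<dots> \<le> c n * (prod_list (map norm us) *
          (\<Sum>bs\<in>(basis_lists (length us) :: 'a list set). M n))"
        using c0[of n] False by (intro mult_left_mono sum_mono M[of _ "length us"] pn) auto
      also have "\<dots> = K * (c n * M n)" unfolding K_def by simp
      also have "\<dots> \<le> K * (1 / 2) ^ Suc n"
        using cM[of n] pn unfolding K_def by (intro mult_left_mono) auto
      finally show ?thesis using False unfolding m_def by simp
    qed
    moreover have "summable m"
    proof (rule summable_cong[THEN iffD2])
      show "\<forall>\<^sub>F n in sequentially. m n = K * (1 / 2) ^ Suc n"
        unfolding eventually_sequentially m_def by (intro exI[of _ "length us"]) auto
      show "summable (\<lambda>n. K * (1 / 2) ^ Suc n)" by (rule summable_mult[OF geo])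
    qed
    ultimately show "\<exists>M. summable M \<and> (\<forall>n x. norm (iter_deriv (f n) us x) \<le> M n)" by blast
  qed
  moreover have nn: "0 \<le> f n x" for n x
    using c0[of n] ball_bump_nonneg[of "a n" "R n" x] by (simp add: f_def b_def)
  have "0 \<le> (\<Sum>n. f n x)" for x by (rule suminf_nonneg[OF sumf nn])
  moreover have "(\<Sum>n. f n x) \<le> 1" for x
  proof -
    have "(\<Sum>n. f n x) \<le> (\<Sum>n. (1 / 2) ^ Suc n)"
      using small[of _ x] nn[of _ x] by (intro suminf_le sumf geo) (auto simp: abs_of_nonneg)
    also have "\<dots> = 1" using power_half_series sums_unique by metis
    finally show ?thesis .
  qed
  moreover have "0 < (\<Sum>n. f n x) \<longleftrightarrow> x \<in> U" for x
  proof -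
    have "0 < (\<Sum>n. f n x) \<longleftrightarrow> (\<exists>n. 0 < f n x)" by (rule suminf_pos_iff[OF sumf nn])
    also have "\<dots> \<longleftrightarrow> (\<exists>n. x \<in> ball (a n) (R n))"
    proof -
      have "0 < f n x \<longleftrightarrow> x \<in> ball (a n) (R n)" for n
        using c0[of n] ball_bump_pos_iff[OF aR(1)[of n], of "a n" x]
        by (simp only: f_def b_def real_scaleR_def zero_less_mult_iff) auto
      then show ?thesis by blast
    qed
    finally show ?thesis unfolding U by blast
  qed
  ultimately show ?thesis by (intro exI[of _ "\<lambda>x. \<Sum>n. f n x"]) auto
qed

lemma mollifier_exists:
  "\<exists>\<rho>::'a::euclidean_space \<Rightarrow> real. smooth_on \<rho> UNIV \<and> (\<forall>v. v \<notin> cbox (- One) One \<longrightarrow> \<rho> v = 0) \<and>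
    (\<rho> has_integral 1) (cbox (- One) One)"
proof -
  define g where "g = ball_bump (0::'a) 1"
  have cg: "continuous_on (cbox (- One) One) g"
    using Ck_on_ball_bump[of 0 "0::'a" 1] unfolding g_def Ck_on_def by (auto intro: continuous_on_subset)
  define I where "I = integral (cbox (- One) One) g"
  have gI: "(g has_integral I) (cbox (- One) One)"
    unfolding I_def using integrable_continuous[OF cg] by (rule integrable_integral)
  have "I \<noteq> 0"
  proof
    assume "I = 0"
    then have "(g has_integral 0) (cbox (- One) One)" using gI by simp
    moreover have "box (- One) (One::'a) \<noteq> {}" by (auto simp: box_ne_empty)
    ultimately have "g 0 = 0"
      using cg by (intro has_integral_0_cbox_imp_0[of "- One" "One::'a" g 0])
        (auto simp: g_def mem_box ball_bump_nonneg)
    then show False using ball_bump_pos_iff[of 1 "0::'a" 0] by (simp add: g_def)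
  qed
  define \<rho> where "\<rho> v = g v * inverse I" for v
  have "(\<rho> has_integral 1) (cbox (- One) One)"
    using has_integral_mult_left[OF gI, of "inverse I"] \<open>I \<noteq> 0\<close> unfolding \<rho>_def by simp
  moreover have "\<rho> v = 0" if "v \<notin> cbox (- One) One" for v
  proof -
    have "v \<notin> ball 0 1"
    proof
      assume v: "v \<in> ball 0 1"
      have "\<bar>v \<bullet> b\<bar> \<le> 1" if "b \<in> Basis" for b
        using Basis_le_norm[OF that, of v] v by (auto simp: dist_norm)
      then have "v \<in> cbox (- One) One" by (auto simp: mem_box abs_le_iff)
      then show False using that by blast
    qed
    then show ?thesis
      using ball_bump_pos_iff[of 1 "0::'a" v] ball_bump_nonneg[of 0 1 v] by (auto simp: \<rho>_def g_def less_le)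
  qed
  moreover have "smooth_on \<rho> UNIV"
    using Ck_on_ball_bump[of _ "0::'a" 1] unfolding smooth_on_def \<rho>_def g_def Ck_on_iff_family
    by (auto intro!: Ck_family_mult[OF open_UNIV] Ck_family_const[OF open_UNIV])
  ultimately show ?thesis by blast
qed

section \<open>Symmetry of second derivatives\<close>

text \<open>
  The second difference is symmetric in \<open>u\<close> and \<open>v\<close>, while two applications of the mean value
  theorem express it by a mixed derivative at a nearby point, in an order that depends on which
  of the two directions is treated first. Shrinking \<open>h\<close> then gives the symmetry of the
  second derivative.
\<close>

lemma second_difference_mean_value:
  fixes f :: "'a::euclidean_space \<Rightarrow> real"
  assumes "Ck_on 2 f S" "ball x r \<subseteq> S" "h > 0" "h * (norm u + norm v) < r"
  shows "\<exists>y. norm (y - x) \<le> h * (norm u + norm v) \<and>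
    f (x + h *\<^sub>R u + h *\<^sub>R v) - f (x + h *\<^sub>R u) - f (x + h *\<^sub>R v) + f x =
      h * h * frechet_derivative (\<lambda>z. frechet_derivative f (at z) u) (at y) v"
proof -
  have c2: "Ck_on (Suc 1) f S" using assms(1) by (simp add: numeral_2_eq_2)
  have n: "norm (s *\<^sub>R u + t *\<^sub>R v) \<le> h * (norm u + norm v)" if "0 \<le> s" "s \<le> h" "0 \<le> t" "t \<le> h" for s t
  proof -
    have "norm (s *\<^sub>R u + t *\<^sub>R v) \<le> s * norm u + t * norm v"
      using norm_triangle_ineq[of "s *\<^sub>R u" "t *\<^sub>R v"] that by simp
    also have "\<dots> \<le> h * norm u + h * norm v" using that by (intro add_mono mult_right_mono) auto
    finally show ?thesis by (simp add: distrib_left)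
  qed
  have inS: "x + s *\<^sub>R u + t *\<^sub>R v \<in> S" if "0 \<le> s" "s \<le> h" "0 \<le> t" "t \<le> h" for s t
    using n[OF that] assms(2,4) by (auto simp: dist_norm add.assoc norm_minus_commute subset_iff)
  have D: "((\<lambda>s. g (a + s *\<^sub>R w)) has_field_derivative frechet_derivative g (at (a + s *\<^sub>R w)) w) (at s)"
    if "Ck_on k g S" "k > 0" "a + s *\<^sub>R w \<in> S" for g :: "'a \<Rightarrow> real" and k a w s
  proof -
    have gd: "(g has_derivative frechet_derivative g (at (a + s *\<^sub>R w))) (at (a + s *\<^sub>R w))"
      by (rule Ck_on_has_derivative[OF that])
    have "((\<lambda>s. a + s *\<^sub>R w) has_derivative (\<lambda>t. t *\<^sub>R w)) (at s)"
      by (auto intro!: derivative_eq_intros)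
    from has_derivative_compose[OF this gd]
    have "((\<lambda>s. g (a + s *\<^sub>R w)) has_derivative (\<lambda>t. frechet_derivative g (at (a + s *\<^sub>R w)) (t *\<^sub>R w))) (at s)" .
    moreover have "frechet_derivative g (at (a + s *\<^sub>R w)) (t *\<^sub>R w) = frechet_derivative g (at (a + s *\<^sub>R w)) w * t" for t
      using linear_scale[OF has_derivative_linear[OF gd], of t w] by simp
    ultimately show ?thesis unfolding has_field_derivative_def by simp
  qed
  define \<phi> where "\<phi> s = f ((x + h *\<^sub>R v) + s *\<^sub>R u) - f (x + s *\<^sub>R u)" for s
  have "DERIV \<phi> s :> frechet_derivative f (at ((x + h *\<^sub>R v) + s *\<^sub>R u)) u - frechet_derivative f (at (x + s *\<^sub>R u)) u"
    if "0 \<le> s" "s \<le> h" for s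
    unfolding \<phi>_def using inS[of s h] inS[of s 0] that assms(3)
    by (intro DERIV_diff D[OF assms(1)]) (auto simp: algebra_simps)
  from MVT2[OF assms(3) this] obtain \<xi> where \<xi>: "0 < \<xi>" "\<xi> < h" and
    1: "\<phi> h - \<phi> 0 = h * (frechet_derivative f (at (x + h *\<^sub>R v + \<xi> *\<^sub>R u)) u - frechet_derivative f (at (x + \<xi> *\<^sub>R u)) u)"
    by auto
  define g where "g = (\<lambda>z. frechet_derivative f (at z) u)"
  have cg: "Ck_on 1 g S" unfolding g_def by (rule Ck_on_directional[OF c2])
  have "DERIV (\<lambda>t. g ((x + \<xi> *\<^sub>R u) + t *\<^sub>R v)) t :> frechet_derivative g (at ((x + \<xi> *\<^sub>R u) + t *\<^sub>R v)) v"
    if "0 \<le> t" "t \<le> h" for t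
    using inS[of \<xi> t] that \<xi> by (intro D[OF cg]) auto
  from MVT2[OF assms(3) this] obtain \<eta> where \<eta>: "0 < \<eta>" "\<eta> < h" and
    2: "g (x + \<xi> *\<^sub>R u + h *\<^sub>R v) - g (x + \<xi> *\<^sub>R u) = h * frechet_derivative g (at (x + \<xi> *\<^sub>R u + \<eta> *\<^sub>R v)) v"
    by auto
  show ?thesis
  proof (intro exI conjI)
    show "norm (x + \<xi> *\<^sub>R u + \<eta> *\<^sub>R v - x) \<le> h * (norm u + norm v)"
      using n[of \<xi> \<eta>] \<xi> \<eta> by (simp add: algebra_simps)
    have "f (x + h *\<^sub>R u + h *\<^sub>R v) - f (x + h *\<^sub>R u) - f (x + h *\<^sub>R v) + f x = \<phi> h - \<phi> 0"
      unfolding \<phi>_def by (simp add: algebra_simps)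
    also have "\<dots> = h * (g (x + \<xi> *\<^sub>R u + h *\<^sub>R v) - g (x + \<xi> *\<^sub>R u))"
      unfolding 1 g_def by (simp add: algebra_simps)
    also have "\<dots> = h * h * frechet_derivative g (at (x + \<xi> *\<^sub>R u + \<eta> *\<^sub>R v)) v" unfolding 2 by simp
    finally show "f (x + h *\<^sub>R u + h *\<^sub>R v) - f (x + h *\<^sub>R u) - f (x + h *\<^sub>R v) + f x =
      h * h * frechet_derivative (\<lambda>z. frechet_derivative f (at z) u) (at (x + \<xi> *\<^sub>R u + \<eta> *\<^sub>R v)) v"
      unfolding g_def .
  qed
qed

lemma second_derivative_symmetric_real:
  fixes f :: "'a::euclidean_space \<Rightarrow> real"
  assumes "open S" "Ck_on 2 f S" "x \<in> S"
  shows "frechet_derivative (\<lambda>z. frechet_derivative f (at z) u) (at x) v =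
    frechet_derivative (\<lambda>z. frechet_derivative f (at z) v) (at x) u"
proof -
  define A where "A u v y = frechet_derivative (\<lambda>z. frechet_derivative f (at z) u) (at y) v" for u v y
  obtain r where r: "r > 0" "ball x r \<subseteq> S" using assms(1,3) openE by blast
  have cA: "continuous_on S (A u v)" for u v
  proof -
    have "Ck_on (Suc (Suc 0)) f S" using assms(2) by (simp add: numeral_2_eq_2)
    then show ?thesis unfolding A_def by (intro Ck_on_imp_continuous_on Ck_on_directional)
  qed
  have "\<bar>A u v x - A v u x\<bar> < e" if "e > 0" for e
  proof -
    have "\<exists>d>0. \<forall>y\<in>S. dist y x < d \<longrightarrow> dist (A u v y) (A u v x) < e / 2" for u v
      using cA[of u v] assms(3) \<open>e > 0\<close> unfolding continuous_on_iff by (meson half_gt_zero)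
    then obtain d1 d2 where d: "d1 > 0" "d2 > 0"
      "\<And>y. y \<in> S \<Longrightarrow> dist y x < d1 \<Longrightarrow> dist (A u v y) (A u v x) < e / 2"
      "\<And>y. y \<in> S \<Longrightarrow> dist y x < d2 \<Longrightarrow> dist (A v u y) (A v u x) < e / 2"
      by metis
    define m where "m = min r (min d1 d2)"
    define h where "h = m / (norm u + norm v + 1)"
    have m: "m > 0" unfolding m_def using r d by auto
    have h: "h > 0" "h * (norm u + norm v) < m"
      unfolding h_def using m by (auto simp: field_simps add_pos_nonneg intro: add_nonneg_pos)
    obtain y where y: "norm (y - x) \<le> h * (norm u + norm v)"
      "f (x + h *\<^sub>R u + h *\<^sub>R v) - f (x + h *\<^sub>R u) - f (x + h *\<^sub>R v) + f x = h * h * A u v y"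
      using second_difference_mean_value[OF assms(2) r(2) h(1), of u v] h(2) unfolding A_def m_def by auto
    obtain z where z: "norm (z - x) \<le> h * (norm u + norm v)"
      "f (x + h *\<^sub>R v + h *\<^sub>R u) - f (x + h *\<^sub>R v) - f (x + h *\<^sub>R u) + f x = h * h * A v u z"
      using second_difference_mean_value[OF assms(2) r(2) h(1), of v u] h(2)
      unfolding A_def m_def by (auto simp: add.commute)
    have "h * h * A u v y = h * h * A v u z" using y(2) z(2) by (simp add: algebra_simps)
    then have eq: "A u v y = A v u z" using h(1) by simp
    have yz: "dist y x < m" "dist z x < m" using y(1) z(1) h(2) by (auto simp: dist_norm)
    then have "y \<in> S" "z \<in> S" using r(2) unfolding m_def by (auto simp: dist_commute subset_iff)
    then have "dist (A u v y) (A u v x) < e / 2" "dist (A v u z) (A v u x) < e / 2"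
      using yz d(3,4) unfolding m_def by auto
    then show ?thesis using eq unfolding dist_real_def by linarith
  qed
  from this[of "\<bar>A u v x - A v u x\<bar>"] have "A u v x = A v u x" by auto
  then show ?thesis unfolding A_def .
qed

lemma second_derivative_symmetric:
  fixes f :: "'a::euclidean_space \<Rightarrow> 'b::euclidean_space"
  assumes "open S" "Ck_on 2 f S" "x \<in> S"
  shows "frechet_derivative (\<lambda>z. frechet_derivative f (at z) u) (at x) v =
    frechet_derivative (\<lambda>z. frechet_derivative f (at z) v) (at x) u"
proof (rule euclidean_eqI)
  fix b :: 'b assume "b \<in> Basis"
  have c2: "Ck_on (Suc 1) f S" using assms(2) by (simp add: numeral_2_eq_2)
  have comp: "(\<lambda>z. frechet_derivative g (at z) w \<bullet> b) z = frechet_derivative (\<lambda>z. g z \<bullet> b) (at z) w"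
    if "Ck_on 1 g S" "z \<in> S" for g :: "'a \<Rightarrow> 'b" and w z
  proof -
    have "(g has_derivative frechet_derivative g (at z)) (at z)"
      by (rule Ck_on_has_derivative[OF that(1) _ that(2)]) simp
    then have "((\<lambda>z. g z \<bullet> b) has_derivative (\<lambda>h. frechet_derivative g (at z) h \<bullet> b)) (at z)"
      by (rule has_derivative_inner_left)
    from frechet_derivative_at[OF this] show ?thesis by metis
  qed
  have c1: "Ck_on 1 f S" using Ck_on_mono[OF c2] by simp
  have "Ck_on 2 (\<lambda>z. f z \<bullet> b) S"
    using assms(2) unfolding Ck_on_iff_family by (intro Ck_family_inner Ck_family_const assms)
  from second_derivative_symmetric_real[OF assms(1) this assms(3)]
  have s: "frechet_derivative (\<lambda>z. frechet_derivative (\<lambda>z. f z \<bullet> b) (at z) u) (at x) v =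
    frechet_derivative (\<lambda>z. frechet_derivative (\<lambda>z. f z \<bullet> b) (at z) v) (at x) u" .
  have "frechet_derivative (\<lambda>z. frechet_derivative f (at z) u) (at x) v \<bullet> b =
      frechet_derivative (\<lambda>z. frechet_derivative (\<lambda>z. f z \<bullet> b) (at z) u) (at x) v" for u v
  proof -
    have "frechet_derivative (\<lambda>z. frechet_derivative f (at z) u) (at x) v \<bullet> b =
        frechet_derivative (\<lambda>z. frechet_derivative f (at z) u \<bullet> b) (at x) v"
      using comp[OF Ck_on_directional[OF c2, of u] assms(3), of v] by simp
    also have "\<dots> = frechet_derivative (\<lambda>z. frechet_derivative (\<lambda>z. f z \<bullet> b) (at z) u) (at x) v"
      using frechet_derivative_cong_open[OF assms(1,3), of "\<lambda>z. frechet_derivative f (at z) u \<bullet> b"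
          "\<lambda>z. frechet_derivative (\<lambda>z. f z \<bullet> b) (at z) u"] comp[OF c1] by simp
    finally show ?thesis .
  qed
  then show "frechet_derivative (\<lambda>z. frechet_derivative f (at z) u) (at x) v \<bullet> b =
    frechet_derivative (\<lambda>z. frechet_derivative f (at z) v) (at x) u \<bullet> b" using s by simp
qed

lemma Ck_on_inverse: "Ck_on k (inverse :: real \<Rightarrow> real) (- {0})"
proof (induction k)
  case 0
  have "continuous_on (- {0}) (inverse :: real \<Rightarrow> real)" by (intro continuous_intros) auto
  then show ?case by (simp add: Ck_on_def)
next
  case (Suc k)
  show ?case
  proof (rule Ck_on_SucI)
    show "open (- {0::real})" by auto
    show "(inverse has_derivative (\<lambda>u. - (inverse x * inverse x) * u)) (at x)" if "x \<in> - {0}" for x :: real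
      using that by (auto intro!: derivative_eq_intros)
    show "Ck_on k (\<lambda>x. - (inverse x * inverse x) * u) (- {0::real})" for u
    proof -
      have "Ck_on k (\<lambda>x. (inverse x * inverse x) * (- u)) (- {0::real})"
        using Suc unfolding Ck_on_iff_family by (intro Ck_family_mult Ck_family_const) auto
      then show ?thesis by simp
    qed
  qed
qed

section \<open>Smoothing by a mollifier of variable radius\<close>

text \<open>
  The vector field \<open>X\<close> is identified with the \<open>(n - 1)\<close>-form \<open>\<iota>\<^sub>X dx\<^sub>1 \<and> \<dots> \<and> dx\<^sub>n\<close>, which is closed
  iff \<open>X\<close> has divergence zero. Pulling the form back under \<open>\<sigma> x = x + s \<delta>(x) v\<close> gives the field
  \<open>adj (D\<sigma>) (X \<circ> \<sigma>)\<close>. As \<open>D\<sigma>\<close> is the identity plus the rank one map \<open>s v \<otimes> \<nabla>\<delta>\<close>, its adjugate is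
  \<open>(1 + s \<nabla>\<delta> \<bullet> v) I - s v \<otimes> \<nabla>\<delta>\<close>; this is the formula below, with the weight \<open>\<rho> v\<close> of the average.
  The pairs \<open>(s, v)\<close> are the parameters of the family.
\<close>

definition smear_integrand ::
  "('a::euclidean_space \<Rightarrow> real) \<Rightarrow> ('a \<Rightarrow> real) \<Rightarrow> ('a \<Rightarrow> 'a) \<Rightarrow> real \<times> 'a \<Rightarrow> 'a \<Rightarrow> 'a" where
  "smear_integrand \<rho> \<delta> X = (\<lambda>(s, v) x. \<rho> v *\<^sub>R
    ((1 + s * frechet_derivative \<delta> (at x) v) *\<^sub>R X (x + (s * \<delta> x) *\<^sub>R v)
      - (s * frechet_derivative \<delta> (at x) (X (x + (s * \<delta> x) *\<^sub>R v))) *\<^sub>R v))"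

definition smear ::
  "('a::euclidean_space \<Rightarrow> real) \<Rightarrow> ('a \<Rightarrow> real) \<Rightarrow> ('a \<Rightarrow> 'a) \<Rightarrow> real \<Rightarrow> 'a \<Rightarrow> 'a" where
  "smear \<rho> \<delta> X s x = integral (cbox (- One) One) (\<lambda>v. smear_integrand \<rho> \<delta> X (s, v) x)"

lemma smooth_on_Ck_family: "smooth_on f S \<Longrightarrow> T \<subseteq> S \<Longrightarrow> Ck_family k (\<lambda>_. f) P T"
  unfolding smooth_on_def using Ck_on_imp_family Ck_on_mono by blast

lemma Ck_family_smear_integrand:
  assumes "smooth_on \<rho> UNIV" "smooth_on \<delta> UNIV" "open S" "open T" "Ck_on k X T"
    and "\<And>s v x. s \<in> P \<Longrightarrow> v \<in> Q \<Longrightarrow> x \<in> S \<Longrightarrow> x + (s * \<delta> x) *\<^sub>R v \<in> T"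
  shows "Ck_family k (smear_integrand \<rho> \<delta> X) (P \<times> Q) S"
proof -
  have c\<delta>: "Ck_family j (\<lambda>_. \<delta>) R S" for j and R :: "(real \<times> 'a) set"
    using smooth_on_Ck_family[OF assms(2)] by blast
  have s: "Ck_family j (\<lambda>p x. fst p) R S" and v: "Ck_family j (\<lambda>p x. snd p) R S"
    for j and R :: "(real \<times> 'a) set"
    by (auto intro!: Ck_family_param continuous_intros assms)
  have "continuous_on UNIV \<rho>" by (rule smooth_on_imp_continuous_on[OF assms(1)])
  then have "continuous_on R (\<lambda>p. \<rho> (snd p))" for R :: "(real \<times> 'a) set"
    by (rule continuous_on_compose2[OF _ continuous_on_snd[OF continuous_on_id]]) auto
  then have r: "Ck_family j (\<lambda>p x. \<rho> (snd p)) R S" for j and R :: "(real \<times> 'a) set"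
    by (intro Ck_family_param assms)
  have "Ck_family k (\<lambda>p x. x + (fst p * \<delta> x) *\<^sub>R snd p) (P \<times> Q) S"
    by (intro Ck_family_add Ck_family_scaleR Ck_family_mult Ck_family_id s v c\<delta> assms)
  from Ck_family_compose[OF assms(3,4) this Ck_on_imp_family[OF assms(5)]]
  have Y: "Ck_family k (\<lambda>p x. X (x + (fst p * \<delta> x) *\<^sub>R snd p)) (P \<times> Q) S"
    using assms(6) by auto
  have "Ck_family k (\<lambda>p x. \<rho> (snd p) *\<^sub>R
    ((1 + fst p * frechet_derivative \<delta> (at x) (snd p)) *\<^sub>R X (x + (fst p * \<delta> x) *\<^sub>R snd p)
      - (fst p * frechet_derivative \<delta> (at x) (X (x + (fst p * \<delta> x) *\<^sub>R snd p))) *\<^sub>R snd p)) (P \<times> Q) S"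
    by (intro Ck_family_add Ck_family_diff Ck_family_scaleR Ck_family_mult Ck_family_const
        Ck_family_derivative_along[where f = "\<lambda>_. \<delta>"] r s v Y c\<delta> assms)
  then show ?thesis unfolding smear_integrand_def by (simp add: case_prod_unfold)
qed

text \<open>
  Differentiation under the integral sign costs \<open>X\<close> no derivative, because \<open>\<delta>\<close> is smooth. With
  \<open>P\<close> an interval that starts at \<open>0\<close> this yields closeness to \<open>X\<close>; with \<open>T\<close> an open set on which
  \<open>X\<close> is smooth it yields that averaging preserves smoothness.
\<close>

lemma Ck_family_smear:
  fixes \<delta> :: "'a::euclidean_space \<Rightarrow> real"
  assumes "smooth_on \<rho> UNIV" "smooth_on \<delta> UNIV" "open S" "open T" "Ck_on k X T"
    and "\<And>s v x. s \<in> P \<Longrightarrow> v \<in> cbox (- One) One \<Longrightarrow> x \<in> S \<Longrightarrow> x + (s * \<delta> x) *\<^sub>R v \<in> T"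
  shows "Ck_family k (smear \<rho> \<delta> X) P S"
  unfolding smear_def
  by (rule Ck_family_integral[OF assms(3) Ck_family_smear_integrand[OF assms]])

text \<open>
  Where the map \<open>x \<mapsto> x + s \<delta>(x) v\<close> agrees with the identity to first order, the average is taken
  over copies of \<open>X x\<close> with total weight \<open>1\<close>.
\<close>

lemma smear_eq_of_flat:
  assumes "(\<rho> has_integral 1) (cbox (- One) One)" "s = 0 \<or> \<delta> x = 0 \<and> frechet_derivative \<delta> (at x) = (\<lambda>_. 0)"
  shows "smear \<rho> \<delta> X s x = X x"
proof -
  have "smear_integrand \<rho> \<delta> X (s, v) x = \<rho> v *\<^sub>R X x" for v
    using assms(2) by (auto simp: smear_integrand_def)
  moreover have "((\<lambda>v. \<rho> v *\<^sub>R X x) has_integral 1 *\<^sub>R X x) (cbox (- One) One)"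
    by (rule has_integral_scaleR_left[OF assms(1)])
  ultimately show ?thesis unfolding smear_def by (simp add: integral_unique)
qed

lemma frechet_derivative_at_minimum:
  fixes \<delta> :: "'a::euclidean_space \<Rightarrow> real"
  assumes "smooth_on \<delta> UNIV" "\<And>y. 0 \<le> \<delta> y" "\<delta> x = 0"
  shows "frechet_derivative \<delta> (at x) = (\<lambda>_. 0)"
proof -
  have "(\<delta> has_derivative frechet_derivative \<delta> (at x)) (at x)"
    using assms(1) Ck_on_has_derivative[of 1 \<delta> UNIV x] unfolding smooth_on_def by auto
  then show ?thesis
    using differential_zero_maxmin[of x UNIV \<delta>] assms by auto
qed

definition euclidean_div :: "('a::euclidean_space \<Rightarrow> 'a) \<Rightarrow> 'a \<Rightarrow> real" where
  "euclidean_div X x = (\<Sum>b\<in>Basis. frechet_derivative X (at x) b \<bullet> b)"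

lemma linear_sum_inner_Basis:
  fixes L :: "'a::euclidean_space \<Rightarrow> real"
  assumes "linear L"
  shows "(\<Sum>b\<in>Basis. L b * (w \<bullet> b)) = L w"
  using linear_eq_sum_Basis[OF assms, of w] by (simp add: mult.commute)

text \<open>
  Pullback commutes with the exterior derivative, so each pulled back field has divergence zero.
  In coordinates: write \<open>Y = X \<circ> \<sigma>\<close>, \<open>d = D\<delta>\<close>, and \<open>H\<close> for the second derivative of \<open>\<delta>\<close>. Since the
  trace of \<open>DX\<close> is zero, the trace of \<open>DY\<close> is \<open>s d (DX v)\<close>. Times \<open>1 + s d v\<close>, this cancels against
  the derivative of \<open>s d Y\<close> along \<open>v\<close>, except for the two terms \<open>s H(v, Y)\<close> and \<open>s H(Y, v)\<close>, which are
  equal because \<open>H\<close> is symmetric.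
\<close>

lemma euclidean_div_smear_integrand:
  fixes \<delta> :: "'a::euclidean_space \<Rightarrow> real"
  assumes "smooth_on \<delta> UNIV" "open T" "Ck_on 1 X T" "x + (s * \<delta> x) *\<^sub>R v \<in> T"
    and "euclidean_div X (x + (s * \<delta> x) *\<^sub>R v) = 0"
  shows "euclidean_div (smear_integrand \<rho> \<delta> X (s, v)) x = 0"
proof -
  define y where "y = x + (s * \<delta> x) *\<^sub>R v"
  define X' where "X' = frechet_derivative X (at y)"
  define d where "d = frechet_derivative \<delta> (at x)"
  define H where "H w = frechet_derivative (\<lambda>z. frechet_derivative \<delta> (at z) w) (at x)" for w
  define Y where "Y z = X (z + (s * \<delta> z) *\<^sub>R v)" for z
  define Y' where "Y' h = X' (h + (s * d h) *\<^sub>R v)" for h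
  have dd: "(\<delta> has_derivative frechet_derivative \<delta> (at z)) (at z)" for z
    using assms(1) Ck_on_has_derivative[of 1 \<delta> UNIV z] unfolding smooth_on_def by auto
  have dH: "((\<lambda>z. frechet_derivative \<delta> (at z) w) has_derivative H w) (at x)" for w
  proof -
    have "Ck_on (Suc 1) \<delta> UNIV" using assms(1) unfolding smooth_on_def by blast
    then have "Ck_on 1 (\<lambda>z. frechet_derivative \<delta> (at z) w) UNIV" by (rule Ck_on_directional)
    then show ?thesis unfolding H_def using Ck_on_has_derivative[of 1 _ UNIV x] by simp
  qed
  have sym: "H w h = H h w" for w h
    unfolding H_def using assms(1) second_derivative_symmetric_real[of UNIV \<delta> x]
    unfolding smooth_on_def by simp
  have linH: "linear (H w)" for w using dH has_derivative_linear by blast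
  have dX: "(X has_derivative X') (at y)"
    unfolding X'_def y_def using assms(3,4) by (intro Ck_on_has_derivative[of 1 X T]) auto
  have lind: "linear d" unfolding d_def using dd has_derivative_linear by blast
  have linX: "linear X'" using dX has_derivative_linear by blast
  have "((\<lambda>z. z + (s * \<delta> z) *\<^sub>R v) has_derivative (\<lambda>h. h + (s * d h) *\<^sub>R v)) (at x)"
    unfolding d_def by (intro derivative_intros dd)
  from has_derivative_compose[OF this, of X X'] dX
  have dY: "(Y has_derivative Y') (at x)"
    unfolding Y_def Y'_def y_def by simp
  have linY: "linear Y'" using dY has_derivative_linear by blast
  have dYd: "((\<lambda>z. frechet_derivative \<delta> (at z) (Y z)) has_derivative (\<lambda>h. d (Y' h) + H (Y x) h)) (at x)"
  proof -
    have "((\<lambda>z. \<Sum>b\<in>Basis. (Y z \<bullet> b) * frechet_derivative \<delta> (at z) b) has_derivative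
      (\<lambda>h. \<Sum>b\<in>Basis. (Y x \<bullet> b) * H b h + (Y' h \<bullet> b) * d b)) (at x)"
      unfolding d_def by (intro derivative_intros has_derivative_mult has_derivative_inner_left dH dY)
    moreover have "frechet_derivative \<delta> (at z) (Y z) = (\<Sum>b\<in>Basis. (Y z \<bullet> b) * frechet_derivative \<delta> (at z) b)" for z
      using linear_eq_sum_Basis[OF has_derivative_linear[OF dd[of z]], of "Y z"]
      unfolding real_scaleR_def .
    moreover have "(\<Sum>b\<in>Basis. (Y x \<bullet> b) * H b h + (Y' h \<bullet> b) * d b) = d (Y' h) + H (Y x) h" for h
    proof -
      have "(\<Sum>b\<in>Basis. (Y x \<bullet> b) * H b h) = (\<Sum>b\<in>Basis. (Y x \<bullet> b) * H h b)"
        by (simp only: sym[of _ h])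
      also have "\<dots> = H h (Y x)"
        using linear_eq_sum_Basis[OF linH, of h "Y x"] unfolding real_scaleR_def by (rule HOL.sym)
      also have "\<dots> = H (Y x) h" by (rule sym)
      finally have "(\<Sum>b\<in>Basis. (Y x \<bullet> b) * H b h) = H (Y x) h" .
      moreover have "(\<Sum>b\<in>Basis. (Y' h \<bullet> b) * d b) = d (Y' h)"
        using linear_eq_sum_Basis[OF lind, of "Y' h"] unfolding real_scaleR_def by (rule HOL.sym)
      ultimately show ?thesis by (simp only: sum.distrib add.commute)
    qed
    ultimately show ?thesis by simp
  qed
  define D where "D h = \<rho> v *\<^sub>R ((1 + s * d v) *\<^sub>R Y' h + (s * H v h) *\<^sub>R Y x
      - (s * (d (Y' h) + H (Y x) h)) *\<^sub>R v)" for h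
  have "((\<lambda>z. \<rho> v *\<^sub>R ((1 + s * frechet_derivative \<delta> (at z) v) *\<^sub>R Y z
      - (s * frechet_derivative \<delta> (at z) (Y z)) *\<^sub>R v)) has_derivative D) (at x)"
    unfolding D_def d_def
    by (rule derivative_eq_intros dY dH dYd[unfolded d_def] refl)+ (simp add: algebra_simps)
  then have "(smear_integrand \<rho> \<delta> X (s, v) has_derivative D) (at x)"
    unfolding smear_integrand_def Y_def by simp
  then have "euclidean_div (smear_integrand \<rho> \<delta> X (s, v)) x = (\<Sum>b\<in>Basis. D b \<bullet> b)"
    unfolding euclidean_div_def by (simp add: frechet_derivative_at[symmetric])
  also have "\<dots> = \<rho> v * ((1 + s * d v) * (\<Sum>b\<in>Basis. Y' b \<bullet> b) + s * (\<Sum>b\<in>Basis. H v b * (Y x \<bullet> b))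
      - s * ((\<Sum>b\<in>Basis. d (Y' b) * (v \<bullet> b)) + (\<Sum>b\<in>Basis. H (Y x) b * (v \<bullet> b))))"
    unfolding D_def
    by (simp add: inner_diff_left inner_add_left sum.distrib sum_subtractf sum_distrib_left algebra_simps)
  also have "(\<Sum>b\<in>Basis. H v b * (Y x \<bullet> b)) = H v (Y x)" by (rule linear_sum_inner_Basis[OF linH])
  also have "(\<Sum>b\<in>Basis. H (Y x) b * (v \<bullet> b)) = H (Y x) v" by (rule linear_sum_inner_Basis[OF linH])
  also have "H (Y x) v = H v (Y x)" by (rule sym)
  also have "(\<Sum>b\<in>Basis. d (Y' b) * (v \<bullet> b)) = d (Y' v)"
    using linear_sum_inner_Basis[of "\<lambda>h. d (Y' h)" v] linear_compose[OF linY lind] by (simp add: o_def)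
  also have "(\<Sum>b\<in>Basis. Y' b \<bullet> b) = s * d (X' v)"
  proof -
    have "(\<Sum>b\<in>Basis. Y' b \<bullet> b) = (\<Sum>b\<in>Basis. X' b \<bullet> b) + s * (\<Sum>b\<in>Basis. d b * (X' v \<bullet> b))"
      unfolding Y'_def
      by (simp add: linear_add[OF linX] linear_scale[OF linX] inner_add_left sum.distrib sum_distrib_left mult.assoc)
    moreover have "(\<Sum>b\<in>Basis. X' b \<bullet> b) = 0"
      using assms(5) unfolding euclidean_div_def X'_def y_def .
    ultimately show ?thesis using linear_sum_inner_Basis[OF lind] by simp
  qed
  also have "d (Y' v) = (1 + s * d v) * d (X' v)"
    unfolding Y'_def by (simp add: linear_add[OF linX] linear_scale[OF linX] linear_add[OF lind] linear_scale[OF lind] algebra_simps)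
  finally show ?thesis by (simp add: algebra_simps)
qed

lemma euclidean_div_smear:
  fixes \<delta> :: "'a::euclidean_space \<Rightarrow> real"
  assumes "smooth_on \<rho> UNIV" "smooth_on \<delta> UNIV" "open S" "open T" "Ck_on 1 X T"
    and "\<And>v x. v \<in> cbox (- One) One \<Longrightarrow> x \<in> S \<Longrightarrow> x + (s * \<delta> x) *\<^sub>R v \<in> T"
    and "\<And>y. y \<in> T \<Longrightarrow> euclidean_div X y = 0" and x: "x \<in> S"
  shows "euclidean_div (smear \<rho> \<delta> X s) x = 0"
proof -
  let ?f = "smear_integrand \<rho> \<delta> X" and ?Q = "cbox (- One) One :: 'a set"
  have c: "Ck_family 1 ?f ({s} \<times> ?Q) S"
    by (rule Ck_family_smear_integrand[OF assms(1-5)]) (use assms(6) in auto)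
  have i: "(\<lambda>v. frechet_derivative (?f (s, v)) (at x) b) integrable_on ?Q" for b
  proof (rule integrable_continuous)
    have "Ck_family 0 (\<lambda>p z. frechet_derivative (?f p) (at z) b) ({s} \<times> ?Q) S"
      using c by (intro Ck_family_directional) simp
    then have "continuous_on (({s} \<times> ?Q) \<times> S) (\<lambda>(p, z). frechet_derivative (?f p) (at z) b)"
      by (simp add: Ck_family_0)
    then have "continuous_on ?Q ((\<lambda>(p, z). frechet_derivative (?f p) (at z) b) \<circ> (\<lambda>v. ((s, v), x)))"
      by (intro continuous_on_compose continuous_intros) (auto elim!: continuous_on_subset simp: x)
    then show "continuous_on ?Q (\<lambda>v. frechet_derivative (?f (s, v)) (at x) b)" by (simp add: o_def)
  qed
  have i2: "(\<lambda>v. frechet_derivative (?f (s, v)) (at x) b \<bullet> b) integrable_on ?Q" for b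
    using integrable_linear[OF i bounded_linear_inner_left] by (simp add: o_def)
  have "(smear \<rho> \<delta> X s has_derivative
      (\<lambda>u. integral ?Q (\<lambda>v. frechet_derivative (?f (s, v)) (at x) u))) (at x)"
    unfolding smear_def using Ck_family_integral_has_derivative[OF assms(3) c, of s x] x by simp
  then have "euclidean_div (smear \<rho> \<delta> X s) x =
      (\<Sum>b\<in>Basis. integral ?Q (\<lambda>v. frechet_derivative (?f (s, v)) (at x) b) \<bullet> b)"
    unfolding euclidean_div_def by (simp add: frechet_derivative_at[symmetric])
  also have "\<dots> = (\<Sum>b\<in>Basis. integral ?Q (\<lambda>v. frechet_derivative (?f (s, v)) (at x) b \<bullet> b))"
    using integral_linear[OF i bounded_linear_inner_left] by (simp add: o_def)
  also have "\<dots> =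
      integral ?Q (\<lambda>v. euclidean_div (?f (s, v)) x)"
    unfolding euclidean_div_def by (rule integral_sum[symmetric]) (use i2 in auto)
  also have "\<dots> = integral ?Q (\<lambda>v. 0)"
    using assms x by (intro integral_cong euclidean_div_smear_integrand[of \<delta> T]) auto
  finally show ?thesis by simp
qed

section \<open>Smoothness where the radius of the mollifier is positive\<close>

lemma Ck_family_power:
  fixes f :: "'p::topological_space \<Rightarrow> 'a::euclidean_space \<Rightarrow> real"
  assumes "open S" "Ck_family k f P S"
  shows "Ck_family k (\<lambda>p x. f p x ^ n) P S"
  by (induction n) (auto intro: Ck_family_const Ck_family_mult assms)

text \<open>
  Near a point where the radius \<open>s \<delta>\<close> is positive, the affine substitution \<open>y = x + s \<delta>(x) v\<close> turns
  the average into the integral of \<open>X y\<close> against a kernel that is smooth in \<open>x\<close>. The domain of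
  integration becomes a box depending on \<open>x\<close>, but the kernel vanishes outside it, so a fixed box
  \<open>Q\<close> containing all of them can be used instead. Only the continuity of \<open>X\<close> matters then.
\<close>

lemma smear_smooth_where_positive:
  fixes \<delta> :: "'a::euclidean_space \<Rightarrow> real"
  assumes "smooth_on \<rho> UNIV" "\<And>v. v \<notin> cbox (- One) One \<Longrightarrow> \<rho> v = 0"
    and "smooth_on \<delta> UNIV" "open T" "continuous_on T X" "0 < s * \<delta> a"
    and box: "cbox (a - (2 * (s * \<delta> a)) *\<^sub>R One) (a + (2 * (s * \<delta> a)) *\<^sub>R One) \<subseteq> T"
  shows "\<exists>S. open S \<and> a \<in> S \<and> smooth_on (smear \<rho> \<delta> X s) S"
proof -
  define d where "d = s * \<delta> a"
  define Q where "Q = cbox (a - (2 * d) *\<^sub>R One) (a + (2 * d) *\<^sub>R One)"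
  have d: "d > 0" using assms(6) unfolding d_def .
  have cont: "continuous_on UNIV (\<lambda>x. s * \<delta> x)"
    by (intro continuous_intros smooth_on_imp_continuous_on[OF assms(3)])
  \<comment> \<open>For \<open>x\<close> in \<open>S\<close> the box of radius \<open>s * \<delta> x\<close> around \<open>x\<close> lies in \<open>Q\<close>, as \<open>d / 2 + 3 / 2 * d = 2 * d\<close>.\<close>
  define S where "S = ball a (d / 2) \<inter> {x. d / 2 < s * \<delta> x} \<inter> {x. s * \<delta> x < 3 / 2 * d}"
  have "open S" unfolding S_def
    by (intro open_Int open_ball open_Collect_less cont continuous_on_const)
  have "a \<in> S" using d unfolding S_def by (auto simp: d_def)
  have pos: "0 < s * \<delta> x" if "x \<in> S" for x using that d unfolding S_def by auto
  have near: "\<bar>(x - a) \<bullet> b\<bar> < d / 2" if "x \<in> S" "b \<in> Basis" for x b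
    using Basis_le_norm[OF that(2), of "x - a"] that(1)
    unfolding S_def by (auto simp: dist_norm norm_minus_commute)
  have lt: "s * \<delta> x < 3 / 2 * d" if "x \<in> S" for x using that unfolding S_def by auto
  have sub: "cbox (x - (s * \<delta> x) *\<^sub>R One) (x + (s * \<delta> x) *\<^sub>R One) \<subseteq> Q" if "x \<in> S" for x
    unfolding Q_def subset_box
  proof (intro impI ballI)
    fix b :: 'a assume b: "b \<in> Basis"
    have "x \<bullet> b - a \<bullet> b < d / 2" "a \<bullet> b - x \<bullet> b < d / 2" "s * \<delta> x < 3 / 2 * d"
      using near[OF that b] lt[OF that] unfolding inner_diff_left by linarith+
    then show "(a - (2 * d) *\<^sub>R One) \<bullet> b \<le> (x - (s * \<delta> x) *\<^sub>R One) \<bullet> b \<and>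
        (x + (s * \<delta> x) *\<^sub>R One) \<bullet> b \<le> (a + (2 * d) *\<^sub>R One) \<bullet> b"
      using b by (simp add: inner_diff_left inner_add_left)
  qed
  have scale_box: "x + e *\<^sub>R v \<in> cbox (x - e *\<^sub>R One) (x + e *\<^sub>R One) \<longleftrightarrow> v \<in> cbox (- One) One"
    if "e > 0" for x v :: 'a and e
  proof -
    have "- e \<le> e * t \<longleftrightarrow> - 1 \<le> t" "e * t \<le> e \<longleftrightarrow> t \<le> 1" for t
      using that mult_le_cancel_left_pos[of e "-1" t] mult_le_cancel_left_pos[of e t 1] by auto
    then show ?thesis by (simp add: mem_box inner_add_left inner_diff_left)
  qed
  have inT: "x + (s * \<delta> x) *\<^sub>R v \<in> T" if "v \<in> cbox (- One) One" "x \<in> S" for v x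
    using scale_box[OF pos[OF that(2)]] that sub[OF that(2)] box unfolding Q_def d_def by blast
  define K where "K = (\<lambda>p::real \<times> 'a. \<lambda>x. inverse (s * \<delta> x) ^ DIM('a) *\<^sub>R
    (\<rho> (inverse (s * \<delta> x) *\<^sub>R (snd p - x)) *\<^sub>R
      ((1 + s * frechet_derivative \<delta> (at x) (inverse (s * \<delta> x) *\<^sub>R (snd p - x))) *\<^sub>R X (snd p)
        - (s * frechet_derivative \<delta> (at x) (X (snd p))) *\<^sub>R (inverse (s * \<delta> x) *\<^sub>R (snd p - x)))))"
  have cK: "Ck_family k K ({0} \<times> Q) S" for k
  proof -
    let ?P = "{0::real} \<times> Q"
    have c\<delta>: "Ck_family j (\<lambda>_. \<delta>) ?P S" for j using smooth_on_Ck_family[OF assms(3)] by blast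
    have "continuous_on ?P (\<lambda>p. X (snd p))"
      by (rule continuous_on_compose2[OF assms(5) continuous_on_snd[OF continuous_on_id]])
        (use box in \<open>auto simp: Q_def d_def\<close>)
    then have cX: "Ck_family k (\<lambda>p x. X (snd p)) ?P S" by (rule Ck_family_param[OF _ \<open>open S\<close>])
    have cy: "Ck_family k (\<lambda>p x. snd p) ?P S"
      by (rule Ck_family_param[OF continuous_on_snd[OF continuous_on_id] \<open>open S\<close>])
    have "Ck_family k (\<lambda>p x. s * \<delta> x) ?P S" by (intro Ck_family_mult Ck_family_const c\<delta> \<open>open S\<close>)
    from Ck_family_compose[OF \<open>open S\<close> _ this Ck_on_imp_family[OF Ck_on_inverse]]
    have ci: "Ck_family k (\<lambda>p x. inverse (s * \<delta> x)) ?P S" using pos by force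
    have cw: "Ck_family k (\<lambda>p x. inverse (s * \<delta> x) *\<^sub>R (snd p - x)) ?P S"
      by (intro Ck_family_scaleR Ck_family_diff Ck_family_id ci cy \<open>open S\<close>)
    have "Ck_family k (\<lambda>_. \<rho>) ?P UNIV" using smooth_on_Ck_family[OF assms(1)] by blast
    from Ck_family_compose[OF \<open>open S\<close> open_UNIV cw this]
    have c\<rho>: "Ck_family k (\<lambda>p x. \<rho> (inverse (s * \<delta> x) *\<^sub>R (snd p - x))) ?P S" by simp
    show ?thesis unfolding K_def
      by (intro Ck_family_scaleR Ck_family_power Ck_family_add Ck_family_diff Ck_family_mult
          Ck_family_const Ck_family_derivative_along[where f = "\<lambda>_. \<delta>"] ci cw cX c\<rho> c\<delta> \<open>open S\<close>)
  qed
  have "smear \<rho> \<delta> X s x = integral Q (\<lambda>y. K (0, y) x)" if x: "x \<in> S" for x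
  proof -
    define e where "e = s * \<delta> x"
    have e: "e > 0" using pos[OF x] unfolding e_def .
    define f where "f v = smear_integrand \<rho> \<delta> X (s, v) x" for v
    have "continuous_on (cbox (- One) One) f"
    proof -
      have "Ck_on 0 X T" using assms(5) by (simp add: Ck_on_def)
      then have "Ck_family 0 (smear_integrand \<rho> \<delta> X) ({s} \<times> cbox (- One) One) S"
        by (rule Ck_family_smear_integrand[OF assms(1,3) \<open>open S\<close> assms(4)]) (use inT in auto)
      then have "continuous_on (({s} \<times> cbox (- One) One) \<times> S) (\<lambda>(p, z). smear_integrand \<rho> \<delta> X p z)"
        by (simp add: Ck_family_0)
      then have "continuous_on (cbox (- One) One) ((\<lambda>(p, z). smear_integrand \<rho> \<delta> X p z) \<circ> (\<lambda>v. ((s, v), x)))"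
        by (intro continuous_on_compose continuous_intros) (auto elim!: continuous_on_subset simp: x)
      then show ?thesis by (simp add: o_def f_def)
    qed
    then have "(f has_integral smear \<rho> \<delta> X s x) (cbox (- One) One)"
      unfolding smear_def f_def by (intro integrable_integral integrable_continuous)
    from has_integral_affinity'[OF this, of "1 / e" "- (1 / e) *\<^sub>R x"] e
    have "((\<lambda>y. f ((1 / e) *\<^sub>R y + - (1 / e) *\<^sub>R x)) has_integral
        smear \<rho> \<delta> X s x /\<^sub>R (1 / e) ^ DIM('a)) (cbox (x - e *\<^sub>R One) (x + e *\<^sub>R One))"
      by (simp add: algebra_simps)
    moreover have eq: "(1 / e) *\<^sub>R y + - (1 / e) *\<^sub>R x = inverse e *\<^sub>R (y - x)" for y
      by (simp add: algebra_simps inverse_eq_divide)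
    ultimately have "((\<lambda>y. f (inverse e *\<^sub>R (y - x))) has_integral
        smear \<rho> \<delta> X s x /\<^sub>R (1 / e) ^ DIM('a)) (cbox (x - e *\<^sub>R One) (x + e *\<^sub>R One))" by simp
    then have "((\<lambda>y. f (inverse e *\<^sub>R (y - x))) has_integral
        smear \<rho> \<delta> X s x /\<^sub>R (1 / e) ^ DIM('a)) Q"
    proof (rule has_integral_on_superset)
      show "f (inverse e *\<^sub>R (y - x)) = 0" if "y \<notin> cbox (x - e *\<^sub>R One) (x + e *\<^sub>R One)" for y
      proof -
        have "x + e *\<^sub>R (inverse e *\<^sub>R (y - x)) = y" using e by simp
        then have "inverse e *\<^sub>R (y - x) \<notin> cbox (- One) One"
          using scale_box[OF e, of x "inverse e *\<^sub>R (y - x)"] that by simp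
        then show ?thesis using assms(2) by (simp add: f_def smear_integrand_def)
      qed
    qed (use sub[OF x] in \<open>simp add: e_def\<close>)
    from has_integral_cmul[OF this, of "inverse e ^ DIM('a)"] e
    have "((\<lambda>y. inverse e ^ DIM('a) *\<^sub>R f (inverse e *\<^sub>R (y - x))) has_integral smear \<rho> \<delta> X s x) Q"
      by (simp add: inverse_eq_divide)
    moreover have "inverse e ^ DIM('a) *\<^sub>R f (inverse e *\<^sub>R (y - x)) = K (0, y) x" for y
    proof -
      have "x + e *\<^sub>R (inverse e *\<^sub>R (y - x)) = y" using e by simp
      then show ?thesis
        unfolding f_def K_def smear_integrand_def e_def[symmetric] prod.case snd_conv by (simp only:)
    qed
    ultimately show ?thesis by (simp add: integral_unique)
  qed
  moreover have "Ck_family k (\<lambda>p x. integral Q (\<lambda>y. K (p, y) x)) {0} S" for k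
    unfolding Q_def by (rule Ck_family_integral[OF \<open>open S\<close> cK[unfolded Q_def]])
  then have "smooth_on (\<lambda>x. integral Q (\<lambda>y. K (0, y) x)) S"
    unfolding smooth_on_def using Ck_family_member by fastforce
  ultimately have "smooth_on (smear \<rho> \<delta> X s) S"
    unfolding smooth_on_def
    using Ck_on_cong[OF \<open>open S\<close>, of "smear \<rho> \<delta> X s" "\<lambda>x. integral Q (\<lambda>y. K (0, y) x)"] by simp
  then show ?thesis using \<open>open S\<close> \<open>a \<in> S\<close> by blast
qed

section \<open>Jacobi's formula and the Piola transform\<close>

text \<open>
  In the Leibniz expansion, a permutation other than the identity moves at least two indices.
  After differentiating one factor there remains an off-diagonal factor, which vanishes at the
  identity matrix. The identity permutation contributes the trace.
\<close>

lemma det_has_derivative_at_identity: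
  fixes M :: "'a::euclidean_space \<Rightarrow> real^'n^'n"
  assumes "M x = mat 1" and d: "\<And>i j. ((\<lambda>z. M z $ i $ j) has_derivative (\<lambda>h. M' h $ i $ j)) (at x)"
  shows "((\<lambda>z. det (M z)) has_derivative (\<lambda>h. trace (M' h))) (at x)"
proof -
  let ?P = "{p. p permutes (UNIV::'n set)}"
  have "((\<lambda>z. det (M z)) has_derivative (\<lambda>h. \<Sum>p\<in>?P. of_int (sign p) *
      (\<Sum>i\<in>UNIV. M' h $ i $ p i * (\<Prod>j\<in>UNIV - {i}. M x $ j $ p j)))) (at x)"
    unfolding det_def
    by (intro has_derivative_sum has_derivative_mult_right has_derivative_prod d)
  moreover have "(\<Sum>p\<in>?P. of_int (sign p) *
      (\<Sum>i\<in>UNIV. M' h $ i $ p i * (\<Prod>j\<in>UNIV - {i}. M x $ j $ p j))) = trace (M' h)" for h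
  proof -
    have z: "(\<Prod>j\<in>UNIV - {i}. M x $ j $ p j) = 0" if p: "p permutes UNIV" "p \<noteq> id" for p and i :: 'n
    proof -
      have "\<exists>j. j \<noteq> i \<and> p j \<noteq> j"
      proof (rule ccontr)
        assume "\<not> ?thesis"
        then have *: "p j = j" if "j \<noteq> i" for j using that by blast
        then have "p i = i" using p(1) by (metis permutes_univ)
        then have "p j = j" for j using * by (cases "j = i") auto
        then show False using p(2) by (auto simp: fun_eq_iff)
      qed
      then obtain j where "j \<noteq> i" "p j \<noteq> j" by blast
      then have "j \<in> UNIV - {i}" "M x $ j $ p j = 0" unfolding assms(1) by (auto simp: mat_def)
      then show ?thesis by (meson finite prod_zero)
    qed
    have "(\<Sum>p\<in>?P. of_int (sign p) *
        (\<Sum>i\<in>UNIV. M' h $ i $ p i * (\<Prod>j\<in>UNIV - {i}. M x $ j $ p j))) =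
      (\<Sum>p\<in>{id}. of_int (sign p) *
        (\<Sum>i\<in>UNIV. M' h $ i $ p i * (\<Prod>j\<in>UNIV - {i}. M x $ j $ p j)))"
    proof (rule sum.mono_neutral_right)
      show "\<forall>p\<in>?P - {id}. of_int (sign p) *
        (\<Sum>i\<in>UNIV. M' h $ i $ p i * (\<Prod>j\<in>UNIV - {i}. M x $ j $ p j)) = 0"
      proof
        fix p assume "p \<in> ?P - {id}"
        then have "(\<Prod>j\<in>UNIV - {i}. M x $ j $ p j) = 0" for i using z[of p i] by blast
        then show "of_int (sign p) *
            (\<Sum>i\<in>UNIV. M' h $ i $ p i * (\<Prod>j\<in>UNIV - {i}. M x $ j $ p j)) = 0"
          by (simp only: mult_zero_right sum.neutral_const)
      qed
    qed (auto simp: permutes_id)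
    also have "\<dots> = trace (M' h)"
      unfolding assms(1) by (simp add: mat_def trace_def)
    finally show ?thesis .
  qed
  ultimately show ?thesis by simp
qed

lemma matrix_mul_component: "(A ** B) $ i $ j = (\<Sum>k\<in>UNIV. A $ i $ k * B $ k $ j)"
  by (simp add: matrix_matrix_mult_def)

text \<open>
  Multiplication by the inverse of \<open>M x\<close> moves the base point to the identity matrix.
\<close>

lemma Jacobi_formula:
  fixes M :: "'a::euclidean_space \<Rightarrow> real^'n^'n"
  assumes "M x ** B = mat 1" "B ** M x = mat 1"
    and d: "\<And>i j. ((\<lambda>z. M z $ i $ j) has_derivative (\<lambda>h. M' h $ i $ j)) (at x)"
  shows "((\<lambda>z. det (M z)) has_derivative (\<lambda>h. det (M x) * trace (B ** M' h))) (at x)"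
proof -
  have "((\<lambda>z. det (B ** M z)) has_derivative (\<lambda>h. trace (B ** M' h))) (at x)"
  proof (rule det_has_derivative_at_identity[where M = "\<lambda>z. B ** M z" and x = x, OF assms(2)])
    show "((\<lambda>z. (B ** M z) $ i $ j) has_derivative (\<lambda>h. (B ** M' h) $ i $ j)) (at x)" for i j
      unfolding matrix_mul_component by (intro has_derivative_sum has_derivative_mult_right d)
  qed
  from has_derivative_mult_right[OF this, of "det (M x)"]
  have "((\<lambda>z. det (M x) * det (B ** M z)) has_derivative (\<lambda>h. det (M x) * trace (B ** M' h))) (at x)" .
  moreover have "det (M x) * det (B ** M z) = det (M z)" for z
    using det_mul[of "M x" B] assms(1) by (simp add: det_mul det_I mult.assoc[symmetric])
  ultimately show ?thesis by simp
qed

lemma Basis_cart: "(Basis :: (real^'n) set) = range (\<lambda>i. axis i 1)"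
  by (auto simp: Basis_vec_def)

lemma sum_Basis_cart: "(\<Sum>b\<in>(Basis :: (real^'n) set). g b) = (\<Sum>i\<in>UNIV. g (axis i 1))"
proof -
  have "inj (\<lambda>i::'n. axis i (1::real))" by (auto simp: inj_on_def axis_eq_axis)
  from sum.reindex[OF this, of g] show ?thesis unfolding Basis_cart by (simp add: o_def)
qed

lemma euclidean_div_cart:
  fixes X :: "real^'n \<Rightarrow> real^'n"
  shows "euclidean_div X x = (\<Sum>i\<in>UNIV. frechet_derivative X (at x) (axis i 1) $ i)"
  unfolding euclidean_div_def sum_Basis_cart by (simp add: inner_axis)

lemma trace_matrix: "trace (matrix f) = (\<Sum>b\<in>Basis. f b \<bullet> b)"
  for f :: "real^'n \<Rightarrow> real^'n"
  unfolding sum_Basis_cart trace_def matrix_def by (simp add: inner_axis)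

text \<open>
  The field \<open>F\<close> is the pullback \<open>adj (D\<sigma>) (Y \<circ> \<sigma>)\<close> of \<open>Y\<close> as an \<open>(n - 1)\<close>-form, given by an equation
  that avoids the adjugate. Differentiate that equation and take the trace of the inverse of
  \<open>D\<sigma>\<close> applied to the result: the term with the derivative of the determinant and the one with the
  second derivative of \<open>\<sigma>\<close> cancel, by Jacobi's formula and the symmetry of second derivatives.
\<close>

lemma divergence_of_Piola_transform:
  fixes \<sigma> F Y :: "real^'n \<Rightarrow> real^'n"
  assumes "open S" "Ck_on 2 \<sigma> S" "x \<in> S"
    and F: "F differentiable at x" and Y: "Y differentiable at (\<sigma> x)"
    and eq: "\<And>z. z \<in> S \<Longrightarrow> frechet_derivative \<sigma> (at z) (F z) =
      det (matrix (frechet_derivative \<sigma> (at z))) *\<^sub>R Y (\<sigma> z)"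
    and inv: "invertible (matrix (frechet_derivative \<sigma> (at x)))"
  shows "euclidean_div F x = det (matrix (frechet_derivative \<sigma> (at x))) * euclidean_div Y (\<sigma> x)"
proof -
  define J where "J z = matrix (frechet_derivative \<sigma> (at z))" for z
  define F' where "F' = frechet_derivative F (at x)"
  define Y' where "Y' = frechet_derivative Y (at (\<sigma> x))"
  define A where "A w = frechet_derivative (\<lambda>z. frechet_derivative \<sigma> (at z) w) (at x)" for w
  obtain B where B: "J x ** B = mat 1" "B ** J x = mat 1" using inv unfolding invertible_def J_def by blast
  have c2: "Ck_on (Suc 1) \<sigma> S" using assms(2) by (simp add: numeral_2_eq_2)
  have c1: "Ck_on 1 \<sigma> S" using Ck_on_mono[OF c2] by simp
  have d\<sigma>: "(\<sigma> has_derivative frechet_derivative \<sigma> (at z)) (at z)" if "z \<in> S" for z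
    by (rule Ck_on_has_derivative[OF c1 _ that]) simp
  have dA: "((\<lambda>z. frechet_derivative \<sigma> (at z) w) has_derivative A w) (at x)" for w
    unfolding A_def by (rule Ck_on_has_derivative[OF Ck_on_directional[OF c2] _ assms(3)]) simp
  have sym: "A w h = A h w" for w h
    unfolding A_def by (rule second_derivative_symmetric[OF assms(1-3)])
  have linA: "linear (A w)" for w using dA has_derivative_linear by blast
  have J: "J z *v w = frechet_derivative \<sigma> (at z) w" if "z \<in> S" for z w
    unfolding J_def using fun_cong[OF matrix_vector_mul(2)[OF has_derivative_linear[OF d\<sigma>[OF that]]]] by simp
  have dF: "(F has_derivative F') (at x)" unfolding F'_def using F frechet_derivative_works by blast
  have dY: "(Y has_derivative Y') (at (\<sigma> x))" unfolding Y'_def using Y frechet_derivative_works by blast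
  have linY: "linear Y'" using dY has_derivative_linear by blast
  define M' where "M' h = matrix (A h)" for h
  have dJ: "((\<lambda>z. J z $ i $ j) has_derivative (\<lambda>h. M' h $ i $ j)) (at x)" for i j
  proof -
    have "((\<lambda>z. frechet_derivative \<sigma> (at z) (axis j 1) $ i) has_derivative (\<lambda>h. A (axis j 1) h $ i)) (at x)"
      by (rule bounded_linear.has_derivative[OF bounded_linear_vec_nth dA])
    then show ?thesis unfolding J_def M'_def matrix_def by (simp add: sym[of "axis j 1"])
  qed
  define \<Delta> where "\<Delta> h = det (J x) * trace (B ** M' h)" for h
  have ddet: "((\<lambda>z. det (J z)) has_derivative \<Delta>) (at x)"
    unfolding \<Delta>_def by (rule Jacobi_formula[OF B dJ])
  have lin\<Delta>: "linear \<Delta>" using ddet has_derivative_linear by blast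
  have dL: "((\<lambda>z. frechet_derivative \<sigma> (at z) (F z)) has_derivative
      (\<lambda>h. A (F x) h + J x *v F' h)) (at x)"
  proof -
    have "((\<lambda>z. \<Sum>b\<in>Basis. (F z \<bullet> b) *\<^sub>R frechet_derivative \<sigma> (at z) b) has_derivative
      (\<lambda>h. \<Sum>b\<in>Basis. (F x \<bullet> b) *\<^sub>R A b h + (F' h \<bullet> b) *\<^sub>R frechet_derivative \<sigma> (at x) b)) (at x)"
      by (intro has_derivative_sum has_derivative_scaleR has_derivative_inner_left dA dF)
    moreover have "(\<Sum>b\<in>Basis. (F z \<bullet> b) *\<^sub>R frechet_derivative \<sigma> (at z) b) =
        frechet_derivative \<sigma> (at z) (F z)" if "z \<in> S" for z
      by (rule linear_eq_sum_Basis[OF has_derivative_linear[OF d\<sigma>[OF that]], symmetric])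
    moreover have "(\<lambda>h. \<Sum>b\<in>Basis. (F x \<bullet> b) *\<^sub>R A b h + (F' h \<bullet> b) *\<^sub>R frechet_derivative \<sigma> (at x) b) =
        (\<lambda>h. A (F x) h + J x *v F' h)"
    proof
      fix h
      have "(\<Sum>b\<in>Basis. (F x \<bullet> b) *\<^sub>R A b h) = (\<Sum>b\<in>Basis. (F x \<bullet> b) *\<^sub>R A h b)"
        by (simp only: sym[of _ h])
      also have "\<dots> = A h (F x)" by (rule linear_eq_sum_Basis[OF linA, symmetric])
      also have "\<dots> = A (F x) h" by (rule sym)
      finally have 1: "(\<Sum>b\<in>Basis. (F x \<bullet> b) *\<^sub>R A b h) = A (F x) h" .
      have 2: "(\<Sum>b\<in>Basis. (F' h \<bullet> b) *\<^sub>R frechet_derivative \<sigma> (at x) b) = J x *v F' h"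
        unfolding J[OF assms(3)]
        by (rule linear_eq_sum_Basis[OF has_derivative_linear[OF d\<sigma>[OF assms(3)]], symmetric])
      show "(\<Sum>b\<in>Basis. (F x \<bullet> b) *\<^sub>R A b h + (F' h \<bullet> b) *\<^sub>R frechet_derivative \<sigma> (at x) b) =
        A (F x) h + J x *v F' h"
        unfolding sum.distrib 1 2 ..
    qed
    ultimately show ?thesis
      using has_derivative_cong_open[OF assms(1,3), of
          "\<lambda>z. \<Sum>b\<in>Basis. (F z \<bullet> b) *\<^sub>R frechet_derivative \<sigma> (at z) b"
          "\<lambda>z. frechet_derivative \<sigma> (at z) (F z)"] by simp
  qed
  have dR: "((\<lambda>z. det (J z) *\<^sub>R Y (\<sigma> z)) has_derivative
      (\<lambda>h. det (J x) *\<^sub>R Y' (J x *v h) + \<Delta> h *\<^sub>R Y (\<sigma> x))) (at x)"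
  proof -
    have "((\<lambda>z. Y (\<sigma> z)) has_derivative (\<lambda>h. Y' (J x *v h))) (at x)"
      using has_derivative_compose[OF d\<sigma>[OF assms(3)] dY] unfolding J[OF assms(3)] .
    from has_derivative_scaleR[OF ddet this] show ?thesis .
  qed
  have "((\<lambda>z. frechet_derivative \<sigma> (at z) (F z)) has_derivative
      (\<lambda>h. det (J x) *\<^sub>R Y' (J x *v h) + \<Delta> h *\<^sub>R Y (\<sigma> x))) (at x)"
    using dR has_derivative_cong_open[OF assms(1,3), of "\<lambda>z. frechet_derivative \<sigma> (at z) (F z)"
        "\<lambda>z. det (J z) *\<^sub>R Y (\<sigma> z)"] eq unfolding J_def by simp
  from has_derivative_unique[OF dL this]
  have E: "J x *v F' h = det (J x) *\<^sub>R Y' (J x *v h) + \<Delta> h *\<^sub>R Y (\<sigma> x) - A (F x) h" for h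
    by (metis add_diff_cancel_left')
  define w where "w = B *v Y (\<sigma> x)"
  have F'h: "F' h = det (J x) *\<^sub>R (B *v Y' (J x *v h)) + \<Delta> h *\<^sub>R w - B *v A (F x) h" for h
  proof -
    have "F' h = B *v (J x *v F' h)" by (simp add: matrix_vector_mul_assoc B)
    then show ?thesis unfolding E w_def
      by (simp add: matrix_vector_mult_diff_distrib matrix_vector_right_distrib scaleR_matrix_vector_assoc
          matrix_vector_mult_scaleR)
  qed
  have Fx: "F x = det (J x) *\<^sub>R w"
  proof -
    have "F x = B *v (J x *v F x)" by (simp add: matrix_vector_mul_assoc B)
    also have "J x *v F x = det (J x) *\<^sub>R Y (\<sigma> x)" using eq[OF assms(3)] J[OF assms(3)] unfolding J_def by simp
    finally show ?thesis unfolding w_def by (simp add: matrix_vector_mult_scaleR)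
  qed
  have lin2: "linear (\<lambda>h. B *v A v h)" for v
    using linear_compose[OF linA[of v] matrix_vector_mul_linear[of B]] by (simp add: o_def)
  have "euclidean_div F x = det (J x) * (\<Sum>b\<in>Basis. (B *v Y' (J x *v b)) \<bullet> b)
      + (\<Sum>b\<in>Basis. \<Delta> b * (w \<bullet> b)) - (\<Sum>b\<in>Basis. (B *v A (F x) b) \<bullet> b)"
    unfolding euclidean_div_def F'_def[symmetric] F'h
    by (simp add: inner_diff_left inner_add_left sum.distrib sum_subtractf sum_distrib_left)
  also have "(\<Sum>b\<in>Basis. \<Delta> b * (w \<bullet> b)) = \<Delta> w" by (rule linear_sum_inner_Basis[OF lin\<Delta>])
  also have "(\<Sum>b\<in>Basis. (B *v A (F x) b) \<bullet> b) = \<Delta> w"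
  proof -
    have "(\<Sum>b\<in>Basis. (B *v A (F x) b) \<bullet> b) = det (J x) * (\<Sum>b\<in>Basis. (B *v A w b) \<bullet> b)"
      unfolding sum_distrib_left Fx
      by (simp add: sym[of "det (J x) *\<^sub>R w"] sym[of w] linear_scale[OF linA] matrix_vector_mult_scaleR)
    also have "(\<Sum>b\<in>Basis. (B *v A w b) \<bullet> b) = trace (matrix (\<lambda>h. B *v A w h))" by (rule trace_matrix[symmetric])
    also have "matrix (\<lambda>h. B *v A w h) = B ** M' w"
      unfolding M'_def using matrix_compose[OF linA[of w] matrix_vector_mul_linear[of B]] by (simp add: o_def)
    finally show ?thesis unfolding \<Delta>_def .
  qed
  also have "(\<Sum>b\<in>Basis. (B *v Y' (J x *v b)) \<bullet> b) = euclidean_div Y (\<sigma> x)"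
  proof -
    have "(\<Sum>b\<in>Basis. (B *v Y' (J x *v b)) \<bullet> b) = trace (matrix (\<lambda>h. B *v Y' (J x *v h)))"
      by (rule trace_matrix[symmetric])
    also have "matrix (\<lambda>h. B *v Y' (J x *v h)) = B ** (matrix Y' ** J x)"
    proof -
      have "matrix (Y' \<circ> (*v) (J x)) = matrix Y' ** J x"
        using matrix_compose[OF matrix_vector_mul_linear[of "J x"] linY] by simp
      moreover have "matrix ((*v) B \<circ> (Y' \<circ> (*v) (J x))) = B ** matrix (Y' \<circ> (*v) (J x))"
        using matrix_compose[OF linear_compose[OF matrix_vector_mul_linear[of "J x"] linY] matrix_vector_mul_linear[of B]]
        by simp
      ultimately show ?thesis by (simp add: o_def)
    qed
    also have "trace (B ** (matrix Y' ** J x)) = trace (matrix Y' ** (J x ** B))"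
      by (subst trace_mul_sym) (simp add: matrix_mul_assoc)
    also have "\<dots> = trace (matrix Y')" unfolding B by simp
    finally show ?thesis unfolding trace_matrix euclidean_div_def Y'_def .
  qed
  finally show ?thesis unfolding J_def by simp
qed

section \<open>Charts, vector fields and divergence\<close>

lemma is_chart_inverse:
  assumes "is_chart c"
  shows is_chart_inv_map: "p \<in> chart_dom c \<Longrightarrow> chart_inv c (chart_map c p) = p"
    and is_chart_map_inv: "x \<in> chart_img c \<Longrightarrow> chart_map c (chart_inv c x) = x"
    and is_chart_map_in: "p \<in> chart_dom c \<Longrightarrow> chart_map c p \<in> chart_img c"
    and is_chart_inv_in: "x \<in> chart_img c \<Longrightarrow> chart_inv c x \<in> chart_dom c"
  using assms unfolding is_chart_def homeomorphism_def by auto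

lemma is_chart_image_open:
  assumes "is_chart c" "open U"
  shows "open (chart_map c ` (chart_dom c \<inter> U))"
proof -
  have h: "open (chart_dom c)" "open (chart_img c)"
    "homeomorphism (chart_dom c) (chart_img c) (chart_map c) (chart_inv c)"
    using assms(1) unfolding is_chart_def by auto
  have "openin (top_of_set (chart_dom c)) (chart_dom c \<inter> U)" using assms(2) by (rule openin_open_Int)
  from homeomorphism_imp_open_map[OF h(3) this] show ?thesis
    using h(2) openin_open_trans by blast
qed

lemma is_chart_inv_image_open:
  assumes "is_chart c" "open V" "V \<subseteq> chart_img c"
  shows "open (chart_inv c ` V)"
proof -
  have h: "open (chart_dom c)" "open (chart_img c)"
    "homeomorphism (chart_dom c) (chart_img c) (chart_map c) (chart_inv c)"
    using assms(1) unfolding is_chart_def by auto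
  have "openin (top_of_set (chart_img c)) V" using assms(2,3) by (simp add: open_openin_trans open_subset)
  from homeomorphism_imp_open_map[OF homeomorphism_symD[OF h(3)] this] show ?thesis
    using h(1) openin_open_trans by blast
qed

locale smooth_manifold =
  fixes A :: "('m::topological_space, 'n::finite) chart set"
  assumes atlas: "smooth_atlas A"
begin

lemma is_chart: "c \<in> A \<Longrightarrow> is_chart c"
  using atlas unfolding smooth_atlas_def by blast

lemma open_chart_dom: "c \<in> A \<Longrightarrow> open (chart_dom c)"
  and open_chart_img: "c \<in> A \<Longrightarrow> open (chart_img c)"
  and homeomorphism_chart:
    "c \<in> A \<Longrightarrow> homeomorphism (chart_dom c) (chart_img c) (chart_map c) (chart_inv c)"
  using is_chart unfolding is_chart_def by auto

lemmas chart_inv_map = is_chart_inv_map[OF is_chart]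
  and chart_map_inv = is_chart_map_inv[OF is_chart]
  and chart_map_in = is_chart_map_in[OF is_chart]
  and chart_inv_in = is_chart_inv_in[OF is_chart]
  and open_chart_map_image = is_chart_image_open[OF is_chart]

lemma chart_map_image:
  assumes "c \<in> A"
  shows "chart_map c ` (chart_dom c \<inter> U) = {x \<in> chart_img c. chart_inv c x \<in> U}"
proof safe
  fix p assume p: "p \<in> chart_dom c" "p \<in> U"
  show "chart_map c p \<in> chart_img c" by (rule chart_map_in[OF assms p(1)])
  show "chart_inv c (chart_map c p) \<in> U" using p chart_inv_map[OF assms p(1)] by simp
next
  fix x assume x: "x \<in> chart_img c" "chart_inv c x \<in> U"
  have "chart_inv c x \<in> chart_dom c \<inter> U" "x = chart_map c (chart_inv c x)"
    using x chart_inv_in[OF assms x(1)] chart_map_inv[OF assms x(1)] by auto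
  then show "x \<in> chart_map c ` (chart_dom c \<inter> U)" by (rule rev_image_eqI)
qed

definition overlap :: "('m, 'n) chart \<Rightarrow> ('m, 'n) chart \<Rightarrow> (real^'n) set" where
  "overlap c d = chart_map c ` (chart_dom c \<inter> chart_dom d)"

lemma overlap_iff: "c \<in> A \<Longrightarrow> x \<in> overlap c d \<longleftrightarrow> x \<in> chart_img c \<and> chart_inv c x \<in> chart_dom d"
  unfolding overlap_def by (simp add: chart_map_image)

lemma open_overlap: "c \<in> A \<Longrightarrow> d \<in> A \<Longrightarrow> open (overlap c d)"
  unfolding overlap_def by (intro open_chart_map_image open_chart_dom)

lemma Ck_on_transition: "c \<in> A \<Longrightarrow> d \<in> A \<Longrightarrow> Ck_on k (transition c d) (overlap c d)"
proof -
  assume cd: "c \<in> A" "d \<in> A"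
  have "\<forall>c\<in>A. \<forall>d\<in>A. \<forall>k. Ck_compatible k c d"
    using atlas unfolding smooth_atlas_def by (elim conjE)
  then have "Ck_compatible k c d" using cd by simp
  then show ?thesis unfolding Ck_compatible_def overlap_def by (elim conjE)
qed

lemma transition_in:
  assumes "c \<in> A" "d \<in> A" "x \<in> overlap c d"
  shows "transition c d x \<in> overlap d c"
proof -
  have p: "chart_inv c x \<in> chart_dom c" "chart_inv c x \<in> chart_dom d"
    using assms(3) chart_inv_in[OF assms(1)] unfolding overlap_iff[OF assms(1)] by auto
  have "transition c d x = chart_map d (chart_inv c x)" by (simp add: transition_def)
  then show ?thesis
    unfolding overlap_def using p by blast
qed

lemma chart_inv_transition:
  assumes "c \<in> A" "d \<in> A" "x \<in> overlap c d"
  shows "chart_inv d (transition c d x) = chart_inv c x"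
  using assms(3) chart_inv_map[OF assms(2)] unfolding overlap_iff[OF assms(1)]
  by (simp add: transition_def)

lemma transition_transition:
  assumes "c \<in> A" "d \<in> A" "x \<in> overlap c d"
  shows "transition d e (transition c d x) = transition c e x"
  using chart_inv_transition[OF assms] by (simp add: transition_def)

lemma transition_self:
  assumes "c \<in> A" "x \<in> chart_img c"
  shows "transition c c x = x"
  using assms by (simp add: transition_def chart_map_inv)

abbreviation (input) dtrans :: "('m, 'n) chart \<Rightarrow> ('m, 'n) chart \<Rightarrow> real^'n \<Rightarrow> real^'n \<Rightarrow> real^'n" where
  "dtrans c d x \<equiv> frechet_derivative (transition c d) (at x)"

lemma transition_has_derivative:
  assumes "c \<in> A" "d \<in> A" "x \<in> overlap c d"
  shows "(transition c d has_derivative dtrans c d x) (at x)"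
  using Ck_on_has_derivative[OF Ck_on_transition[OF assms(1,2), of 1] _ assms(3)] by simp

lemma linear_dtrans:
  assumes "c \<in> A" "d \<in> A" "x \<in> overlap c d"
  shows "linear (dtrans c d x)"
  by (rule has_derivative_linear[OF transition_has_derivative[OF assms]])

lemma dtrans_cocycle:
  assumes "c \<in> A" "d \<in> A" "e \<in> A" "x \<in> overlap c d" "x \<in> overlap c e"
  shows "dtrans d e (transition c d x) (dtrans c d x u) = dtrans c e x u"
proof -
  have "transition c d x \<in> overlap d e"
  proof -
    have "chart_inv c x \<in> chart_dom d" "chart_inv c x \<in> chart_dom e"
      using assms(4,5) unfolding overlap_iff[OF assms(1)] by blast+
    then show ?thesis
      unfolding overlap_iff[OF assms(2)] chart_inv_transition[OF assms(1,2,4)]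
      using chart_map_in[OF assms(2)] by (simp add: transition_def)
  qed
  from has_derivative_compose[OF transition_has_derivative[OF assms(1,2,4)]
      transition_has_derivative[OF assms(2,3) this]]
  have "((\<lambda>x. transition d e (transition c d x)) has_derivative
      (\<lambda>u. dtrans d e (transition c d x) (dtrans c d x u))) (at x)" .
  then have "(transition c e has_derivative
      (\<lambda>u. dtrans d e (transition c d x) (dtrans c d x u))) (at x)"
    by (rule iffD1[OF has_derivative_cong_open[OF open_overlap[OF assms(1,2)] assms(4)], rotated])
      (rule transition_transition[OF assms(1,2)])
  from fun_cong[OF frechet_derivative_at[OF this], of u] show ?thesis .
qed

lemma dtrans_self:
  assumes "c \<in> A" "x \<in> chart_img c"
  shows "dtrans c c x u = u"
proof -
  have "(transition c c has_derivative (\<lambda>u. u)) (at x)"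
    by (rule iffD2[OF has_derivative_cong_open[OF open_chart_img[OF assms(1)] assms(2)]
          has_derivative_ident]) (rule transition_self[OF assms(1)])
  from fun_cong[OF frechet_derivative_at[OF this], of u] show ?thesis by simp
qed

lemma overlap_self: "c \<in> A \<Longrightarrow> overlap c c = chart_img c"
  by (auto simp: overlap_iff chart_inv_in)

lemma dtrans_inverse:
  assumes "c \<in> A" "d \<in> A" "x \<in> overlap c d"
  shows "dtrans d c (transition c d x) (dtrans c d x u) = u"
proof -
  have "x \<in> chart_img c" using assms by (simp add: overlap_iff)
  then show ?thesis
    using dtrans_cocycle[OF assms(1,2,1,3), of u] dtrans_self[OF assms(1), of x u]
      overlap_self[OF assms(1)] by metis
qed

lemma map_in_overlap: "c \<in> A \<Longrightarrow> p \<in> chart_dom c \<Longrightarrow> p \<in> chart_dom d \<Longrightarrow> chart_map c p \<in> overlap c d"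
  unfolding overlap_def by blast

lemma transition_map: "c \<in> A \<Longrightarrow> p \<in> chart_dom c \<Longrightarrow> transition c d (chart_map c p) = chart_map d p"
  by (simp add: transition_def chart_inv_map)

lemma tangent_of_in_tangent_space:
  assumes "c \<in> A" "p \<in> chart_dom c"
  shows "tangent_of A c p u \<in> tangent_space A p"
  unfolding tangent_space_def
proof (intro CollectI conjI allI ballI impI)
  fix d e assume de: "d \<in> A" "e \<in> A" "p \<in> chart_dom d \<inter> chart_dom e"
  have "dtrans d e (transition c d (chart_map c p)) (dtrans c d (chart_map c p) u) =
      dtrans c e (chart_map c p) u"
    using assms de by (intro dtrans_cocycle map_in_overlap) auto
  then show "tangent_of A c p u e = dtrans d e (chart_map d p) (tangent_of A c p u d)"
    using assms de by (simp add: tangent_of_def transition_map)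
qed (auto simp: tangent_of_def)

lemma tangent_of_self:
  assumes "c \<in> A" "p \<in> chart_dom c"
  shows "tangent_of A c p u c = u"
  using assms by (simp add: tangent_of_def dtrans_self chart_map_in)

lemma tangent_space_change_chart:
  assumes "v \<in> tangent_space A p" "c \<in> A" "d \<in> A" "p \<in> chart_dom c" "p \<in> chart_dom d"
  shows "v d = dtrans c d (chart_map c p) (v c)"
proof -
  have "\<forall>c\<in>A. \<forall>d\<in>A. p \<in> chart_dom c \<inter> chart_dom d \<longrightarrow> v d = dtrans c d (chart_map c p) (v c)"
    using assms(1) unfolding tangent_space_def mem_Collect_eq by (elim conjE)
  from this[rule_format, OF assms(2,3)] show ?thesis using assms(4,5) by blast
qed

lemma tangent_of_coord:
  assumes "v \<in> tangent_space A p" "c \<in> A" "p \<in> chart_dom c"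
  shows "tangent_of A c p (v c) = v"
proof
  fix d
  show "tangent_of A c p (v c) d = v d"
  proof (cases "d \<in> A \<and> p \<in> chart_dom d")
    case True
    then have "v d = dtrans c d (chart_map c p) (v c)"
      by (intro tangent_space_change_chart[OF assms(1,2)] assms(3)) auto
    then show ?thesis using True unfolding tangent_of_def by metis
  next
    case False
    have "\<forall>c. \<not> (c \<in> A \<and> p \<in> chart_dom c) \<longrightarrow> v c = 0"
      using assms(1) unfolding tangent_space_def mem_Collect_eq by (elim conjE)
    then have "v d = 0" using False by blast
    then show ?thesis using False by (auto simp: tangent_of_def)
  qed
qed

lemma local_field_transition:
  assumes "vector_field A X" "c \<in> A" "d \<in> A" "x \<in> overlap c d"
  shows "local_field d X (transition c d x) = dtrans c d x (local_field c X x)"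
proof -
  define p where "p = chart_inv c x"
  have p: "p \<in> chart_dom c" "p \<in> chart_dom d" "chart_map c p = x"
    using assms unfolding p_def by (auto simp: overlap_iff chart_inv_in chart_map_inv)
  have "X p \<in> tangent_space A p" using assms(1) unfolding vector_field_def by blast
  then have "X p d = dtrans c d (chart_map c p) (X p c)"
    by (rule tangent_space_change_chart[OF _ assms(2,3) p(1,2)])
  then show ?thesis
    unfolding local_field_def chart_inv_transition[OF assms(2-4)] p_def[symmetric] p(3) .
qed

lemma local_field_pullback:
  assumes "vector_field A X" "c \<in> A" "d \<in> A" "x \<in> overlap c d"
  shows "local_field c X x = dtrans d c (transition c d x) (local_field d X (transition c d x))"
  unfolding local_field_transition[OF assms] by (rule dtrans_inverse[OF assms(2-4), symmetric])

text \<open>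
  Coordinate expressions of a field in two charts differ by composition with a transition map and
  multiplication by the derivative of its inverse, both smooth.
\<close>

lemma Ck_family_change_chart:
  assumes "\<And>s. s \<in> P \<Longrightarrow> vector_field A (X s)" "c \<in> A" "d \<in> A" "open T"
    and "Ck_family k (\<lambda>s. local_field d (X s)) P T"
  shows "Ck_family k (\<lambda>s. local_field c (X s)) P (overlap c d \<inter> transition c d -` T)"
proof -
  let ?S = "overlap c d \<inter> transition c d -` T"
  have "continuous_on (overlap c d) (transition c d)"
    by (rule Ck_on_imp_continuous_on[OF Ck_on_transition[OF assms(2,3)]])
  then have S: "open ?S"
    using iffD1[OF continuous_on_open_vimage[OF open_overlap[OF assms(2,3)]]] assms(4)
    by (metis Int_commute)
  have T: "open (T \<inter> overlap d c)" using assms by (intro open_Int open_overlap)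
  have "Ck_family k (\<lambda>_. transition c d) P ?S"
    by (rule Ck_family_mono[OF Ck_on_imp_family[OF Ck_on_transition[OF assms(2,3)]] order_refl order_refl]) auto
  moreover have "Ck_family k (\<lambda>s y. dtrans d c y (local_field d (X s) y)) P (T \<inter> overlap d c)"
  proof (rule Ck_family_derivative_along[where f = "\<lambda>_. transition d c", OF T])
    show "Ck_family (Suc k) (\<lambda>_. transition d c) P (T \<inter> overlap d c)"
      by (rule Ck_family_mono[OF Ck_on_imp_family[OF Ck_on_transition[OF assms(3,2)]] order_refl order_refl]) auto
    show "Ck_family k (\<lambda>s. local_field d (X s)) P (T \<inter> overlap d c)"
      by (rule Ck_family_mono[OF assms(5) order_refl order_refl]) auto
  qed
  ultimately have "Ck_family k (\<lambda>s x. dtrans d c (transition c d x)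
      (local_field d (X s) (transition c d x))) P ?S"
    by (rule Ck_family_compose[OF S T]) (use transition_in[OF assms(2,3)] in auto)
  then show ?thesis
  proof (rule Ck_family_eq[OF S])
    fix s x assume "s \<in> P" "x \<in> ?S"
    then show "local_field c (X s) x = dtrans d c (transition c d x) (local_field d (X s) (transition c d x))"
      using local_field_pullback[OF assms(1) assms(2,3)] by blast
  qed
qed

lemma dtrans_matrix_invertible:
  assumes "c \<in> A" "d \<in> A" "x \<in> overlap c d"
  shows "invertible (matrix (dtrans c d x))"
proof -
  let ?y = "transition c d x"
  have y: "?y \<in> overlap d c" by (rule transition_in[OF assms])
  have yx: "transition d c ?y = x"
    using transition_transition[OF assms, of c] transition_self[OF assms(1)] assms by (simp add: overlap_iff)
  have l: "linear (dtrans c d x)" "linear (dtrans d c ?y)"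
    by (rule linear_dtrans[OF assms]) (rule linear_dtrans[OF assms(2,1) y])
  have "dtrans d c ?y \<circ> dtrans c d x = id" using dtrans_inverse[OF assms] by auto
  then have 1: "matrix (dtrans d c ?y) ** matrix (dtrans c d x) = mat 1"
    using matrix_compose[OF l] by (simp add: matrix_id_mat_1)
  have "dtrans c d x \<circ> dtrans d c ?y = id" using dtrans_inverse[OF assms(2,1) y] yx by auto
  then have 2: "matrix (dtrans c d x) ** matrix (dtrans d c ?y) = mat 1"
    using matrix_compose[OF l(2,1)] by (simp add: matrix_id_mat_1)
  show ?thesis using 1 2 unfolding invertible_def by blast
qed

text \<open>
  A chart in which the volume form is the canonical one expresses the density in every other
  chart as the Jacobian determinant of the transition map.
\<close>

lemma density_conservative:
  assumes "c \<in> A" "W \<in> A" "x \<in> overlap c W"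
    and "\<And>y u. y \<in> chart_img W \<Longrightarrow> push_form A \<omega> W y u = canonical_form u"
  shows "density A \<omega> c x = det (matrix (dtrans c W x))"
proof -
  define p where "p = chart_inv c x"
  have p: "p \<in> chart_dom c" "p \<in> chart_dom W" "chart_map c p = x"
    using assms unfolding p_def by (auto simp: overlap_iff chart_inv_in chart_map_inv)
  have t: "tangent_of A c p u = tangent_of A W p (dtrans c W x u)" for u
  proof -
    have "tangent_of A c p u W = dtrans c W x u"
      using p assms(2) by (simp add: tangent_of_def)
    then show ?thesis
      using tangent_of_coord[OF tangent_of_in_tangent_space[OF assms(1) p(1), of u] assms(2) p(2)] by simp
  qed
  have y: "chart_map W p \<in> chart_img W" "chart_inv W (chart_map W p) = p"
    using assms(2) p(2) by (auto simp: chart_map_in chart_inv_map)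
  have "density A \<omega> c x = push_form A \<omega> W (chart_map W p) (\<lambda>i. dtrans c W x (axis i 1))"
    unfolding density_def push_form_def p_def[symmetric] y t ..
  also have "\<dots> = det (matrix (dtrans c W x))"
    unfolding assms(4)[OF y(1)] canonical_form_def matrix_def ..
  finally show ?thesis .
qed

lemma density_conservative_self:
  assumes "W \<in> A" "x \<in> chart_img W"
    and "\<And>y u. y \<in> chart_img W \<Longrightarrow> push_form A \<omega> W y u = canonical_form u"
  shows "density A \<omega> W x = 1"
proof -
  have "dtrans W W x = id" using dtrans_self[OF assms(1,2)] by auto
  then show ?thesis
    using density_conservative[OF assms(1,1) _ assms(3)] assms(2) overlap_self[OF assms(1)]
    by (simp add: matrix_id_mat_1)
qed

lemma vec_nth_frechet_derivative:
  fixes F :: "'a::euclidean_space \<Rightarrow> real^'n"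
  assumes "F differentiable at x"
  shows "frechet_derivative (\<lambda>y. F y $ i) (at x) h = frechet_derivative F (at x) h $ i"
proof -
  have "((\<lambda>y. F y $ i) has_derivative (\<lambda>h. frechet_derivative F (at x) h $ i)) (at x)"
    using assms by (intro bounded_linear.has_derivative[OF bounded_linear_vec_nth])
      (simp add: frechet_derivative_works)
  from fun_cong[OF frechet_derivative_at[OF this], of h] show ?thesis by simp
qed

lemma divergence_eq_euclidean_div:
  assumes "(\<lambda>y. density A \<omega> c y *\<^sub>R local_field c X y) differentiable at x"
  shows "divergence A \<omega> c X x =
    euclidean_div (\<lambda>y. density A \<omega> c y *\<^sub>R local_field c X y) x / density A \<omega> c x"
  unfolding divergence_def euclidean_div_cart vec_nth_frechet_derivative[OF assms, symmetric] by simp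

lemma divergence_conservative:
  assumes "W \<in> A" "x \<in> chart_img W" "local_field W X differentiable at x"
    and "\<And>y u. y \<in> chart_img W \<Longrightarrow> push_form A \<omega> W y u = canonical_form u"
  shows "divergence A \<omega> W X x = euclidean_div (local_field W X) x"
proof -
  have eq: "density A \<omega> W y *\<^sub>R local_field W X y = local_field W X y" if "y \<in> chart_img W" for y
    using density_conservative_self[OF assms(1) that assms(4)] by simp
  note o = open_chart_img[OF assms(1)]
  have d: "(\<lambda>y. density A \<omega> W y *\<^sub>R local_field W X y) differentiable at x"
    using differentiable_cong_open[OF o assms(2) eq] assms(3) by simp
  have "frechet_derivative (\<lambda>y. density A \<omega> W y *\<^sub>R local_field W X y) (at x) =
      frechet_derivative (local_field W X) (at x)"
    by (rule frechet_derivative_cong_open[OF o assms(2) eq])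
  moreover have "density A \<omega> W x = 1"
    by (rule density_conservative_self[OF assms(1,2)]) (rule assms(4))
  ultimately show ?thesis
    unfolding divergence_eq_euclidean_div[OF d] euclidean_div_def by simp
qed

text \<open>
  With \<open>\<rho>\<close> the density in the chart \<open>c\<close>, the field \<open>\<rho> X\<^sub>c\<close> is the Piola transform of the expression
  of \<open>X\<close> in the conservative chart \<open>W\<close>, because \<open>\<rho>\<close> is the Jacobian determinant.
\<close>

lemma divergence_zero_change_chart:
  assumes "vector_field A X" "c \<in> A" "W \<in> A" "x \<in> overlap c W"
    and W: "\<And>y u. y \<in> chart_img W \<Longrightarrow> push_form A \<omega> W y u = canonical_form u"
    and dc: "local_field c X differentiable at x"
    and dW: "local_field W X differentiable at (transition c W x)"
    and 0: "divergence A \<omega> W X (transition c W x) = 0"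
  shows "divergence A \<omega> c X x = 0"
proof -
  let ?y = "transition c W x"
  let ?F = "\<lambda>z. density A \<omega> c z *\<^sub>R local_field c X z"
  note o = open_overlap[OF assms(2,3)]
  have y: "?y \<in> chart_img W" using transition_in[OF assms(2-4)] assms(3) by (simp add: overlap_iff)
  have dens: "density A \<omega> c z = det (matrix (dtrans c W z))" if "z \<in> overlap c W" for z
    by (rule density_conservative[OF assms(2,3) that W])
  have "(\<lambda>z. det (matrix (dtrans c W z))) differentiable at x"
  proof -
    have "Ck_on 1 (\<lambda>z. dtrans c W z u) (overlap c W)" for u
      using Ck_on_directional[OF Ck_on_transition[OF assms(2,3), of "Suc 1"]] .
    then have "((\<lambda>z. dtrans c W z u) has_derivative frechet_derivative (\<lambda>z. dtrans c W z u) (at x)) (at x)" for u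
      by (rule Ck_on_has_derivative[OF _ _ assms(4)]) simp
    from bounded_linear.has_derivative[OF bounded_linear_vec_nth this]
    have "((\<lambda>z. matrix (dtrans c W z) $ i $ j) has_derivative
        (\<lambda>h. (\<chi> i j. frechet_derivative (\<lambda>z. dtrans c W z (axis j 1)) (at x) h $ i) $ i $ j)) (at x)" for i j
      unfolding matrix_def by simp
    moreover obtain B where "matrix (dtrans c W x) ** B = mat 1" "B ** matrix (dtrans c W x) = mat 1"
      using dtrans_matrix_invertible[OF assms(2-4)] unfolding invertible_def by blast
    ultimately show ?thesis
      using Jacobi_formula[where M = "\<lambda>z. matrix (dtrans c W z)"
          and M' = "\<lambda>h. \<chi> i j. frechet_derivative (\<lambda>z. dtrans c W z (axis j 1)) (at x) h $ i"]
        differentiableI by blast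
  qed
  then have "(\<lambda>z. density A \<omega> c z) differentiable at x"
    using differentiable_cong_open[OF o assms(4), of "density A \<omega> c"] dens by simp
  then have dF: "?F differentiable at x" using dc by (rule differentiable_scaleR)
  have "euclidean_div ?F x = det (matrix (dtrans c W x)) * euclidean_div (local_field W X) ?y"
  proof (rule divergence_of_Piola_transform[OF o Ck_on_transition[OF assms(2,3)] assms(4) dF dW _
        dtrans_matrix_invertible[OF assms(2-4)]])
    fix z assume z: "z \<in> overlap c W"
    show "dtrans c W z (?F z) = det (matrix (dtrans c W z)) *\<^sub>R local_field W X (transition c W z)"
      unfolding linear_scale[OF linear_dtrans[OF assms(2,3) z]]
        local_field_transition[OF assms(1-3) z] dens[OF z] ..
  qed
  also have "euclidean_div (local_field W X) ?y = 0"
    using divergence_conservative[OF assms(3) y dW W] 0 by simp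
  finally show ?thesis unfolding divergence_eq_euclidean_div[OF dF] by simp
qed

end

section \<open>Openness of the two kinds of regions\<close>

lemma boundary_chart_mem_iff:
  assumes "boundary_chart A k N i c" "p \<in> chart_dom c"
  shows "p \<in> N \<longleftrightarrow> 0 \<le> chart_map c p $ i"
proof -
  have c: "is_chart c" and im: "chart_map c ` (chart_dom c \<inter> N) = chart_img c \<inter> {x. 0 \<le> x $ i}"
    using assms(1) unfolding boundary_chart_def by auto
  show ?thesis
  proof
    assume "p \<in> N"
    then have "chart_map c p \<in> chart_map c ` (chart_dom c \<inter> N)" using assms(2) by blast
    then show "0 \<le> chart_map c p $ i" unfolding im by blast
  next
    assume "0 \<le> chart_map c p $ i"
    then have "chart_map c p \<in> chart_map c ` (chart_dom c \<inter> N)"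
      unfolding im using is_chart_map_in[OF c assms(2)] by blast
    then obtain q where "q \<in> chart_dom c" "q \<in> N" "chart_map c p = chart_map c q" by blast
    then show "p \<in> N" using is_chart_inv_map[OF c] assms(2) by metis
  qed
qed

text \<open>
  A boundary chart maps \<open>N\<close> to a half-space, so points with positive coordinate are interior to \<open>N\<close>
  and points with coordinate zero are limits of points outside \<open>N\<close>. In particular a point
  cannot be of both kinds, for different boundary charts.
\<close>

lemma minterior_eq_interior:
  assumes "Ck_full_submanifold A k N"
  shows "minterior A k N = interior N"
proof
  show "minterior A k N \<subseteq> interior N"
  proof
    fix p assume p: "p \<in> minterior A k N"
    then have pN: "p \<in> N" "p \<notin> mboundary A k N" unfolding minterior_def by auto
    obtain i c where c: "boundary_chart A k N i c" "p \<in> chart_dom c"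
      using assms pN(1) unfolding Ck_full_submanifold_def by blast
    have "chart_map c p $ i \<noteq> 0" using pN c unfolding mboundary_def by blast
    moreover have "0 \<le> chart_map c p $ i" using boundary_chart_mem_iff[OF c] pN(1) by blast
    ultimately have pos: "0 < chart_map c p $ i" by simp
    have ch: "is_chart c" using c(1) unfolding boundary_chart_def by blast
    have "open (chart_img c \<inter> {x. 0 < x $ i})"
      using ch unfolding is_chart_def
      by (intro open_Int open_Collect_less continuous_intros) auto
    then have o: "open (chart_inv c ` (chart_img c \<inter> {x. 0 < x $ i}))"
      by (intro is_chart_inv_image_open[OF ch]) auto
    have "p \<in> chart_inv c ` (chart_img c \<inter> {x. 0 < x $ i})"
      using is_chart_inv_map[OF ch c(2)] is_chart_map_in[OF ch c(2)] pos by force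
    moreover have "chart_inv c ` (chart_img c \<inter> {x. 0 < x $ i}) \<subseteq> N"
    proof
      fix q assume "q \<in> chart_inv c ` (chart_img c \<inter> {x. 0 < x $ i})"
      then obtain x where x: "x \<in> chart_img c" "0 < x $ i" "q = chart_inv c x" by blast
      then show "q \<in> N"
        using boundary_chart_mem_iff[OF c(1), of q] is_chart_inv_in[OF ch x(1)] is_chart_map_inv[OF ch x(1)] by simp
    qed
    ultimately show "p \<in> interior N" using o interiorI by blast
  qed
  show "interior N \<subseteq> minterior A k N"
  proof
    fix q assume q: "q \<in> interior N"
    have "q \<notin> mboundary A k N"
    proof
      assume "q \<in> mboundary A k N"
      then obtain i c where c: "boundary_chart A k N i c" "q \<in> chart_dom c" "chart_map c q $ i = 0"
        unfolding mboundary_def by blast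
      have ch: "is_chart c" using c(1) unfolding boundary_chart_def by blast
      have "open (chart_map c ` (chart_dom c \<inter> interior N))" by (rule is_chart_image_open[OF ch open_interior])
      moreover have "chart_map c q \<in> chart_map c ` (chart_dom c \<inter> interior N)" using c(2) q by blast
      ultimately obtain e where e: "e > 0" "ball (chart_map c q) e \<subseteq> chart_map c ` (chart_dom c \<inter> interior N)"
        using openE by blast
      define x where "x = chart_map c q - (e / 2) *\<^sub>R axis i 1"
      have "x \<in> ball (chart_map c q) e" using e(1) by (simp add: x_def dist_norm norm_axis_1)
      then obtain p where p: "p \<in> chart_dom c" "p \<in> interior N" "x = chart_map c p" using e(2) by blast
      have "0 \<le> x $ i" using boundary_chart_mem_iff[OF c(1) p(1)] p interior_subset by blast
      then show False using c(3) e(1) by (simp add: x_def)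
    qed
    then show "q \<in> minterior A k N" using q interior_subset unfolding minterior_def by blast
  qed
qed

lemma boundary_chart_zero_in_mboundary:
  assumes "boundary_chart A k N i c" "x \<in> chart_img c" "x $ i = 0"
  shows "chart_inv c x \<in> mboundary A k N"
proof -
  have ch: "is_chart c" using assms(1) unfolding boundary_chart_def by blast
  note d = is_chart_inv_in[OF ch assms(2)] is_chart_map_inv[OF ch assms(2)]
  have "chart_inv c x \<in> N" using boundary_chart_mem_iff[OF assms(1) d(1)] d(2) assms(3) by simp
  then show ?thesis
    unfolding mboundary_def mem_Collect_eq using assms(1,3) d
    by (intro conjI exI[of _ i] exI[of _ c]) simp_all
qed

text \<open>
  Away from \<open>t = 0\<close>, the collar embedding read in charts is a continuous injection from an open
  subset of \<open>\<real>\<^sup>n\<close> to \<open>\<real>\<^sup>n\<close>. Invariance of domain applies.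
\<close>

lemma open_collar_interior:
  fixes A :: "('m::topological_space, 'n::finite) chart set"
  assumes "smooth_atlas A" "collar_interior A N \<Omega>"
  shows "open \<Omega>"
proof -
  obtain \<zeta> \<epsilon> where z: "collar_embedding A N \<zeta>" "0 < \<epsilon>" and \<Omega>: "\<Omega> = \<zeta> ` (mboundary A 3 N \<times> {0<..<\<epsilon>})"
    using assms(2) unfolding collar_interior_def by blast
  have emb: "embedding_map (top_of_set (mboundary A 3 N \<times> {0..})) euclidean \<zeta>"
    and loc: "\<forall>i c d p t. boundary_chart A 3 N i c \<and> p \<in> chart_dom c \<inter> mboundary A 3 N \<and> 0 \<le> t \<and>
        d \<in> A \<and> \<zeta> (p, t) \<in> chart_dom d \<longrightarrow>
      (\<exists>W g. open W \<and> set_coord i t (chart_map c p) \<in> W \<and> Ck_on 2 g W \<and>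
        (\<forall>z\<in>W. 0 \<le> z $ i \<longrightarrow> set_coord i 0 z \<in> chart_img c \<and>
          \<zeta> (chart_inv c (set_coord i 0 z), z $ i) \<in> chart_dom d \<and>
          g z = chart_map d (\<zeta> (chart_inv c (set_coord i 0 z), z $ i))) \<and>
        inj (frechet_derivative g (at (set_coord i t (chart_map c p)))))"
    using z(1) unfolding collar_embedding_def by blast+
  have inj: "inj_on \<zeta> (mboundary A 3 N \<times> {0..})"
    using emb unfolding embedding_map_def homeomorphic_map_def by simp
  have "\<exists>T. open T \<and> q \<in> T \<and> T \<subseteq> \<Omega>" if q: "q \<in> \<Omega>" for q
  proof -
    obtain p t where pt: "p \<in> mboundary A 3 N" "0 < t" "t < \<epsilon>" "q = \<zeta> (p, t)"
      using q unfolding \<Omega> by auto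
    obtain i c where c: "boundary_chart A 3 N i c" "p \<in> chart_dom c" "chart_map c p $ i = 0"
      using pt(1) unfolding mboundary_def by blast
    obtain d where d: "d \<in> A" "q \<in> chart_dom d" using assms(1) unfolding smooth_atlas_def by blast
    have cc: "is_chart c" using c(1) unfolding boundary_chart_def by blast
    have cd: "is_chart d" using assms(1) d(1) unfolding smooth_atlas_def by blast
    have "\<exists>W g. open W \<and> set_coord i t (chart_map c p) \<in> W \<and> Ck_on 2 g W \<and>
        (\<forall>z\<in>W. 0 \<le> z $ i \<longrightarrow> set_coord i 0 z \<in> chart_img c \<and>
          \<zeta> (chart_inv c (set_coord i 0 z), z $ i) \<in> chart_dom d \<and>
          g z = chart_map d (\<zeta> (chart_inv c (set_coord i 0 z), z $ i))) \<and>
        inj (frechet_derivative g (at (set_coord i t (chart_map c p))))"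
      by (rule loc[rule_format]) (use c pt d in auto)
    then obtain W g where W: "open W" "set_coord i t (chart_map c p) \<in> W" "Ck_on 2 g W"
      and g: "\<And>z. z \<in> W \<Longrightarrow> 0 \<le> z $ i \<Longrightarrow> set_coord i 0 z \<in> chart_img c"
        "\<And>z. z \<in> W \<Longrightarrow> 0 \<le> z $ i \<Longrightarrow> \<zeta> (chart_inv c (set_coord i 0 z), z $ i) \<in> chart_dom d"
        "\<And>z. z \<in> W \<Longrightarrow> 0 \<le> z $ i \<Longrightarrow> g z = chart_map d (\<zeta> (chart_inv c (set_coord i 0 z), z $ i))"
      by metis
    define V where "V = W \<inter> {z. 0 < z $ i} \<inter> {z. z $ i < \<epsilon>}"
    have oV: "open V" unfolding V_def
      by (intro open_Int W(1) open_Collect_less continuous_intros)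
    have V: "z \<in> W" "0 < z $ i" "0 \<le> z $ i" "z $ i < \<epsilon>" if "z \<in> V" for z
      using that unfolding V_def by auto
    have bd: "chart_inv c (set_coord i 0 z) \<in> mboundary A 3 N" if "z \<in> V" for z
      using boundary_chart_zero_in_mboundary[OF c(1) g(1)[OF V(1,3)[OF that]]] by (simp add: set_coord_def)
    have contg: "continuous_on V g"
    proof -
      have "continuous_on W g" by (rule Ck_on_imp_continuous_on[OF W(3)])
      then show ?thesis by (rule continuous_on_subset) (auto simp: V_def)
    qed
    have injg: "inj_on g V"
    proof (rule inj_onI)
      fix z z' assume zz: "z \<in> V" "z' \<in> V" "g z = g z'"
      have "chart_map d (\<zeta> (chart_inv c (set_coord i 0 z), z $ i)) =
          chart_map d (\<zeta> (chart_inv c (set_coord i 0 z'), z' $ i))"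
        using zz(3) g(3)[OF V(1,3)[OF zz(1)]] g(3)[OF V(1,3)[OF zz(2)]] by simp
      then have "\<zeta> (chart_inv c (set_coord i 0 z), z $ i) = \<zeta> (chart_inv c (set_coord i 0 z'), z' $ i)"
        using is_chart_inv_map[OF cd g(2)[OF V(1,3)[OF zz(1)]]]
          is_chart_inv_map[OF cd g(2)[OF V(1,3)[OF zz(2)]]] by metis
      then have "(chart_inv c (set_coord i 0 z), z $ i) = (chart_inv c (set_coord i 0 z'), z' $ i)"
        by (rule inj_onD[OF inj]) (use bd zz V(3) in auto)
      then have e: "chart_inv c (set_coord i 0 z) = chart_inv c (set_coord i 0 z')" "z $ i = z' $ i" by auto
      then have "set_coord i 0 z = set_coord i 0 z'"
        using is_chart_map_inv[OF cc g(1)[OF V(1,3)[OF zz(1)]]]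
          is_chart_map_inv[OF cc g(1)[OF V(1,3)[OF zz(2)]]] by metis
      then have eq: "set_coord i 0 z $ j = set_coord i 0 z' $ j" for j by simp
      have "z $ j = z' $ j" for j
        using e(2) eq[of j] by (cases "j = i") (simp_all add: set_coord_def)
      then show "z = z'" by (simp add: vec_eq_iff)
    qed
    have o: "open (g ` V)" by (rule invariance_of_domain[OF contg oV injg])
    have sub: "g ` V \<subseteq> chart_img d"
      using g(2,3) V(1,3) is_chart_map_in[OF cd] by auto
    have invg: "chart_inv d (g z) = \<zeta> (chart_inv c (set_coord i 0 z), z $ i)" if "z \<in> V" for z
      using g(3)[OF V(1,3)[OF that]] is_chart_inv_map[OF cd g(2)[OF V(1,3)[OF that]]] by simp
    show ?thesis
    proof (intro exI conjI)
      show "open (chart_inv d ` g ` V)" by (rule is_chart_inv_image_open[OF cd o sub])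
      let ?x = "set_coord i t (chart_map c p)"
      have xi: "?x $ i = t" by (simp add: set_coord_def)
      then have x: "?x \<in> V" using W(2) pt unfolding V_def by simp
      have "set_coord i 0 ?x = chart_map c p" using c(3) by (simp add: set_coord_def vec_eq_iff)
      then have "chart_inv d (g ?x) = q"
        using invg[OF x] xi is_chart_inv_map[OF cc c(2)] pt(4) by simp
      then show "q \<in> chart_inv d ` g ` V" using x by blast
      show "chart_inv d ` g ` V \<subseteq> \<Omega>"
      proof
        fix q' assume "q' \<in> chart_inv d ` g ` V"
        then obtain z where "z \<in> V" "q' = chart_inv d (g z)" by blast
        then show "q' \<in> \<Omega>" using invg bd V unfolding \<Omega> by auto
      qed
    qed
  qed
  then show ?thesis using open_subopen by blast
qed

lemma uniform_small_at_zero: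
  fixes F :: "real \<Rightarrow> 'a::metric_space \<Rightarrow> 'b::real_normed_vector"
  assumes "continuous_on ({0..s0} \<times> K) (\<lambda>(s, x). F s x)" "compact K" "s0 > 0" "\<eta> > 0"
  shows "\<forall>\<^sub>F s in at_right 0. \<forall>x\<in>K. norm (F s x - F 0 x) \<le> \<eta>"
proof -
  have "uniformly_continuous_on ({0..s0} \<times> K) (\<lambda>(s, x). F s x)"
    by (intro compact_uniformly_continuous assms compact_Times) auto
  then obtain d where d: "d > 0" "\<And>z z'. z \<in> {0..s0} \<times> K \<Longrightarrow> z' \<in> {0..s0} \<times> K \<Longrightarrow> dist z' z < d \<Longrightarrow>
      dist (case z' of (s, x) \<Rightarrow> F s x) (case z of (s, x) \<Rightarrow> F s x) < \<eta>"
    using assms(4) unfolding uniformly_continuous_on_def by metis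
  have "norm (F s x - F 0 x) \<le> \<eta>" if "0 < s" "s < min d s0" "x \<in> K" for s x
    using d(2)[of "(0, x)" "(s, x)"] that assms(3) by (simp add: dist_Pair_Pair dist_norm less_imp_le)
  then show ?thesis
    unfolding eventually_at_right_field using d(1) assms(3) by (intro exI[of _ "min d s0"]) auto
qed

lemma iter_deriv_diff:
  fixes f g :: "'a::euclidean_space \<Rightarrow> 'b::real_normed_vector"
  assumes "open S" "Ck_on k f S" "Ck_on k g S" "length us \<le> k" "x \<in> S"
  shows "iter_deriv (\<lambda>x. f x - g x) us x = iter_deriv f us x - iter_deriv g us x"
proof -
  have "Ck_on k (\<lambda>x. (-1) *\<^sub>R g x) S"
    using assms(3) unfolding Ck_on_iff_family by (intro Ck_family_scaleR Ck_family_const assms(1))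
  from iter_deriv_add[OF assms(1,2) this assms(4,5)] iter_deriv_scaleR[OF assms(1,3-5), of "-1"]
  show ?thesis by simp
qed

section \<open>Smoothing inside one chart of a conservative regular atlas\<close>

lemma norm_le_of_mem_cbox_One:
  fixes v :: "'a::euclidean_space"
  assumes "v \<in> cbox (- One) One"
  shows "norm v \<le> DIM('a)"
proof -
  have "norm v \<le> (\<Sum>b\<in>Basis. \<bar>v \<bullet> b\<bar>)" by (rule norm_le_l1)
  also have "\<dots> \<le> (\<Sum>b\<in>(Basis::'a set). 1)"
    using assms by (intro sum_mono) (auto simp: mem_box abs_le_iff)
  finally show ?thesis by simp
qed

text \<open>
  The charts \<open>W i\<close> extend the charts \<open>V i\<close>, whose images have compact closure in those of \<open>W i\<close>. The
  smoothing takes place in \<open>W i\<close> and changes the field inside the domain of \<open>V i\<close> only.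
\<close>

locale conservative_regular_manifold = smooth_manifold A
  for A :: "('m::t2_space, 'n::finite) chart set" +
  fixes \<omega> :: "('m, 'n) topform" and m :: nat and V W :: "nat \<Rightarrow> ('m, 'n) chart" and l L :: real
  assumes compact_manifold: "compact (UNIV :: 'm set)"
    and V_in: "\<And>i. i \<in> {1..m} \<Longrightarrow> V i \<in> A" and W_in: "\<And>i. i \<in> {1..m} \<Longrightarrow> W i \<in> A"
    and V_cover: "(\<Union>i\<in>{1..m}. chart_dom (V i)) = UNIV"
    and W_conservative: "\<And>i x u. i \<in> {1..m} \<Longrightarrow> x \<in> chart_img (W i) \<Longrightarrow>
      push_form A \<omega> (W i) x u = canonical_form u"
    and V_img: "\<And>i. i \<in> {1..m} \<Longrightarrow> chart_img (V i) = ball 0 l"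
    and W_img: "\<And>i. i \<in> {1..m} \<Longrightarrow> chart_img (W i) = ball 0 L"
    and l_pos: "0 < l"
    and V_closure: "\<And>i. i \<in> {1..m} \<Longrightarrow> closure (chart_dom (V i)) \<subseteq> chart_dom (W i)"
    and W_extends: "\<And>i p. i \<in> {1..m} \<Longrightarrow> p \<in> chart_dom (V i) \<Longrightarrow>
      chart_map (W i) p = chart_map (V i) p"
begin

lemma V_sub_W: "i \<in> {1..m} \<Longrightarrow> p \<in> chart_dom (V i) \<Longrightarrow> p \<in> chart_dom (W i)"
  using V_closure closure_subset by blast

lemma W_inv_ball:
  assumes "i \<in> {1..m}" "x \<in> ball 0 l"
  shows "chart_inv (W i) x = chart_inv (V i) x" and "chart_inv (V i) x \<in> chart_dom (V i)"
proof -
  have x: "x \<in> chart_img (V i)" using assms V_img by simp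
  show p: "chart_inv (V i) x \<in> chart_dom (V i)" by (rule chart_inv_in[OF V_in[OF assms(1)] x])
  have "chart_map (W i) (chart_inv (V i) x) = x"
    using W_extends[OF assms(1) p] chart_map_inv[OF V_in[OF assms(1)] x] by simp
  then show "chart_inv (W i) x = chart_inv (V i) x"
    using chart_inv_map[OF W_in[OF assms(1)] V_sub_W[OF assms(1) p]] by simp
qed

lemma W_map_in_ball:
  assumes "i \<in> {1..m}" "p \<in> chart_dom (V i)"
  shows "chart_map (W i) p \<in> ball 0 l"
  using chart_map_in[OF V_in[OF assms(1)] assms(2)] W_extends[OF assms] V_img[OF assms(1)] by simp

lemma ball_subset_W_img: "i \<in> {1..m} \<Longrightarrow> cball (0::real^'n) l \<subseteq> ball 0 L"
proof -
  assume i: "i \<in> {1..m}"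
  let ?K = "closure (chart_dom (V i))"
  have "compact ?K" using compact_manifold closed_Int_compact[OF closed_closure] by force
  moreover have "continuous_on ?K (chart_map (W i))"
    by (rule continuous_on_subset[OF homeomorphism_cont1[OF homeomorphism_chart[OF W_in[OF i]]] V_closure[OF i]])
  ultimately have "closed (chart_map (W i) ` ?K)"
    by (intro compact_imp_closed compact_continuous_image)
  moreover have "ball 0 l \<subseteq> chart_map (W i) ` ?K"
  proof
    fix x :: "real^'n" assume x: "x \<in> ball 0 l"
    have "chart_map (W i) (chart_inv (V i) x) = x"
      using W_inv_ball[OF i x] W_extends[OF i] chart_map_inv[OF V_in[OF i]] V_img[OF i] x by simp
    then show "x \<in> chart_map (W i) ` ?K"
      using W_inv_ball(2)[OF i x] closure_subset by (metis image_eqI subsetD)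
  qed
  ultimately have "closure (ball 0 l) \<subseteq> chart_map (W i) ` ?K" by (intro closure_minimal)
  then have "cball 0 l \<subseteq> chart_map (W i) ` ?K" using l_pos by (simp add: closure_ball)
  also have "\<dots> \<subseteq> ball 0 L"
    using V_closure[OF i] chart_map_in[OF W_in[OF i]] unfolding W_img[OF i] by blast
  finally show "cball (0::real^'n) l \<subseteq> ball 0 L" .
qed

lemma l_less_L: "i \<in> {1..m} \<Longrightarrow> l < L"
proof -
  assume "i \<in> {1..m}"
  have "l *\<^sub>R axis undefined 1 \<in> cball (0::real^'n) l" using l_pos by (simp add: norm_axis_1)
  then have "l *\<^sub>R axis undefined 1 \<in> ball (0::real^'n) L"
    using ball_subset_W_img[OF \<open>i \<in> {1..m}\<close>] by blast
  then show "l < L" using l_pos by (simp add: norm_axis_1)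
qed

lemma local_field_V_eq_W:
  assumes "vector_field A X" "i \<in> {1..m}" "x \<in> ball 0 l"
  shows "local_field (V i) X x = local_field (W i) X x"
proof -
  note V = V_in[OF assms(2)] and W = W_in[OF assms(2)]
  have ov: "y \<in> overlap (W i) (V i)" if "y \<in> ball 0 l" for y
    using W_inv_ball[OF assms(2) that] ball_subset_W_img[OF assms(2)] W_img[OF assms(2)] that
    unfolding overlap_iff[OF W] by (auto simp: subset_iff)
  have t: "transition (W i) (V i) y = y" if "y \<in> ball 0 l" for y
    using W_inv_ball(1)[OF assms(2) that] chart_map_inv[OF V] V_img[OF assms(2)] that
    by (simp add: transition_def)
  have "(transition (W i) (V i) has_derivative (\<lambda>u. u)) (at x)"
    by (rule iffD2[OF has_derivative_cong_open[OF open_ball assms(3)] has_derivative_ident]) (rule t)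
  from fun_cong[OF frechet_derivative_at[OF this]]
  have "dtrans (W i) (V i) x u = u" for u by simp
  then show ?thesis
    using local_field_transition[OF assms(1) W V ov[OF assms(3)]] t[OF assms(3)] by metis
qed

text \<open>
  A bound on the \<open>C\<^sup>r\<close> norm of the difference that mentions no suprema, which makes it additive
  without considerations of boundedness.
\<close>

definition Cr_close :: "nat \<Rightarrow> ('m, 'n) vfield \<Rightarrow> ('m, 'n) vfield \<Rightarrow> real \<Rightarrow> bool" where
  "Cr_close r X Z e \<longleftrightarrow> (\<forall>j\<in>{1..m}. \<forall>us. length us \<le> r \<and> set us \<subseteq> sphere 0 1 \<longrightarrow>
    (\<forall>x\<in>ball 0 l. norm (iter_deriv (local_field (V j) (field_diff Z X)) us x) \<le> e))"

lemma local_field_diff: "local_field c (field_diff Z X) = (\<lambda>x. local_field c Z x - local_field c X x)"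
  by (simp add: local_field_def field_diff_def)

lemma divfree_vector_field: "X \<in> divfree_fields A \<omega> r \<Longrightarrow> vector_field A X"
  unfolding divfree_fields_def by blast

lemma divfree_Ck:
  assumes "X \<in> divfree_fields A \<omega> r" "c \<in> A"
  shows "Ck_on r (local_field c X) (chart_img c)"
proof -
  have "\<forall>c\<in>A. Ck_on r (local_field c X) (chart_map c ` (chart_dom c \<inter> UNIV))"
    using assms(1) unfolding divfree_fields_def Ck_field_on_def by blast
  then show ?thesis using assms(2) unfolding chart_img_def by simp
qed

lemma Cr_close_refl: "0 \<le> e \<Longrightarrow> Cr_close r X X e"
  unfolding Cr_close_def local_field_diff by (simp add: iter_deriv_zero)

lemma Cr_close_trans:
  assumes "X \<in> divfree_fields A \<omega> r" "Y \<in> divfree_fields A \<omega> r" "Z \<in> divfree_fields A \<omega> r"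
    and "Cr_close r X Y e" "Cr_close r Y Z e'"
  shows "Cr_close r X Z (e + e')"
  unfolding Cr_close_def
proof (intro ballI allI impI)
  fix j and us :: "(real^'n) list" and x assume j: "j \<in> {1..m}" and us: "length us \<le> r \<and> set us \<subseteq> sphere 0 1" and x: "x \<in> ball (0::real^'n) l"
  have C: "Ck_on r (local_field (V j) F) (ball 0 l)" if "F \<in> divfree_fields A \<omega> r" for F
    using divfree_Ck[OF that V_in[OF j]] V_img[OF j] by simp
  have d: "Ck_on r (local_field (V j) (field_diff F G)) (ball 0 l)"
    if "F \<in> divfree_fields A \<omega> r" "G \<in> divfree_fields A \<omega> r" for F G
    using C[OF that(1)] C[OF that(2)] unfolding local_field_diff Ck_on_iff_family
    by (intro Ck_family_diff open_ball)
  have "local_field (V j) (field_diff Z X) =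
      (\<lambda>x. local_field (V j) (field_diff Y X) x + local_field (V j) (field_diff Z Y) x)"
    unfolding local_field_diff by auto
  then have "iter_deriv (local_field (V j) (field_diff Z X)) us x =
      iter_deriv (local_field (V j) (field_diff Y X)) us x + iter_deriv (local_field (V j) (field_diff Z Y)) us x"
    using iter_deriv_add[OF open_ball d[OF assms(2,1)] d[OF assms(3,2)] conjunct1[OF us] x] by simp
  also have "norm \<dots> \<le> e + e'"
    using assms(4,5) j us x unfolding Cr_close_def by (intro norm_triangle_le add_mono) blast+
  finally show "norm (iter_deriv (local_field (V j) (field_diff Z X)) us x) \<le> e + e'" .
qed

lemma whitney_norm_le:
  assumes "Cr_close r X Z e"
  shows "whitney_norm m V r (field_diff Z X) \<le> e"
proof -
  have m: "{1..m} \<noteq> {}" using V_cover by auto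
  have "deriv_norm k (local_field (V j) (field_diff Z X)) x \<le> e"
    if "j \<in> {1..m}" "k \<le> r" "x \<in> ball 0 l" for j k x
    unfolding deriv_norm_def
  proof (rule cSUP_least)
    have "replicate k (axis undefined 1) \<in> {us. length us = k \<and> set us \<subseteq> sphere (0::real^'n) 1}"
      by (auto simp: norm_axis_1)
    then show "{us. length us = k \<and> set us \<subseteq> sphere (0::real^'n) 1} \<noteq> {}" by blast
  qed (use assms that in \<open>auto simp: Cr_close_def\<close>)
  then have "(SUP x\<in>chart_img (V j). deriv_norm k (local_field (V j) (field_diff Z X)) x) \<le> e"
    if "j \<in> {1..m}" "k \<le> r" for j k
    unfolding V_img[OF that(1)] using l_pos that by (intro cSUP_least) auto
  then show ?thesis
    unfolding whitney_norm_def using m by (subst Max_le_iff) auto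
qed

text \<open>
  A field that coincides with \<open>X\<close> outside the domain of \<open>V i\<close> has two open pieces: the domain of
  \<open>W i\<close>, where it can be controlled in the chart \<open>W i\<close>, and the complement of the closure of the domain
  of \<open>V i\<close>, where it is \<open>X\<close>. They cover the manifold because that closure lies in the
  domain of \<open>W i\<close>.
\<close>

lemma chart_change_cover:
  assumes i: "i \<in> {1..m}" and c: "c \<in> A" and G: "open G"
    and W: "\<And>s. s \<in> P \<Longrightarrow> vector_field A (Z s)"
    and inside: "Ck_family k (\<lambda>s. local_field (W i) (Z s)) P (chart_map (W i) ` (chart_dom (W i) \<inter> G))"
    and outside: "Ck_on k (local_field c X) (chart_map c ` (chart_dom c \<inter> G - closure (chart_dom (V i))))"
    and eq: "\<And>s p. s \<in> P \<Longrightarrow> p \<notin> chart_dom (V i) \<Longrightarrow> Z s p = X p"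
  shows "Ck_family k (\<lambda>s. local_field c (Z s)) P (chart_map c ` (chart_dom c \<inter> G))"
proof (rule Ck_family_local)
  fix x assume x: "x \<in> chart_map c ` (chart_dom c \<inter> G)"
  then have xc: "x \<in> chart_img c" "chart_inv c x \<in> G" unfolding chart_map_image[OF c] by auto
  let ?p = "chart_inv c x"
  let ?S = "chart_map c ` (chart_dom c \<inter> G)"
  note Wi = W_in[OF i]
  show "\<exists>T. open T \<and> x \<in> T \<and> Ck_family k (\<lambda>s. local_field c (Z s)) P (?S \<inter> T)"
  proof (cases "?p \<in> chart_dom (W i)")
    case True
    let ?T = "overlap c (W i)"
    have "Ck_family k (\<lambda>s. local_field c (Z s)) P
        (?T \<inter> transition c (W i) -` (chart_map (W i) ` (chart_dom (W i) \<inter> G)))"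
      by (rule Ck_family_change_chart[OF W c Wi open_chart_map_image[OF Wi G] inside])
    moreover have "?S \<inter> ?T \<subseteq> ?T \<inter> transition c (W i) -` (chart_map (W i) ` (chart_dom (W i) \<inter> G))"
    proof
      fix y assume y: "y \<in> ?S \<inter> ?T"
      then have "y \<in> ?S" "y \<in> ?T" by auto
      then have "chart_inv c y \<in> chart_dom (W i) \<inter> G"
        unfolding overlap_iff[OF c] chart_map_image[OF c] by simp
      then show "y \<in> ?T \<inter> transition c (W i) -` (chart_map (W i) ` (chart_dom (W i) \<inter> G))"
        using y by (auto simp: transition_def)
    qed
    ultimately have "Ck_family k (\<lambda>s. local_field c (Z s)) P (?S \<inter> ?T)"
      using Ck_family_mono[OF _ order_refl order_refl] by blast
    moreover have "x \<in> ?T" using True xc(1) unfolding overlap_iff[OF c] by blast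
    ultimately show ?thesis using open_overlap[OF c Wi] by blast
  next
    case False
    then have np: "?p \<notin> closure (chart_dom (V i))" using V_closure[OF i] by blast
    let ?T = "chart_map c ` (chart_dom c \<inter> (- closure (chart_dom (V i))))"
    have T: "open ?T" by (rule open_chart_map_image[OF c]) auto
    have xT: "x \<in> ?T" using xc(1) np unfolding chart_map_image[OF c] by blast
    have ST: "?S \<inter> ?T = chart_map c ` (chart_dom c \<inter> G - closure (chart_dom (V i)))"
      using chart_map_image[OF c, of G] chart_map_image[OF c, of "- closure (chart_dom (V i))"]
        chart_map_image[OF c, of "G - closure (chart_dom (V i))"]
      by (auto simp: Int_Diff)
    have o: "open (?S \<inter> ?T)" using T open_chart_map_image[OF c G] by blast
    have "Ck_family k (\<lambda>s. local_field c (Z s)) P (?S \<inter> ?T)"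
    proof (rule Ck_family_eq[OF o])
      show "Ck_family k (\<lambda>_. local_field c X) P (?S \<inter> ?T)"
        unfolding ST by (rule Ck_on_imp_family[OF outside])
      fix s y assume s: "s \<in> P" and "y \<in> ?S \<inter> ?T"
      then have "chart_inv c y \<notin> chart_dom (V i)"
        using closure_subset unfolding chart_map_image[OF c] by blast
      then show "local_field c (Z s) y = local_field c X y"
        using eq[OF s] unfolding local_field_def by simp
    qed
    then show ?thesis using T xT by blast
  qed
qed

text \<open>
  A deformation of \<open>X\<close>, constant outside \<open>U\<close>, through fields with zero divergence in the chart
  \<open>W i\<close>. For positive time it is smooth on \<open>U\<close>, and it stays smooth wherever \<open>X\<close> was smooth;
  the latter allows deformations in different charts to follow each other.
\<close>

definition smoothing_family ::
  "nat \<Rightarrow> 'm set \<Rightarrow> nat \<Rightarrow> ('m, 'n) vfield \<Rightarrow> real \<Rightarrow> (real \<Rightarrow> ('m, 'n) vfield) \<Rightarrow> bool" where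
  "smoothing_family i U r X s0 Z \<longleftrightarrow> 0 < s0 \<and> Z 0 = X \<and>
    (\<forall>s\<in>{0..s0}. vector_field A (Z s)) \<and>
    (\<forall>s\<in>{0..s0}. \<forall>p. p \<notin> U \<longrightarrow> Z s p = X p) \<and>
    Ck_family r (\<lambda>s. local_field (W i) (Z s)) {0..s0} (ball 0 L) \<and>
    (\<forall>s\<in>{0..s0}. \<forall>x\<in>ball 0 L. euclidean_div (local_field (W i) (Z s)) x = 0) \<and>
    (\<forall>s\<in>{0<..s0}. \<forall>G. open G \<longrightarrow> smooth_field_on A X G \<longrightarrow>
      smooth_on (local_field (W i) (Z s)) (chart_map (W i) ` (chart_dom (W i) \<inter> (G \<union> U))))"

lemma smoothing_family_exists:
  assumes i: "i \<in> {1..m}" and U: "open U" "U \<subseteq> chart_dom (V i)"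
    and X: "X \<in> divfree_fields A \<omega> r" and r: "r \<ge> 1"
  shows "\<exists>s0 Z. smoothing_family i U r X s0 Z"
proof -
  let ?w = "W i"
  let ?K = "real (DIM(real^'n))"
  note w = W_in[OF i]
  define B where "B = ball (0::real^'n) L"
  have img: "chart_img ?w = B" unfolding B_def by (rule W_img[OF i])
  define Y where "Y = local_field ?w X"
  have vX: "vector_field A X" by (rule divfree_vector_field[OF X])
  have cY: "Ck_on r Y B" unfolding Y_def img[symmetric] by (rule divfree_Ck[OF X w])
  have c1Y: "Ck_on 1 Y B" by (rule Ck_on_mono[OF cY r order_refl])
  have divY: "euclidean_div Y y = 0" if "y \<in> B" for y
  proof -
    have "divergence A \<omega> ?w X y = 0" using X w that img unfolding divfree_fields_def by simp
    moreover have "Y differentiable at y"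
      by (rule differentiableI[OF Ck_on_has_derivative[OF c1Y _ that]]) simp
    ultimately show ?thesis
      using divergence_conservative[OF w _ _ W_conservative[OF i], of y X] that img unfolding Y_def by simp
  qed
  define Uw where "Uw = chart_map ?w ` (chart_dom ?w \<inter> U)"
  have oUw: "open Uw" unfolding Uw_def by (rule open_chart_map_image[OF w U(1)])
  have Uwl: "Uw \<subseteq> ball 0 l" unfolding Uw_def using W_map_in_ball[OF i] U(2) by blast
  obtain \<delta> :: "real^'n \<Rightarrow> real" where "smooth_on \<delta> UNIV \<and> (\<forall>x. 0 \<le> \<delta> x \<and> \<delta> x \<le> 1) \<and>
      (\<forall>x. 0 < \<delta> x \<longleftrightarrow> x \<in> Uw)"
    using smooth_positive_exactly_on[OF oUw] by (rule exE)
  then have \<delta>: "smooth_on \<delta> UNIV" "\<And>x. 0 \<le> \<delta> x" "\<And>x. \<delta> x \<le> 1" "\<And>x. 0 < \<delta> x \<longleftrightarrow> x \<in> Uw"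
    by (elim conjE; simp)+
  obtain \<rho> :: "real^'n \<Rightarrow> real" where "smooth_on \<rho> UNIV \<and>
      (\<forall>v. v \<notin> cbox (- One) One \<longrightarrow> \<rho> v = 0) \<and> (\<rho> has_integral 1) (cbox (- One) One)"
    using mollifier_exists by (rule exE)
  then have \<rho>: "smooth_on \<rho> UNIV" "\<And>v. v \<notin> cbox (- One) One \<Longrightarrow> \<rho> v = 0"
    "(\<rho> has_integral 1) (cbox (- One) One)"
    by (elim conjE; simp)+
  have K: "?K > 0" by simp
  have lL: "l < L" by (rule l_less_L[OF i])
  \<comment> \<open>Points of the box \<open>cbox (- One) One\<close> have norm at most \<open>?K\<close>. With this bound on the time, twice
    the displacement \<open>s * \<delta> x * ?K\<close> is at most half the distance from \<open>ball 0 l\<close> to the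
    boundary of \<open>B\<close>.\<close>
  define s0 where "s0 = (L - l) / (4 * ?K)"
  have s0: "s0 > 0" unfolding s0_def using lL K by simp
  have s0K: "4 * (s0 * ?K) = L - l" unfolding s0_def using K by simp
  have sK: "s * \<delta> x * ?K \<le> s0 * ?K" "0 \<le> s * \<delta> x" if "s \<in> {0..s0}" for s x
  proof -
    have "s * \<delta> x \<le> s0 * 1" using that \<delta>(2,3) s0 by (intro mult_mono) auto
    then show "s * \<delta> x * ?K \<le> s0 * ?K" using K by (simp add: mult_right_mono)
    show "0 \<le> s * \<delta> x" using that \<delta>(2) by simp
  qed
  have inB: "x + (s * \<delta> x) *\<^sub>R v \<in> B" if "s \<in> {0..s0}" "v \<in> cbox (- One) One" "x \<in> B" for s v x
  proof (cases "\<delta> x = 0")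
    case False
    then have "x \<in> Uw" using \<delta>(2)[of x] \<delta>(4)[of x] by (simp add: less_le)
    then have "norm x < l" using Uwl by auto
    moreover have "norm ((s * \<delta> x) *\<^sub>R v) \<le> s0 * ?K"
    proof -
      have "norm ((s * \<delta> x) *\<^sub>R v) \<le> s * \<delta> x * ?K"
        using norm_le_of_mem_cbox_One[OF that(2)] sK(2)[OF that(1), of x]
        by (simp only: norm_scaleR abs_of_nonneg) (intro mult_left_mono)
      then show ?thesis using sK(1)[OF that(1), of x] by linarith
    qed
    moreover have "norm (x + (s * \<delta> x) *\<^sub>R v) \<le> norm x + norm ((s * \<delta> x) *\<^sub>R v)" by (rule norm_triangle_ineq)
    ultimately have "norm (x + (s * \<delta> x) *\<^sub>R v) < L" using s0K lL by linarith
    then show ?thesis unfolding B_def by simp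
  qed (use that in simp)
  define Z where "Z s p = (if p \<in> chart_dom ?w
    then tangent_of A ?w p (smear \<rho> \<delta> Y s (chart_map ?w p)) else X p)" for s p
  have localZ: "local_field ?w (Z s) x = smear \<rho> \<delta> Y s x" if "x \<in> B" for s x
    using that img chart_inv_in[OF w] chart_map_inv[OF w] tangent_of_self[OF w]
    unfolding local_field_def Z_def by simp
  have vZ: "vector_field A (Z s)" for s
    unfolding vector_field_def
  proof
    fix p show "Z s p \<in> tangent_space A p"
      using vX tangent_of_in_tangent_space[OF w] unfolding Z_def vector_field_def by simp
  qed
  have Zeq: "Z s p = X p" if "s = 0 \<or> p \<notin> U" for s p
  proof (cases "p \<in> chart_dom ?w")
    case True
    let ?x = "chart_map ?w p"
    have "smear \<rho> \<delta> Y s ?x = Y ?x"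
    proof (rule smear_eq_of_flat[OF \<rho>(3)])
      show "s = 0 \<or> \<delta> ?x = 0 \<and> frechet_derivative \<delta> (at ?x) = (\<lambda>_. 0)"
      proof (cases "s = 0")
        case False
        then have "chart_inv ?w ?x \<notin> U" using that chart_inv_map[OF w True] by simp
        then have "?x \<notin> Uw" unfolding Uw_def chart_map_image[OF w] by blast
        then have "\<delta> ?x = 0" using \<delta>(2)[of ?x] \<delta>(4)[of ?x] by (simp add: less_le)
        then show ?thesis using frechet_derivative_at_minimum[OF \<delta>(1,2)] by blast
      qed simp
    qed
    also have "Y ?x = X p ?w" unfolding Y_def local_field_def by (simp add: chart_inv_map[OF w True])
    finally have "Z s p = tangent_of A ?w p (X p ?w)" using True unfolding Z_def by simp
    also have "\<dots> = X p"
      using vX unfolding vector_field_def by (intro tangent_of_coord w True) auto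
    finally show ?thesis .
  qed (simp add: Z_def)
  have cs: "Ck_family r (smear \<rho> \<delta> Y) {0..s0} B"
    by (rule Ck_family_smear[OF \<rho>(1) \<delta>(1) _ _ cY]) (use inB in \<open>auto simp: B_def\<close>)
  have oB: "open B" unfolding B_def by simp
  show ?thesis unfolding smoothing_family_def
  proof (rule exI[of _ s0], rule exI[of _ Z], intro conjI ballI allI impI)
    show "0 < s0" by (rule s0)
    show "Z 0 = X" using Zeq by auto
    show "vector_field A (Z s)" for s by (rule vZ)
    show "Z s p = X p" if "p \<notin> U" for s p using Zeq that by blast
    show "Ck_family r (\<lambda>s. local_field ?w (Z s)) {0..s0} (ball 0 L)"
      unfolding B_def[symmetric] by (rule Ck_family_eq[OF oB cs]) (rule localZ)
  next
    fix s x assume s: "s \<in> {0..s0}" and "x \<in> ball (0::real^'n) L"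
    then have x: "x \<in> B" unfolding B_def by simp
    have "euclidean_div (smear \<rho> \<delta> Y s) x = 0"
      by (rule euclidean_div_smear[OF \<rho>(1) \<delta>(1) oB oB c1Y inB[OF s] divY x])
    moreover have "frechet_derivative (local_field ?w (Z s)) (at x) = frechet_derivative (smear \<rho> \<delta> Y s) (at x)"
      by (rule frechet_derivative_cong_open[OF oB x]) (rule localZ)
    ultimately show "euclidean_div (local_field ?w (Z s)) x = 0" unfolding euclidean_div_def by simp
  next
    fix s G assume s: "s \<in> {0<..s0}" and G: "open G" "smooth_field_on A X G"
    have s': "s \<in> {0..s0}" "s > 0" using s by auto
    let ?S = "chart_map ?w ` (chart_dom ?w \<inter> (G \<union> U))"
    let ?Gw = "chart_map ?w ` (chart_dom ?w \<inter> G)"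
    have oS: "open ?S" and oG: "open ?Gw"
      using G(1) U(1) by (auto intro: open_chart_map_image[OF w])
    have SB: "?S \<subseteq> B" "?Gw \<subseteq> B" using chart_map_in[OF w] img by auto
    have smooth_Y: "smooth_on Y ?Gw" using G(2) w unfolding smooth_field_on_def Y_def by blast
    have "Ck_on k (smear \<rho> \<delta> Y s) ?S" for k
    proof (rule Ck_on_local)
      fix a assume a: "a \<in> ?S"
      show "\<exists>T. open T \<and> a \<in> T \<and> Ck_on k (smear \<rho> \<delta> Y s) (?S \<inter> T)"
      proof (cases "a \<in> Uw")
        case True
        have "cbox (a - (2 * (s * \<delta> a)) *\<^sub>R One) (a + (2 * (s * \<delta> a)) *\<^sub>R One) \<subseteq> B"
        proof
          fix y assume y: "y \<in> cbox (a - (2 * (s * \<delta> a)) *\<^sub>R One) (a + (2 * (s * \<delta> a)) *\<^sub>R One)"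
          have "norm (y - a) \<le> (\<Sum>b\<in>Basis. \<bar>(y - a) \<bullet> b\<bar>)" by (rule norm_le_l1)
          also have "\<dots> \<le> (\<Sum>b\<in>(Basis::(real^'n) set). 2 * (s * \<delta> a))"
            using y by (intro sum_mono) (auto simp: mem_box inner_diff_left inner_add_left abs_le_iff algebra_simps)
          also have "\<dots> = 2 * (s * \<delta> a * ?K)" by simp
          finally have "norm (y - a) \<le> 2 * (s0 * ?K)" using sK(1)[OF s'(1), of a] by linarith
          moreover have "norm a < l" using True Uwl by auto
          moreover have "norm y \<le> norm a + norm (y - a)" using norm_triangle_ineq[of a "y - a"] by simp
          ultimately have "norm y < L" using s0K lL by linarith
          then show "y \<in> B" unfolding B_def by simp
        qed
        moreover have "0 < s * \<delta> a" using True \<delta>(4) s'(2) by simp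
        moreover have "continuous_on B Y" by (rule Ck_on_imp_continuous_on[OF c1Y])
        ultimately obtain T where T: "open T" "a \<in> T" "smooth_on (smear \<rho> \<delta> Y s) T"
          using smear_smooth_where_positive[OF \<rho>(1,2) \<delta>(1) oB] by blast
        have "Ck_on k (smear \<rho> \<delta> Y s) T" using T(3) unfolding smooth_on_def by (rule spec)
        then have "Ck_on k (smear \<rho> \<delta> Y s) (?S \<inter> T)" by (rule Ck_on_mono[OF _ order_refl Int_lower2])
        then show ?thesis using T(1,2) by blast
      next
        case False
        then have "\<delta> a = 0" using \<delta>(2)[of a] \<delta>(4)[of a] by (simp add: less_le)
        have "a \<in> ?Gw" using a False unfolding Uw_def by blast
        then obtain e where e: "e > 0" "ball a e \<subseteq> ?Gw" using oG openE by blast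
        have cont: "continuous_on UNIV (\<lambda>x. s * \<delta> x * ?K)"
          by (intro continuous_intros smooth_on_imp_continuous_on[OF \<delta>(1)])
        \<comment> \<open>The radius vanishes at \<open>a\<close>, so close to \<open>a\<close> it is so small that only values of \<open>Y\<close> in the
          region \<open>?Gw\<close> of smoothness are averaged.\<close>
        define T where "T = ball a (e / 2) \<inter> {x. s * \<delta> x * ?K < e / 2}"
        have oT: "open T" unfolding T_def by (intro open_Int open_ball open_Collect_less cont continuous_on_const)
        have aT: "a \<in> T" unfolding T_def using e(1) \<open>\<delta> a = 0\<close> by simp
        have "Ck_family k (smear \<rho> \<delta> Y) {s} T"
        proof (rule Ck_family_smear[OF \<rho>(1) \<delta>(1) oT oG])
          show "Ck_on k Y ?Gw" using smooth_Y unfolding smooth_on_def by blast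
          fix t v x assume t: "t \<in> {s}" and v: "v \<in> cbox (- One) (One::real^'n)" and x: "x \<in> T"
          have "norm ((s * \<delta> x) *\<^sub>R v) \<le> s * \<delta> x * ?K"
            using norm_le_of_mem_cbox_One[OF v] sK(2)[OF s'(1), of x]
            by (simp only: norm_scaleR abs_of_nonneg) (intro mult_left_mono)
          moreover have "s * \<delta> x * ?K < e / 2" "dist a x < e / 2" using x unfolding T_def by auto
          moreover have "dist a (x + (s * \<delta> x) *\<^sub>R v) \<le> dist a x + norm ((s * \<delta> x) *\<^sub>R v)"
            using dist_triangle[of a "x + (s * \<delta> x) *\<^sub>R v" x] by (simp add: dist_norm)
          ultimately have "dist a (x + (s * \<delta> x) *\<^sub>R v) < e" by linarith
          then show "x + (t * \<delta> x) *\<^sub>R v \<in> ?Gw" using e(2) t by auto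
        qed
        then have "Ck_on k (smear \<rho> \<delta> Y s) T" by (rule Ck_family_member) simp
        then have "Ck_on k (smear \<rho> \<delta> Y s) (?S \<inter> T)" by (rule Ck_on_mono[OF _ order_refl Int_lower2])
        then show ?thesis using oT aT by blast
      qed
    qed
    moreover have "local_field ?w (Z s) x = smear \<rho> \<delta> Y s x" if "x \<in> ?S" for x
      by (rule localZ[OF subsetD[OF SB(1) that]])
    ultimately show "smooth_on (local_field ?w (Z s)) ?S"
      unfolding smooth_on_def using Ck_on_cong[OF oS, of "local_field ?w (Z s)" "smear \<rho> \<delta> Y s"] by simp
  qed
qed

lemma chart_map_dom: "chart_map c ` (chart_dom c \<inter> UNIV) = chart_img c"
  by (simp add: chart_img_def)

text \<open>
  Inside the domain of \<open>W i\<close>, the divergence vanishes in the conservative chart and hence in all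
  others; elsewhere it is that of \<open>X\<close>.
\<close>

lemma smoothing_family_divfree:
  assumes i: "i \<in> {1..m}" and X: "X \<in> divfree_fields A \<omega> r" and r: "r \<ge> 1"
    and vZ: "vector_field A Z" and eq: "\<And>p. p \<notin> chart_dom (V i) \<Longrightarrow> Z p = X p"
    and C: "\<And>c. c \<in> A \<Longrightarrow> Ck_on r (local_field c Z) (chart_img c)"
    and div: "\<And>x. x \<in> ball 0 L \<Longrightarrow> euclidean_div (local_field (W i) Z) x = 0"
  shows "Z \<in> divfree_fields A \<omega> r"
proof -
  note w = W_in[OF i]
  have diff: "local_field c Z differentiable at x" if "c \<in> A" "x \<in> chart_img c" for c x
    by (rule differentiableI[OF Ck_on_has_derivative[OF C[OF that(1)] _ that(2)]]) (use r in simp)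
  have "divergence A \<omega> c Z x = 0" if c: "c \<in> A" and x: "x \<in> chart_img c" for c x
  proof (cases "chart_inv c x \<in> chart_dom (W i)")
    case True
    then have o: "x \<in> overlap c (W i)" using x unfolding overlap_iff[OF c] by blast
    let ?y = "transition c (W i) x"
    have y: "?y \<in> chart_img (W i)" using transition_in[OF c w o] unfolding overlap_iff[OF w] by blast
    have 0: "divergence A \<omega> (W i) Z ?y = 0"
      using divergence_conservative[OF w y diff[OF w y] W_conservative[OF i]] div y W_img[OF i] by simp
    show ?thesis
      by (rule divergence_zero_change_chart[OF vZ c w o _ diff[OF c x] diff[OF w y] 0])
        (rule W_conservative[OF i])
  next
    case False
    let ?T = "chart_map c ` (chart_dom c \<inter> (- closure (chart_dom (V i))))"
    have T: "open ?T" by (rule open_chart_map_image[OF c]) auto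
    have xT: "x \<in> ?T" using x False V_closure[OF i] unfolding chart_map_image[OF c] by blast
    have loc: "local_field c Z y = local_field c X y" if "y \<in> ?T" for y
    proof -
      have "chart_inv c y \<notin> chart_dom (V i)"
        using that closure_subset unfolding chart_map_image[OF c] by blast
      then show ?thesis using eq unfolding local_field_def by simp
    qed
    have "frechet_derivative (\<lambda>y. density A \<omega> c y * local_field c Z y $ k) (at x) =
        frechet_derivative (\<lambda>y. density A \<omega> c y * local_field c X y $ k) (at x)" for k
      by (rule frechet_derivative_cong_open[OF T xT]) (simp only: loc)
    then have "divergence A \<omega> c Z x = divergence A \<omega> c X x" unfolding divergence_def by simp
    also have "\<dots> = 0" using X c x unfolding divfree_fields_def by simp
    finally show ?thesis .
  qed
  then show ?thesis
    unfolding divfree_fields_def Ck_field_on_def chart_map_dom using vZ C by simp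
qed

text \<open>
  All derivatives up to order \<open>r\<close> are continuous in \<open>(s, x)\<close> jointly, and the ball \<open>ball 0 l\<close> over which
  the norm takes its suprema has compact closure in the domain \<open>ball 0 L\<close>.
\<close>

lemma eventually_Cr_close:
  fixes Z :: "real \<Rightarrow> ('m, 'n) vfield" and s0 e :: real
  assumes vZ: "\<And>s. s \<in> {0..s0} \<Longrightarrow> vector_field A (Z s)" and "s0 > 0" "e > 0"
    and C: "\<And>c. c \<in> A \<Longrightarrow> Ck_family r (\<lambda>s. local_field c (Z s)) {0..s0} (chart_img c)"
  shows "\<forall>\<^sub>F s in at_right 0. Cr_close r (Z 0) (Z s) e"
proof -
  define BL where "BL = (\<Union>k\<le>r. basis_lists k :: (real^'n) list set)"
  have fin: "finite BL" unfolding BL_def by (intro finite_UN_I finite_basis_lists) auto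
  define \<eta> where "\<eta> = e / (real (card BL) + 1)"
  have \<eta>: "\<eta> > 0" unfolding \<eta>_def using assms(3) by simp
  have \<eta>e: "real (card BL) * \<eta> \<le> e" unfolding \<eta>_def using assms(3) by (simp add: field_simps)
  have CW: "Ck_family r (\<lambda>s. local_field (W j) (Z s)) {0..s0} (ball 0 L)" if "j \<in> {1..m}" for j
    using C[OF W_in[OF that]] unfolding W_img[OF that] .
  have "\<forall>\<^sub>F s in at_right 0. \<forall>j\<in>{1..m}. \<forall>bs\<in>BL. \<forall>x\<in>cball 0 l.
      norm (iter_deriv (local_field (W j) (Z s)) bs x - iter_deriv (local_field (W j) (Z 0)) bs x) \<le> \<eta>"
  proof (rule eventually_ball_finite[OF finite_atLeastAtMost], rule ballI,
      rule eventually_ball_finite[OF fin], rule ballI)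
    fix j bs assume j: "j \<in> {1..m}" and bs: "bs \<in> BL"
    have "length bs \<le> r" using bs unfolding BL_def basis_lists_def by auto
    then have "continuous_on ({0..s0} \<times> ball 0 L) (\<lambda>(s, x). iter_deriv (local_field (W j) (Z s)) bs x)"
      using CW[OF j] unfolding Ck_family_def by blast
    then have "continuous_on ({0..s0} \<times> cball 0 l) (\<lambda>(s, x). iter_deriv (local_field (W j) (Z s)) bs x)"
      by (rule continuous_on_subset) (use ball_subset_W_img[OF j] in blast)
    from uniform_small_at_zero[OF this compact_cball \<open>s0 > 0\<close> \<eta>]
    show "\<forall>\<^sub>F s in at_right 0. \<forall>x\<in>cball 0 l.
      norm (iter_deriv (local_field (W j) (Z s)) bs x - iter_deriv (local_field (W j) (Z 0)) bs x) \<le> \<eta>" .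
  qed
  moreover have "\<forall>\<^sub>F s in at_right 0. s \<in> {0..s0}"
    unfolding eventually_at_right_field using \<open>s0 > 0\<close> by (intro exI[of _ s0]) auto
  ultimately show ?thesis
  proof eventually_elim
    case (elim s)
    show ?case unfolding Cr_close_def
    proof (intro ballI allI impI)
      fix j and us :: "(real^'n) list" and x
      assume j: "j \<in> {1..m}" and us: "length us \<le> r \<and> set us \<subseteq> sphere 0 1" and x: "x \<in> ball (0::real^'n) l"
      let ?D = "\<lambda>x. local_field (W j) (Z s) x - local_field (W j) (Z 0) x"
      have C0: "Ck_on r (local_field (W j) (Z 0)) (ball 0 L)" and Cs: "Ck_on r (local_field (W j) (Z s)) (ball 0 L)"
        using Ck_family_member[OF CW[OF j], of 0] Ck_family_member[OF CW[OF j], of s] elim(2) \<open>s0 > 0\<close> by auto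
      then have CD: "Ck_on r ?D (ball 0 L)"
        unfolding Ck_on_iff_family by (intro Ck_family_diff open_ball)
      have xL: "x \<in> ball 0 L" using x ball_subset_W_img[OF j] by (auto simp: subset_iff)
      have "iter_deriv (local_field (V j) (field_diff (Z s) (Z 0))) us x = iter_deriv ?D us x"
        using vZ[OF elim(2)] vZ[of 0] \<open>s0 > 0\<close> local_field_V_eq_W[OF _ j]
        by (intro iter_deriv_cong_open[OF open_ball _ x]) (simp add: local_field_diff)
      also have "norm \<dots> \<le> prod_list (map norm us) * (\<Sum>bs\<in>basis_lists (length us). norm (iter_deriv ?D bs x))"
        by (rule norm_iter_deriv_le[OF open_ball CD _ xL]) (use us in simp)
      also have "prod_list (map norm us) = 1"
      proof -
        have "map norm us = replicate (length us) 1" using us by (intro replicate_eqI) auto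
        then show ?thesis by simp
      qed
      also have "1 * (\<Sum>bs\<in>basis_lists (length us). norm (iter_deriv ?D bs x)) \<le>
          (\<Sum>bs\<in>(basis_lists (length us) :: (real^'n) list set). \<eta>)"
        unfolding mult_1_left
      proof (rule sum_mono)
        fix bs :: "(real^'n) list" assume bs: "bs \<in> basis_lists (length us)"
        then have "bs \<in> BL" "length bs \<le> r" using us unfolding BL_def basis_lists_def by auto
        then show "norm (iter_deriv ?D bs x) \<le> \<eta>"
          using iter_deriv_diff[OF open_ball Cs C0 _ xL, of bs] elim(1) j x by simp
      qed
      also have "\<dots> \<le> real (card BL) * \<eta>"
      proof -
        have "basis_lists (length us) \<subseteq> BL" using us unfolding BL_def by blast
        then have "card (basis_lists (length us) :: (real^'n) list set) \<le> card BL" by (rule card_mono[OF fin])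
        then show ?thesis using \<eta> by simp
      qed
      also have "\<dots> \<le> e" by (rule \<eta>e)
      finally show "norm (iter_deriv (local_field (V j) (field_diff (Z s) (Z 0))) us x) \<le> e" .
    qed
  qed
qed

text \<open>
  The deformation, stopped at a time small enough for the required closeness, and transferred from
  the chart \<open>W i\<close> to all charts of the smooth structure.
\<close>

section \<open>Smoothing in all charts\<close>

lemma smoothing_step:
  assumes i: "i \<in> {1..m}" and U: "open U" "U \<subseteq> chart_dom (V i)"
    and X: "X \<in> divfree_fields A \<omega> r" and r: "r \<ge> 1" and e: "e > 0"
  shows "\<exists>Z \<in> divfree_fields A \<omega> r. Cr_close r X Z e \<and> (\<forall>p. p \<notin> U \<longrightarrow> Z p = X p) \<and>
    (\<forall>G. open G \<longrightarrow> smooth_field_on A X G \<longrightarrow> smooth_field_on A Z (G \<union> U))"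
proof -
  obtain s0 Z where Z: "smoothing_family i U r X s0 Z"
    using smoothing_family_exists[OF i U X r] by blast
  note 1 = Z[unfolded smoothing_family_def]
  note s0 = conjunct1[OF 1] and 2 = conjunct2[OF 1]
  note Z0 = conjunct1[OF 2] and 3 = conjunct2[OF 2]
  note vZ = conjunct1[OF 3, rule_format] and 4 = conjunct2[OF 3]
  note eq = conjunct1[OF 4, rule_format] and 5 = conjunct2[OF 4]
  note fam = conjunct1[OF 5] and 6 = conjunct2[OF 5]
  note div = conjunct1[OF 6, rule_format] and smooth = conjunct2[OF 6, rule_format]
  have eqV: "Z s p = X p" if "s \<in> {0..s0}" "p \<notin> chart_dom (V i)" for s p
    using eq[OF that(1)] that(2) U(2) by blast
  have C: "Ck_family r (\<lambda>s. local_field c (Z s)) {0..s0} (chart_img c)" if c: "c \<in> A" for c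
    unfolding chart_map_dom[symmetric]
  proof (rule chart_change_cover[OF i c open_UNIV vZ])
    show "Ck_family r (\<lambda>s. local_field (W i) (Z s)) {0..s0} (chart_map (W i) ` (chart_dom (W i) \<inter> UNIV))"
      unfolding chart_map_dom W_img[OF i] by (rule fam)
    show "Ck_on r (local_field c X) (chart_map c ` (chart_dom c \<inter> UNIV - closure (chart_dom (V i))))"
      by (rule Ck_on_mono[OF divfree_Ck[OF X c] order_refl]) (auto simp: chart_img_def)
  qed (auto intro: eqV)
  have "\<forall>\<^sub>F s in at_right 0. Cr_close r (Z 0) (Z s) e"
    by (rule eventually_Cr_close[OF vZ s0 e C])
  then obtain b where b: "b > 0" "\<And>s. 0 < s \<Longrightarrow> s < b \<Longrightarrow> Cr_close r (Z 0) (Z s) e"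
    unfolding eventually_at_right_field by blast
  define s where "s = min s0 (b / 2)"
  have s: "s \<in> {0<..s0}" "s \<in> {0..s0}" "0 < s" "s < b" unfolding s_def using s0 b(1) by auto
  show ?thesis
  proof (intro bexI[of _ "Z s"] conjI allI impI)
    show "Cr_close r X (Z s) e" using b(2)[OF s(3,4)] unfolding Z0 .
    show "Z s p = X p" if "p \<notin> U" for p by (rule eq[OF s(2) that])
    show "Z s \<in> divfree_fields A \<omega> r"
      by (rule smoothing_family_divfree[OF i X r vZ[OF s(2)] eqV[OF s(2)] Ck_family_member[OF C s(2)] div[OF s(2)]])
    fix G assume G: "open G" "smooth_field_on A X G"
    show "smooth_field_on A (Z s) (G \<union> U)"
      unfolding smooth_field_on_def smooth_on_def
    proof (intro ballI allI)
      fix c k assume c: "c \<in> A"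
      have "Ck_family k (\<lambda>t. local_field c (Z t)) {s} (chart_map c ` (chart_dom c \<inter> (G \<union> U)))"
      proof (rule chart_change_cover[OF i c])
        show oGU: "open (G \<union> U)" using G(1) U(1) by blast
        have "Ck_on k (local_field (W i) (Z s)) (chart_map (W i) ` (chart_dom (W i) \<inter> (G \<union> U)))"
          using smooth[OF s(1) G] unfolding smooth_on_def by blast
        from Ck_on_imp_family[OF this, of "{s}"]
        show "Ck_family k (\<lambda>t. local_field (W i) (Z t)) {s} (chart_map (W i) ` (chart_dom (W i) \<inter> (G \<union> U)))"
          by (rule Ck_family_eq[OF open_chart_map_image[OF W_in[OF i] oGU]]) simp
        have "Ck_on k (local_field c X) (chart_map c ` (chart_dom c \<inter> G))"
          using G(2) c unfolding smooth_field_on_def smooth_on_def by blast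
        moreover have "chart_dom c \<inter> (G \<union> U) - closure (chart_dom (V i)) \<subseteq> chart_dom c \<inter> G"
          using U(2) closure_subset by blast
        ultimately show "Ck_on k (local_field c X)
            (chart_map c ` (chart_dom c \<inter> (G \<union> U) - closure (chart_dom (V i))))"
          by (rule Ck_on_mono[OF _ order_refl image_mono])
      qed (use vZ eqV s(2) in auto)
      then show "Ck_on k (local_field c (Z s)) (chart_map c ` (chart_dom c \<inter> (G \<union> U)))"
        by (rule Ck_family_member) simp
    qed
  qed
qed

text \<open>
  The charts \<open>V 1, \<dots>, V m\<close> are treated one after the other. The smoothing step in one chart keeps
  the smoothness gained before, so after the last step the field is smooth on all of \<open>\<Omega>\<close>.
\<close>

lemma smoothing_on_open_set:
  assumes \<Omega>: "open \<Omega>" and X: "X \<in> divfree_fields A \<omega> r" and r: "r \<ge> 1" and e: "e > 0"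
  shows "\<exists>Z \<in> divfree_fields A \<omega> r. Cr_close r X Z e \<and> smooth_field_on A Z \<Omega> \<and> (\<forall>p \<in> - \<Omega>. Z p = X p)"
proof -
  define \<eta> where "\<eta> = e / (real m + 1)"
  have \<eta>: "\<eta> > 0" unfolding \<eta>_def using e by simp
  have "\<exists>Z \<in> divfree_fields A \<omega> r. Cr_close r X Z (real k * \<eta>) \<and>
      smooth_field_on A Z (\<Union>i\<in>{1..k}. \<Omega> \<inter> chart_dom (V i)) \<and> (\<forall>p \<in> - \<Omega>. Z p = X p)" if "k \<le> m" for k
    using that
  proof (induction k)
    case 0
    have "smooth_field_on A X {}" unfolding smooth_field_on_def smooth_on_def Ck_on_def by simp
    then show ?case using X Cr_close_refl[of 0 r X] by (intro bexI[of _ X]) auto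
  next
    case (Suc k)
    then obtain Y where Y: "Y \<in> divfree_fields A \<omega> r" "Cr_close r X Y (real k * \<eta>)"
      "smooth_field_on A Y (\<Union>i\<in>{1..k}. \<Omega> \<inter> chart_dom (V i))" "\<forall>p \<in> - \<Omega>. Y p = X p" by auto
    have i: "Suc k \<in> {1..m}" using Suc.prems by simp
    have oG: "open (\<Union>i\<in>{1..k}. \<Omega> \<inter> chart_dom (V i))"
      using \<Omega> open_chart_dom[OF V_in] Suc.prems by (intro open_UN ballI open_Int) auto
    obtain Z where Z: "Z \<in> divfree_fields A \<omega> r" "Cr_close r Y Z \<eta>"
      "\<forall>p. p \<notin> \<Omega> \<inter> chart_dom (V (Suc k)) \<longrightarrow> Z p = Y p"
      "\<forall>G. open G \<longrightarrow> smooth_field_on A Y G \<longrightarrow> smooth_field_on A Z (G \<union> (\<Omega> \<inter> chart_dom (V (Suc k))))"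
      using smoothing_step[OF i open_Int[OF \<Omega> open_chart_dom[OF V_in[OF i]]] Int_lower2 Y(1) r \<eta>]
      by (elim bexE conjE) (rule that)
    have "Cr_close r X Z (real (Suc k) * \<eta>)"
      using Cr_close_trans[OF X Y(1) Z(1) Y(2) Z(2)] by (simp add: distrib_right add.commute)
    moreover have "smooth_field_on A Z (\<Union>i\<in>{1..Suc k}. \<Omega> \<inter> chart_dom (V i))"
    proof -
      have "(\<Union>i\<in>{1..Suc k}. \<Omega> \<inter> chart_dom (V i)) =
          (\<Union>i\<in>{1..k}. \<Omega> \<inter> chart_dom (V i)) \<union> (\<Omega> \<inter> chart_dom (V (Suc k)))"
        by (auto simp: atLeastAtMostSuc_conv)
      then show ?thesis using Z(4) oG Y(3) by simp
    qed
    moreover have "\<forall>p \<in> - \<Omega>. Z p = X p" using Z(3) Y(4) by auto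
    ultimately show ?case using Z(1) by blast
  qed
  from this[of m] obtain Z where Z: "Z \<in> divfree_fields A \<omega> r" "Cr_close r X Z (real m * \<eta>)"
    "smooth_field_on A Z (\<Union>i\<in>{1..m}. \<Omega> \<inter> chart_dom (V i))" "\<forall>p \<in> - \<Omega>. Z p = X p" by auto
  have "(\<Union>i\<in>{1..m}. \<Omega> \<inter> chart_dom (V i)) = \<Omega>" using V_cover by blast
  moreover have "real m * \<eta> \<le> e" unfolding \<eta>_def using e by (simp add: field_simps)
  then have "Cr_close r X Z e" using Z(2) unfolding Cr_close_def by (meson order_trans)
  ultimately show ?thesis using Z by metis
qed

end

theorem theorem5:
  fixes A :: "('m::{t2_space, second_countable_topology}, 'n::finite) chart set"
    and \<omega> :: "('m, 'n) topform"
    and m :: nat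
    and V :: "nat \<Rightarrow> ('m, 'n) chart"
    and N \<Omega> :: "'m set"
    and r :: nat
    and X :: "('m, 'n) vfield"
    and \<epsilon> :: real
  assumes "CARD('n) \<ge> 2"
    and "compact (UNIV :: 'm set)"
    and "connected (UNIV :: 'm set)"
    and "smooth_structure A"
    and "orientable A"
    and "smooth_volume_form A \<omega>"
    and "conservative_atlas A \<omega> m V"
    and "regular_atlas A \<omega> m V"
    and "compact N"
    and "Ck_full_submanifold A 3 N"
    and "connected (mboundary A 3 N)"
    and "\<Omega> = minterior A 3 N \<or> collar_interior A N \<Omega>"
    and "r \<ge> 1"
    and "X \<in> divfree_fields A \<omega> r"
    and "\<epsilon> > 0"
  shows "\<exists>Z \<in> divfree_fields A \<omega> r.
    whitney_norm m V r (field_diff Z X) < \<epsilon> \<and>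
    smooth_field_on A Z \<Omega> \<and>
    (\<forall>p \<in> - \<Omega>. Z p = X p)"
proof -
  have at: "smooth_atlas A" using assms(4) unfolding smooth_structure_def by blast
  obtain W where W: "conservative_atlas A \<omega> m W" and VW: "\<forall>i\<in>{1..m}.
      closure (chart_dom (V i)) \<subseteq> chart_dom (W i) \<and>
      (\<forall>p\<in>chart_dom (V i). chart_map (W i) p = chart_map (V i) p)"
    using assms(8) unfolding regular_atlas_def by blast
  obtain l where l: "l > 0" "\<forall>i\<in>{1..m}. chart_img (V i) = ball 0 l"
    using assms(7) unfolding conservative_atlas_def by blast
  obtain L where L: "\<forall>i\<in>{1..m}. chart_img (W i) = ball 0 L"
    using W unfolding conservative_atlas_def by blast
  interpret conservative_regular_manifold A \<omega> m V W l L
  proof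
    show "smooth_atlas A" by (rule at)
    show "compact (UNIV :: 'm set)" by (rule assms(2))
    show "V i \<in> A" if "i \<in> {1..m}" for i using assms(7) that unfolding conservative_atlas_def by blast
    show "W i \<in> A" if "i \<in> {1..m}" for i using W that unfolding conservative_atlas_def by blast
    show "(\<Union>i\<in>{1..m}. chart_dom (V i)) = UNIV" using assms(7) unfolding conservative_atlas_def by blast
    show "push_form A \<omega> (W i) x u = canonical_form u" if "i \<in> {1..m}" "x \<in> chart_img (W i)" for i x u
      using W that unfolding conservative_atlas_def by blast
    show "chart_img (V i) = ball 0 l" if "i \<in> {1..m}" for i using l(2) that by blast
    show "chart_img (W i) = ball 0 L" if "i \<in> {1..m}" for i using L that by blast
    show "0 < l" by (rule l(1))
    show "closure (chart_dom (V i)) \<subseteq> chart_dom (W i)" if "i \<in> {1..m}" for i using VW that by blast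
    show "chart_map (W i) p = chart_map (V i) p" if "i \<in> {1..m}" "p \<in> chart_dom (V i)" for i p
      using VW that by blast
  qed
  have "open \<Omega>"
    using assms(12) minterior_eq_interior[OF assms(10)] open_collar_interior[OF at] by auto
  \<comment> \<open>Half of \<open>\<epsilon>\<close>, because the estimate of the norm is not strict.\<close>
  from smoothing_on_open_set[OF this assms(14,13) half_gt_zero[OF assms(15)]]
  obtain Z where Z: "Z \<in> divfree_fields A \<omega> r" "Cr_close r X Z (\<epsilon> / 2)" "smooth_field_on A Z \<Omega>"
    "\<forall>p \<in> - \<Omega>. Z p = X p" by blast
  have "whitney_norm m V r (field_diff Z X) < \<epsilon>"
    using whitney_norm_le[OF Z(2)] assms(15) by linarith
  then show ?thesis using Z by blast
qed
end
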